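(* Let $0<p\le1$ and $\rho<\rho^*(p)$. There exist constants $0<c_4<1$ and $c_5>0$ such that whenever $\alpha=m/n>c_4$ and $n$ is sufficiently large, with probability at least $1-e^{-c_5n}$ an $m\times n$ matrix $A$ with i.i.d. $\mathcal N(0,1)$ entries has the property: every $\mathbf x\in\mathbb R^n$ whose support $T$ satisfies $|T|\le\rho n$ is the unique solution of $\min\{\|\mathbf v\|_p^p: A\mathbf v=A\mathbf x\}$.
   Context: $\|\mathbf v\|_p^p=\sum_i|v_i|^p$; the support of $\mathbf x$ is $\{i:x_i\ne0\}$. Let $f(z)=\sqrt{2/\pi}\,e^{-z^2/2}$ for $z\ge0$; $z^*(p)>0$ satisfies $\int_0^{z^*}x^pf(x)\,dx=\int_{z^*}^\infty x^pf(x)\,dx$ and $\rho^*(p)=1-\operatorname{erf}(z^*(p)/\sqrt2)$. *)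

theory Defs
  imports "HOL-Probability.Probability"
begin

text \<open>Half-normal density f(z) = sqrt(2/pi) exp(-z^2/2), used for z >= 0.\<close>
definition fhn :: "real \<Rightarrow> real" where
  "fhn z = sqrt (2 / pi) * exp (- z\<^sup>2 / 2)"

definition erf :: "real \<Rightarrow> real" where
  "erf x = 2 / sqrt pi * (LBINT t=0..x. exp (- t\<^sup>2))"

definition z_star :: "real \<Rightarrow> real" where
  "z_star p = (THE z. z > 0 \<and>
      (LBINT x=0..z. x powr p * fhn x) = (LBINT x=ereal z..\<infinity>. x powr p * fhn x))"

definition rho_star :: "real \<Rightarrow> real" where
  "rho_star p = 1 - erf (z_star p / sqrt 2)"

definition gauss_matrix :: "nat \<Rightarrow> nat \<Rightarrow> (nat \<times> nat \<Rightarrow> real) measure" where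
  "gauss_matrix m n = PiM ({..<m} \<times> {..<n}) (\<lambda>_. density lborel std_normal_density)"

definition lpp :: "real \<Rightarrow> nat \<Rightarrow> (nat \<Rightarrow> real) \<Rightarrow> real" where
  "lpp p n v = (\<Sum>i<n. \<bar>v i\<bar> powr p)"

definition mat_vec :: "nat \<Rightarrow> nat \<Rightarrow> (nat \<times> nat \<Rightarrow> real) \<Rightarrow> (nat \<Rightarrow> real) \<Rightarrow> (nat \<Rightarrow> real)" where
  "mat_vec m n A v = (\<lambda>j. if j < m then (\<Sum>i<n. A (j, i) * v i) else 0)"

definition lp_recovers :: "real \<Rightarrow> real \<Rightarrow> nat \<Rightarrow> nat \<Rightarrow> (nat \<times> nat \<Rightarrow> real) \<Rightarrow> bool" where
  "lp_recovers p \<rho> m n A \<longleftrightarrow>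
     (\<forall>x. (\<forall>i\<ge>n. x i = 0) \<and> real (card {i. i < n \<and> x i \<noteq> 0}) \<le> \<rho> * real n \<longrightarrow>
        (\<forall>v. (\<forall>i\<ge>n. v i = 0) \<and> mat_vec m n A v = mat_vec m n A x \<and> v \<noteq> x
             \<longrightarrow> lpp p n x < lpp p n v))"

end

theory Submission
  imports Defs
begin

text \<open>
  By the triangle inequality for \<open>t \<mapsto> \<bar>t\<bar> powr p\<close>, recovery fails only if the null space of \<open>A\<close> contains a vector that carries
  at least half of its \<open>p\<close>-mass on some \<open>\<rho> n\<close> coordinates. Such vectors form a cone \<open>K\<close>. Since \<open>\<rho> < \<rho>\<^sup>*\<close>, a Chernoff bound for
  \<open>\<bar>\<bar>h\<bar> powr p - \<tau>\<bar> - \<tau>\<close> with \<open>\<tau> = z\<^sup>* powr p\<close> shows that a standard Gaussian vector lies in a fixed enlargement of \<open>K\<close> only with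
  probability \<open>exp (- a n)\<close>.

  Let \<open>X\<close> be the orthogonal projection of an independent Gaussian vector \<open>h\<close> onto the null space. The direction of \<open>X\<close> is rotation invariant,
  so \<open>X\<close> is no more likely than \<open>h\<close> to meet a cone, up to a slight enlargement of the cone. On the other hand, if
  the null space contains a unit vector \<open>v\<close> of \<open>K\<close>, then shifting \<open>h\<close> by \<open>s v\<close> with \<open>s\<^sup>2 = b n\<close> changes its density by a factor of only about
  \<open>exp (- s\<^sup>2)\<close>, while the unshifted projection has squared norm of order \<open>n - m\<close>, much smaller than \<open>s\<^sup>2\<close> when \<open>m / n\<close> is near 1. Hence \<open>X\<close> is close to
  \<open>s v\<close>, and so in the enlarged cone, with conditional probability at least about \<open>exp (- b n)\<close>. For \<open>b < a\<close>
  Markov's inequality bounds the probability that the null space meets \<open>K\<close>.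
\<close>

section \<open>Euclidean vectors, Gram-Schmidt projections and plane rotations\<close>

text \<open>Two unions have to be avoided, one over exponentially many supports and one over a
  continuum of null vectors. The supports \<open>T\<close> are removed by a Lagrange multiplier: if
  a vector has half of its mass on some small \<open>T\<close>, then an i.i.d. sum that does not
  mention \<open>T\<close> is nonnegative, and, up to the slack, \<open>\<tau>\<close> is the
  multiplier for which the mean of this sum is negative exactly below the threshold. The null
  vectors are removed by a single random test vector in the null space. The constants are forced in
  a fixed order: the Chernoff rate and its slack \<open>\<eta>\<close>; then
  \<open>\<epsilon>\<close>, so that two enlargements of the cone, for the projection noise and for
  the cap, stay within \<open>\<eta>\<close>; then the shift energy \<open>b\<close>, paid for by
  the Chernoff rate; and last the fraction of missing rows, so that the noise is small against the
  shift. Rotation invariance is used only through rotations of coordinate planes: these reduce it to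
  a two-dimensional integral and still connect all directions. Vectors are functions on
  \<open>nat\<close> of which the inner product reads only the values below \<open>n\<close>, so
  several equations are stated for these indices alone.\<close>

definition ip :: "nat \<Rightarrow> (nat \<Rightarrow> real) \<Rightarrow> (nat \<Rightarrow> real) \<Rightarrow> real" where
  "ip n x y = (\<Sum>i<n. x i * y i)"

lemma ip_commute: "ip n x y = ip n y x"
  by (simp add: ip_def mult.commute)

lemma ip_scale_left: "ip n (\<lambda>i. c * x i) y = c * ip n x y"
  by (simp add: ip_def sum_distrib_left mult.assoc)

lemma ip_scale_right: "ip n x (\<lambda>i. c * y i) = c * ip n x y"
  by (metis ip_commute ip_scale_left)

lemma ip_diff_scale_left: "ip n (\<lambda>i. x i - c * y i) z = ip n x z - c * ip n y z"
  by (simp add: ip_def sum_subtractf sum_distrib_left algebra_simps)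

lemma ip_diff_scale_right: "ip n z (\<lambda>i. x i - c * y i) = ip n z x - c * ip n z y"
  by (metis ip_commute ip_diff_scale_left)

lemma ip_self_nonneg [simp]: "0 \<le> ip n x x"
  by (simp add: ip_def sum_nonneg)

lemma ip_self_eq_0_iff: "ip n x x = 0 \<longleftrightarrow> (\<forall>i<n. x i = 0)"
  by (auto simp: ip_def sum_nonneg_eq_0_iff)

lemma ip_self_pos_iff: "0 < ip n x x \<longleftrightarrow> (\<exists>i<n. x i \<noteq> 0)"
  using ip_self_eq_0_iff[of n x] ip_self_nonneg[of n x] by (auto simp: less_le)

lemma ip_self_eq_0D: "ip n x x = 0 \<Longrightarrow> ip n y x = 0"
  by (auto simp: ip_self_eq_0_iff) (simp add: ip_def)

lemma ip_cong: "(\<And>i. i < n \<Longrightarrow> x i = x' i) \<Longrightarrow> (\<And>i. i < n \<Longrightarrow> y i = y' i) \<Longrightarrow> ip n x y = ip n x' y'"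
  by (simp add: ip_def)

text \<open>If the new vector \<open>gs_proj n A j (A j)\<close> vanishes, then the quotient is 0 and the step changes nothing,
  so linear dependence of the rows needs no separate treatment.\<close>

fun gs_proj :: "nat \<Rightarrow> (nat \<Rightarrow> nat \<Rightarrow> real) \<Rightarrow> nat \<Rightarrow> (nat \<Rightarrow> real) \<Rightarrow> nat \<Rightarrow> real" where
  "gs_proj n A 0 x = x"
| "gs_proj n A (Suc j) x =
     (\<lambda>i. gs_proj n A j x i - ip n x (gs_proj n A j (A j)) / ip n (gs_proj n A j (A j)) (gs_proj n A j (A j))
            * gs_proj n A j (A j) i)"

lemma gs_proj_linear:
  "gs_proj n A j (\<lambda>i. x i - c * y i) = (\<lambda>i. gs_proj n A j x i - c * gs_proj n A j y i)"
proof (induction j)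
  case (Suc j)
  define b where "b = gs_proj n A j (A j)"
  show ?case
    by (simp add: Suc b_def[symmetric] ip_diff_scale_left diff_divide_distrib algebra_simps)
qed simp

text \<open>Each step subtracts a symmetric map of rank at most one, the projection onto
  \<open>b\<close>. The recursion pairs \<open>b\<close> with \<open>x\<close> itself instead of the
  current residual, which makes the symmetry visible; both pairings agree because \<open>b\<close>
  lies in the range of the previous projection.\<close>

lemma gs_proj_symmetric: "ip n (gs_proj n A j x) y = ip n x (gs_proj n A j y)"
proof (induction j arbitrary: x y)
  case (Suc j)
  define b where "b = gs_proj n A j (A j)"
  show ?case
    by (simp add: b_def[symmetric] ip_diff_scale_left ip_diff_scale_right Suc ip_commute[of n b y]
        del: times_divide_eq_left) simp
qed simp

text \<open>\<open>b\<close> is fixed by the previous projection, so by symmetry that projection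
  does not change inner products with \<open>b\<close>, and the new residual is orthogonal to
  \<open>b\<close>. If \<open>ip n b b = 0\<close>, every inner product with \<open>b\<close> is 0
  anyway.\<close>

lemma gs_proj_idem: "i < n \<Longrightarrow> gs_proj n A j (gs_proj n A j x) i = gs_proj n A j x i"
proof (induction j arbitrary: x i)
  case (Suc j)
  define b where "b = gs_proj n A j (A j)"
  have bb: "gs_proj n A j b i = b i" if "i < n" for i
    using Suc that by (simp add: b_def)
  have *: "ip n x b = 0" if "ip n b b = 0" for x using that by (rule ip_self_eq_0D)
  have "ip n (gs_proj n A j x) b = ip n x b"
    unfolding gs_proj_symmetric by (rule ip_cong) (use bb in auto)
  then have "ip n (gs_proj n A (Suc j) x) b = ip n x b - ip n x b / ip n b b * ip n b b"
    by (simp add: b_def[symmetric] ip_diff_scale_left del: times_divide_eq_left)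
  then have "ip n (gs_proj n A (Suc j) x) b = 0"
    using * by auto
  moreover have "gs_proj n A j (gs_proj n A (Suc j) x) i = gs_proj n A (Suc j) x i" if "i < n" for i
    using Suc.IH[OF that] bb[OF that] by (simp add: gs_proj_linear b_def[symmetric] del: times_divide_eq_left)
  ultimately show ?case
    using Suc.prems by (simp add: b_def[symmetric] del: gs_proj.simps(2) add: gs_proj.simps(2)[of n A j "gs_proj n A (Suc j) x"])
qed simp

lemma gs_proj_ip_self: "ip n (gs_proj n A j x) (gs_proj n A j x) = ip n x (gs_proj n A j x)"
  unfolding gs_proj_symmetric by (rule ip_cong) (auto simp: gs_proj_idem)

lemma gs_proj_norm_Suc:
  defines "b \<equiv> \<lambda>n A j. gs_proj n A j (A j)"
  shows "ip n (gs_proj n A (Suc j) x) (gs_proj n A (Suc j) x) =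
    ip n (gs_proj n A j x) (gs_proj n A j x) - (ip n x (b n A j))\<^sup>2 / ip n (b n A j) (b n A j)"
  unfolding gs_proj_ip_self
  by (simp add: ip_diff_scale_right b_def power2_eq_square del: times_divide_eq_left) simp

text \<open>Null vectors of the matrix are fixed, so a shift of \<open>h\<close> along such a vector
  passes through the projection unchanged.\<close>

lemma gs_proj_fix:
  "(\<And>i. i < j \<Longrightarrow> ip n (A i) v = 0) \<Longrightarrow> gs_proj n A j v = v"
proof (induction j)
  case (Suc j)
  then have *: "gs_proj n A j v = v" by simp
  then have "ip n v (gs_proj n A j (A j)) = 0"
    using Suc.prems[of j] by (simp add: gs_proj_symmetric[symmetric] ip_commute)
  with * show ?case by simp
qed simp

lemma gs_proj_cong: "(\<And>i. i < j \<Longrightarrow> A i = A' i) \<Longrightarrow> gs_proj n A j x = gs_proj n A' j x"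
  by (induction j arbitrary: x) auto

section \<open>Plane rotations and their action on directions\<close>

definition plane_rot :: "nat \<Rightarrow> nat \<Rightarrow> real \<Rightarrow> real \<Rightarrow> (nat \<Rightarrow> real) \<Rightarrow> nat \<Rightarrow> real" where
  "plane_rot a b c s x = x(a := c * x a - s * x b, b := s * x a + c * x b)"

lemma plane_rot_ip:
  assumes "a \<noteq> b" "a < n" "b < n" "c\<^sup>2 + s\<^sup>2 = 1"
  shows "ip n (plane_rot a b c s x) (plane_rot a b c s y) = ip n x y"
proof -
  have split: "(\<Sum>i<n. f i) = f a + f b + (\<Sum>i\<in>{..<n}-{a,b}. f i)" for f :: "nat \<Rightarrow> real"
  proof -
    have "(\<Sum>i<n. f i) = f a + (\<Sum>i\<in>{..<n}-{a}. f i)"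
      using assms by (intro sum.remove) auto
    also have "(\<Sum>i\<in>{..<n}-{a}. f i) = f b + (\<Sum>i\<in>{..<n}-{a}-{b}. f i)"
      using assms by (intro sum.remove) auto
    also have "{..<n}-{a}-{b} = {..<n}-{a,b}" by auto
    finally show ?thesis by (simp add: add.assoc)
  qed
  have "(\<Sum>i\<in>{..<n}-{a,b}. plane_rot a b c s x i * plane_rot a b c s y i) = (\<Sum>i\<in>{..<n}-{a,b}. x i * y i)"
    by (rule sum.cong) (auto simp: plane_rot_def)
  moreover have "plane_rot a b c s x a * plane_rot a b c s y a + plane_rot a b c s x b * plane_rot a b c s y b
     = (c\<^sup>2 + s\<^sup>2) * (x a * y a + x b * y b)"
    using assms(1) by (simp add: plane_rot_def algebra_simps power2_eq_square)
  ultimately show ?thesis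
    using assms(4) by (simp add: ip_def split)
qed

lemma plane_rot_linear:
  "plane_rot a b c s (\<lambda>i. x i - k * y i) = (\<lambda>i. plane_rot a b c s x i - k * plane_rot a b c s y i)"
  by (auto simp: plane_rot_def fun_eq_iff algebra_simps)

text \<open>The recursion is built from inner products and linear combinations only, and plane
  rotations preserve both.\<close>

lemma gs_proj_plane_rot:
  assumes "a \<noteq> b" "a < n" "b < n" "c\<^sup>2 + s\<^sup>2 = 1"
  shows "gs_proj n (\<lambda>j. plane_rot a b c s (A j)) j (plane_rot a b c s x) = plane_rot a b c s (gs_proj n A j x)"
proof (induction j arbitrary: x)
  case (Suc j)
  show ?case by (simp add: Suc plane_rot_ip[OF assms] plane_rot_linear del: times_divide_eq_left)
qed simp

text \<open>Plane rotations and positive scalings act transitively on nonzero vectors: rotating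
  coordinate 0 against each other coordinate in turn clears the latter, and a positive multiple of
  the first basis vector remains. For \<open>n = 1\<close> no rotation could repair the sign, hence
  \<open>2 \<le> n\<close>.\<close>

lemma rot_invariant_const:
  fixes \<phi> :: "(nat \<Rightarrow> real) \<Rightarrow> 'a"
  assumes n: "2 \<le> n"
    and rot: "\<And>a b c s y. a \<noteq> b \<Longrightarrow> a < n \<Longrightarrow> b < n \<Longrightarrow> c\<^sup>2 + s\<^sup>2 = 1 \<Longrightarrow> \<phi> (plane_rot a b c s y) = \<phi> y"
    and cong: "\<And>y y'. (\<And>i. i < n \<Longrightarrow> y i = y' i) \<Longrightarrow> \<phi> y = \<phi> y'"
    and scale: "\<And>y t. t > 0 \<Longrightarrow> \<phi> (\<lambda>i. t * y i) = \<phi> y"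
    and y: "0 < ip n y y" and y': "0 < ip n y' y'"
  shows "\<phi> y = \<phi> y'"
proof -
  have *: "\<phi> y = \<phi> (\<lambda>i. if i = 0 then 1 else 0)" if y: "0 < ip n y y" for y
  proof -
    \<comment> \<open>The sign is asserted only after at least one rotation: a rotation leaves
      \<open>r \<ge> 0\<close> in coordinate 0, while the initial vector can have either sign
      there.\<close>
    have "\<exists>z. \<phi> z = \<phi> y \<and> ip n z z = ip n y y \<and> (\<forall>i. 1 \<le> i \<and> i \<le> j \<longrightarrow> z i = 0) \<and> (1 \<le> j \<longrightarrow> 0 \<le> z 0)"
      if "j < n" for j using that
    proof (induction j)
      case 0 then show ?case by (intro exI[of _ y]) auto
    next
      case (Suc j)
      then obtain z where z: "\<phi> z = \<phi> y" "ip n z z = ip n y y" "\<forall>i. 1 \<le> i \<and> i \<le> j \<longrightarrow> z i = 0" by auto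
      define r where "r = sqrt ((z 0)\<^sup>2 + (z (Suc j))\<^sup>2)"
      \<comment> \<open>If \<open>r = 0\<close>, both coordinates already vanish and the identity
        rotation serves.\<close>
      define c where "c = (if r = 0 then 1 else z 0 / r)"
      define s where "s = (if r = 0 then 0 else - z (Suc j) / r)"
      have r2: "r\<^sup>2 = (z 0)\<^sup>2 + (z (Suc j))\<^sup>2" by (simp add: r_def)
      have r0: "z 0 = 0 \<and> z (Suc j) = 0" if "r = 0"
        using r2 that by (simp add: sum_power2_eq_zero_iff)
      have cs: "c\<^sup>2 + s\<^sup>2 = 1"
        using r2 by (auto simp: c_def s_def power_divide simp flip: add_divide_distrib)
      have e1: "c * z 0 - s * z (Suc j) = r"
        using r0 r2 by (auto simp: c_def s_def power2_eq_square divide_simps)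
      have e2: "s * z 0 + c * z (Suc j) = 0"
        using r0 by (auto simp: c_def s_def)
      have "r \<ge> 0" by (simp add: r_def)
      define z' where "z' = z(0 := r, Suc j := 0)"
      have *: "plane_rot 0 (Suc j) c s z = z'"
        by (simp add: plane_rot_def e1 e2 z'_def)
      have z': "z' 0 = r" "\<forall>i. 1 \<le> i \<and> i \<le> Suc j \<longrightarrow> z' i = 0"
        using z(3) by (auto simp: z'_def)
      show ?case
        using z(1,2) z' rot[of 0 "Suc j" c s z] plane_rot_ip[of 0 "Suc j" n c s z z] Suc.prems cs \<open>r \<ge> 0\<close>
        by (intro exI[of _ z']) (simp add: *)
    qed
    from this[of "n-1"] n obtain z where z: "\<phi> z = \<phi> y" "ip n z z = ip n y y"
      "\<And>i. 1 \<le> i \<Longrightarrow> i \<le> n-1 \<Longrightarrow> z i = 0" "0 \<le> z 0" by auto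
    have "z 0 \<noteq> 0"
    proof
      assume "z 0 = 0"
      then have "\<forall>i<n. z i = 0" using z(3) by (metis Suc_leI Suc_pred diff_Suc_1 less_Suc_eq_le n not_gr_zero not_less_eq_eq le_zero_eq One_nat_def)
      then show False using z(2) y by (simp flip: ip_self_eq_0_iff)
    qed
    then have pos: "z 0 > 0" using z(4) by simp
    have "\<phi> y = \<phi> (\<lambda>i. z 0 * (if i = 0 then 1 else 0))"
      unfolding z(1)[symmetric] by (rule cong) (use z(3) in auto)
    also have "\<dots> = \<phi> (\<lambda>i. if i = 0 then 1 else 0)" by (rule scale[OF pos])
    finally show ?thesis .
  qed
  show ?thesis using *[OF y] *[OF y'] by simp
qed

section \<open>The standard Gaussian measure and its symmetries\<close>

definition std_gauss :: "real measure" where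
  "std_gauss = density lborel std_normal_density"

definition gauss_vec :: "nat \<Rightarrow> (nat \<Rightarrow> real) measure" where
  "gauss_vec n = PiM {..<n} (\<lambda>_. std_gauss)"

lemma sets_std_gauss [measurable_cong, simp]: "sets std_gauss = sets borel"
  by (simp add: std_gauss_def)

lemma space_std_gauss [simp]: "space std_gauss = UNIV"
  by (simp add: std_gauss_def)

lemma prob_space_std_gauss: "prob_space std_gauss"
  unfolding std_gauss_def by (rule prob_space_normal_density) simp

interpretation SG: product_prob_space "\<lambda>_. std_gauss" I for I :: "'i set"
  by (simp add: product_prob_spaceI prob_space_std_gauss)

lemma prob_space_gauss_vec: "prob_space (gauss_vec n)"
  unfolding gauss_vec_def by (rule prob_space_PiM) (rule prob_space_std_gauss)

lemma nn_integral_std_gauss: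
  "f \<in> borel_measurable borel \<Longrightarrow> (\<integral>\<^sup>+x. f x \<partial>std_gauss) = (\<integral>\<^sup>+x. ennreal (std_normal_density x) * f x \<partial>lborel)"
  unfolding std_gauss_def by (subst nn_integral_density) auto

text \<open>One-dimensional Cameron-Martin formula: the exponential is the quotient of the shifted
  and the original density.\<close>

lemma nn_integral_std_gauss_shift:
  assumes [measurable]: "f \<in> borel_measurable borel"
  shows "(\<integral>\<^sup>+x. f (x + c) \<partial>std_gauss) = (\<integral>\<^sup>+x. f x * ennreal (exp (c * x - c\<^sup>2 / 2)) \<partial>std_gauss)"
proof -
  have *: "std_normal_density (x - c) = std_normal_density x * exp (c * x - c\<^sup>2 / 2)" for x
  proof -
    have "- (x - c)\<^sup>2 / 2 = - x\<^sup>2 / 2 + (c * x - c\<^sup>2 / 2)" by (simp add: power2_eq_square field_simps)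
    then show ?thesis unfolding std_normal_density_def by (simp only: exp_add)
  qed
  have "(\<integral>\<^sup>+x. f (x + c) \<partial>std_gauss) = (\<integral>\<^sup>+x. ennreal (std_normal_density x) * f (x + c) \<partial>lborel)"
    by (simp add: nn_integral_std_gauss)
  also have "\<dots> = (\<integral>\<^sup>+x. ennreal (std_normal_density (x - c)) * f x \<partial>lborel)"
    by (subst nn_integral_real_affine[where c=1 and t="-c"]) auto
  also have "\<dots> = (\<integral>\<^sup>+x. f x * ennreal (exp (c * x - c\<^sup>2 / 2)) \<partial>std_gauss)"
    unfolding * by (subst nn_integral_std_gauss, measurable) (auto intro!: nn_integral_cong simp: ennreal_mult mult_ac)
  finally show ?thesis .
qed

text \<open>The density of a Gaussian pair depends on x^2 + y^2 only, so the claim is one about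
  planar Lebesgue measure. Two one-dimensional affine substitutions with an exchange of the
  integrals in between prove it; their Jacobians cancel.\<close>

lemma nn_integral_std_gauss_rot:
  assumes f[measurable]: "(\<lambda>(x, y). f x y) \<in> borel_measurable (borel \<Otimes>\<^sub>M borel)"
    and cs: "c\<^sup>2 + s\<^sup>2 = 1"
  shows "(\<integral>\<^sup>+x. \<integral>\<^sup>+y. f (c * x - s * y) (s * x + c * y) \<partial>std_gauss \<partial>std_gauss)
       = (\<integral>\<^sup>+x. \<integral>\<^sup>+y. f x y \<partial>std_gauss \<partial>std_gauss)"
proof -
  define G where "G x y = ennreal (std_normal_density x * std_normal_density y) * f x y" for x y
  have G[measurable]: "(\<lambda>(x, y). G x y) \<in> borel_measurable (borel \<Otimes>\<^sub>M borel)"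
    unfolding G_def by measurable
  have G1[measurable]: "(\<lambda>x. G (g x) (h x)) \<in> borel_measurable M"
    if [measurable]: "g \<in> borel_measurable M" "h \<in> borel_measurable M" for g h and M :: "'a measure"
    using measurable_compose[OF measurable_Pair[OF that] G] by simp
  have f1[measurable]: "(\<lambda>x. f (g x) (h x)) \<in> borel_measurable M"
    if [measurable]: "g \<in> borel_measurable M" "h \<in> borel_measurable M" for g h and M :: "'a measure"
    using measurable_compose[OF measurable_Pair[OF that] f] by simp
  have f2[measurable]: "(\<lambda>x. f (g x) (h x)) \<in> borel_measurable M"
    if [measurable]: "g \<in> borel_measurable M" "h \<in> borel_measurable M" for g h and M :: "('a \<times> 'b) measure"
    using measurable_compose[OF measurable_Pair[OF that] f] by simp
  have G2[measurable]: "(\<lambda>x. G (g x) (h x)) \<in> borel_measurable M"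
    if [measurable]: "g \<in> borel_measurable M" "h \<in> borel_measurable M" for g h and M :: "('a \<times> 'b) measure"
    using measurable_compose[OF measurable_Pair[OF that] G] by simp
  have inv: "std_normal_density (c * x - s * y) * std_normal_density (s * x + c * y)
     = std_normal_density x * std_normal_density y" for x y
  proof -
    have "(c * x - s * y)\<^sup>2 + (s * x + c * y)\<^sup>2 = (c\<^sup>2 + s\<^sup>2) * (x\<^sup>2 + y\<^sup>2)"
      by (simp add: power2_eq_square algebra_simps)
    then have "exp (- (c * x - s * y)\<^sup>2 / 2) * exp (- (s * x + c * y)\<^sup>2 / 2) = exp (- x\<^sup>2 / 2) * exp (- y\<^sup>2 / 2)"
      using cs by (simp flip: exp_add add: field_simps)
    then show ?thesis by (simp add: std_normal_density_def field_simps)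
  qed
  have lhs: "(\<integral>\<^sup>+x. \<integral>\<^sup>+y. f (c * x - s * y) (s * x + c * y) \<partial>std_gauss \<partial>std_gauss)
      = (\<integral>\<^sup>+x. \<integral>\<^sup>+y. G (c * x - s * y) (s * x + c * y) \<partial>lborel \<partial>lborel)"
    by (subst nn_integral_std_gauss, measurable)
       (auto simp: nn_integral_std_gauss G_def inv nn_integral_cmult[symmetric] ennreal_mult mult.assoc intro!: nn_integral_cong )
  have rhs: "(\<integral>\<^sup>+x. \<integral>\<^sup>+y. f x y \<partial>std_gauss \<partial>std_gauss) = (\<integral>\<^sup>+x. \<integral>\<^sup>+y. G x y \<partial>lborel \<partial>lborel)"
    by (subst nn_integral_std_gauss, measurable)
       (auto simp: nn_integral_std_gauss G_def nn_integral_cmult[symmetric] ennreal_mult mult_ac intro!: nn_integral_cong)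
  have "(\<integral>\<^sup>+x. \<integral>\<^sup>+y. G (c * x - s * y) (s * x + c * y) \<partial>lborel \<partial>lborel) = (\<integral>\<^sup>+x. \<integral>\<^sup>+y. G x y \<partial>lborel \<partial>lborel)"
  \<comment> \<open>The substitutions divide by \<open>c\<close>. A rotation with
    \<open>c = 0\<close> is a quarter turn, that is, a reflection and an exchange of the
    variables.\<close>
  proof (cases "c = 0")
    case False
    \<comment> \<open>At fixed \<open>y\<close> the new variable is
      \<open>u = c * x - s * y\<close>; the second coordinate is then
      \<open>(s * u + y) / c\<close>, again affine in \<open>y\<close>.\<close>
    have e: "c * (s * y / c + 1 / c * u) - s * y = u" "s * (s * y / c + 1 / c * u) + c * y = (s * u + y) / c" for u y
    proof -
      show "c * (s * y / c + 1 / c * u) - s * y = u" using False by (simp add: field_simps)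
      have "s * (s * y / c + 1 / c * u) + c * y = (s * u + (c\<^sup>2 + s\<^sup>2) * y) / c"
        using False by (simp add: field_simps power2_eq_square)
      then show "s * (s * y / c + 1 / c * u) + c * y = (s * u + y) / c" by (simp add: cs)
    qed
    have "(\<integral>\<^sup>+x. \<integral>\<^sup>+y. G (c * x - s * y) (s * x + c * y) \<partial>lborel \<partial>lborel)
        = (\<integral>\<^sup>+y. \<integral>\<^sup>+x. G (c * x - s * y) (s * x + c * y) \<partial>lborel \<partial>lborel)"
      by (rule lborel_pair.Fubini') measurable
    also have "\<dots> = (\<integral>\<^sup>+y. ennreal (1 / \<bar>c\<bar>) * (\<integral>\<^sup>+u. G u ((s * u + y) / c) \<partial>lborel) \<partial>lborel)"
    proof (intro nn_integral_cong)
      fix y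
      show "(\<integral>\<^sup>+x. G (c * x - s * y) (s * x + c * y) \<partial>lborel) = ennreal (1 / \<bar>c\<bar>) * (\<integral>\<^sup>+u. G u ((s * u + y) / c) \<partial>lborel)"
        using False by (subst nn_integral_real_affine[where c="1/c" and t="s * y / c"])
          (measurable, simp only: e, simp)
    qed
    also have "\<dots> = ennreal (1 / \<bar>c\<bar>) * (\<integral>\<^sup>+y. \<integral>\<^sup>+u. G u ((s * u + y) / c) \<partial>lborel \<partial>lborel)"
      by (rule nn_integral_cmult) measurable
    also have "(\<integral>\<^sup>+y. \<integral>\<^sup>+u. G u ((s * u + y) / c) \<partial>lborel \<partial>lborel) = (\<integral>\<^sup>+u. \<integral>\<^sup>+y. G u ((s * u + y) / c) \<partial>lborel \<partial>lborel)"
      by (rule lborel_pair.Fubini') measurable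
    also have "\<dots> = (\<integral>\<^sup>+u. ennreal \<bar>c\<bar> * (\<integral>\<^sup>+w. G u w \<partial>lborel) \<partial>lborel)"
    proof (intro nn_integral_cong)
      fix u
      show "(\<integral>\<^sup>+y. G u ((s * u + y) / c) \<partial>lborel) = ennreal \<bar>c\<bar> * (\<integral>\<^sup>+w. G u w \<partial>lborel)"
        using False by (subst nn_integral_real_affine[where c=c and t="- s * u"]) auto
    qed
    also have "\<dots> = ennreal \<bar>c\<bar> * (\<integral>\<^sup>+u. \<integral>\<^sup>+w. G u w \<partial>lborel \<partial>lborel)"
      by (rule nn_integral_cmult) measurable
    finally show ?thesis using False by (simp flip: mult.assoc ennreal_mult)
  next
    case True
    then have s: "s = 1 \<or> s = -1" using cs by (simp add: power2_eq_1_iff)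
    have r: "(\<integral>\<^sup>+x. h x \<partial>lborel) = (\<integral>\<^sup>+x. h (- x) \<partial>lborel)" if "h \<in> borel_measurable borel" for h :: "real \<Rightarrow> ennreal"
      using nn_integral_real_affine[OF that, of "-1" 0] by simp
    from s show ?thesis
    proof
      assume s: "s = 1"
      have "(\<integral>\<^sup>+x. \<integral>\<^sup>+y. G (- y) x \<partial>lborel \<partial>lborel) = (\<integral>\<^sup>+x. \<integral>\<^sup>+y. G y x \<partial>lborel \<partial>lborel)"
        by (intro nn_integral_cong r[symmetric]) measurable
      also have "\<dots> = (\<integral>\<^sup>+x. \<integral>\<^sup>+y. G x y \<partial>lborel \<partial>lborel)"
        by (rule lborel_pair.Fubini') measurable
      finally show ?thesis using True s by simp
    next
      assume s: "s = -1"
      have "(\<integral>\<^sup>+x. \<integral>\<^sup>+y. G y (- x) \<partial>lborel \<partial>lborel) = (\<integral>\<^sup>+x. \<integral>\<^sup>+y. G y x \<partial>lborel \<partial>lborel)"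
        by (intro r[symmetric]) measurable
      also have "\<dots> = (\<integral>\<^sup>+x. \<integral>\<^sup>+y. G x y \<partial>lborel \<partial>lborel)"
        by (rule lborel_pair.Fubini') measurable
      finally show ?thesis using True s by simp
    qed
  qed
  then show ?thesis by (simp add: lhs rhs)
qed


section \<open>Product Gaussian measures: shifts and rotations through the coordinates they
  move\<close>

lemma measurable_PiM_upd:
  assumes "a \<in> I" "f \<in> M \<rightarrow>\<^sub>M PiM I N" "g \<in> M \<rightarrow>\<^sub>M N a"
  shows "(\<lambda>x. (f x)(a := g x)) \<in> M \<rightarrow>\<^sub>M PiM I N"
  by (rule measurable_fun_upd[where J=I, OF _ assms(2,3)]) (use assms(1) in auto)

lemma measurable_plane_rot:
  assumes "a \<in> I" "b \<in> I"
  shows "plane_rot a b c s \<in> PiM I (\<lambda>_. std_gauss) \<rightarrow>\<^sub>M PiM I (\<lambda>_. std_gauss)"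
  unfolding plane_rot_def[abs_def]
  by (intro measurable_PiM_upd measurable_ident_sets refl assms) (use assms in measurable)

lemma nn_integral_gauss_insert:
  assumes "finite J" "a \<notin> J" "F \<in> borel_measurable (PiM (insert a J) (\<lambda>_. std_gauss))"
  shows "(\<integral>\<^sup>+x. F x \<partial>PiM (insert a J) (\<lambda>_. std_gauss))
      = (\<integral>\<^sup>+x. \<integral>\<^sup>+y. F (x(a := y)) \<partial>std_gauss \<partial>PiM J (\<lambda>_. std_gauss))"
  by (rule SG.product_nn_integral_insert[OF assms])

lemma measurable_section_upd:
  assumes "a \<notin> J" "F \<in> borel_measurable (PiM (insert a J) (\<lambda>_. std_gauss))" "x \<in> space (PiM J (\<lambda>_. std_gauss))"
  shows "(\<lambda>y. F (x(a := y))) \<in> borel_measurable borel"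
  using measurable_compose[OF measurable_component_update[OF assms(3,1)] assms(2)] 
  by (simp cong: measurable_cong_sets)

lemma nn_integral_gauss_shift1:
  assumes I: "finite I" "a \<in> I" and F: "F \<in> borel_measurable (PiM I (\<lambda>_. std_gauss))"
  shows "(\<integral>\<^sup>+x. F (x(a := x a + c)) \<partial>PiM I (\<lambda>_. std_gauss))
       = (\<integral>\<^sup>+x. F x * ennreal (exp (c * x a - c\<^sup>2 / 2)) \<partial>PiM I (\<lambda>_. std_gauss))"
proof -
  obtain J where J: "finite J" "a \<notin> J" "I = insert a J"
    using I by (metis finite_insert mk_disjoint_insert)
  note F[measurable]
  have a[measurable]: "(\<lambda>x. x a) \<in> borel_measurable (PiM I (\<lambda>_. std_gauss))"
    using measurable_component_singleton[OF I(2), of "\<lambda>_. std_gauss"] by (simp cong: measurable_cong_sets)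
  have u: "(\<lambda>x. x(a := x a + c)) \<in> PiM I (\<lambda>_. std_gauss) \<rightarrow>\<^sub>M PiM I (\<lambda>_. std_gauss)"
    by (intro measurable_PiM_upd measurable_ident_sets I refl) (simp cong: measurable_cong_sets)
  have 1: "(\<lambda>x. F (x(a := x a + c))) \<in> borel_measurable (PiM I (\<lambda>_. std_gauss))"
    by (rule measurable_compose[OF u F])
  have 2: "(\<lambda>x. F x * ennreal (exp (c * x a - c\<^sup>2 / 2))) \<in> borel_measurable (PiM I (\<lambda>_. std_gauss))"
    by measurable
  show ?thesis
    unfolding J(3) nn_integral_gauss_insert[OF J(1,2) 1[unfolded J(3)]] nn_integral_gauss_insert[OF J(1,2) 2[unfolded J(3)]]
  proof (rule nn_integral_cong)
    fix x assume "x \<in> space (PiM J (\<lambda>_. std_gauss))"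
    from nn_integral_std_gauss_shift[OF measurable_section_upd[OF J(2) F[unfolded J(3)] this], of c]
    show "(\<integral>\<^sup>+y. F (x(a := y, a := (x(a := y)) a + c)) \<partial>std_gauss) =
      (\<integral>\<^sup>+y. F (x(a := y)) * ennreal (exp (c * (x(a := y)) a - c\<^sup>2 / 2)) \<partial>std_gauss)"
      by simp
  qed
qed

lemma nn_integral_gauss_insert2:
  assumes J: "finite J" "a \<notin> J" "b \<notin> J" "a \<noteq> b"
    and F[measurable]: "F \<in> borel_measurable (PiM (insert b (insert a J)) (\<lambda>_. std_gauss))"
  shows "(\<integral>\<^sup>+x. F x \<partial>PiM (insert b (insert a J)) (\<lambda>_. std_gauss))
      = (\<integral>\<^sup>+x. \<integral>\<^sup>+y. \<integral>\<^sup>+z. F (x(a := y, b := z)) \<partial>std_gauss \<partial>std_gauss \<partial>PiM J (\<lambda>_. std_gauss))"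
proof -
  have [measurable]: "(\<lambda>(x, y). x(b := y)) \<in> PiM (insert a J) (\<lambda>_. std_gauss) \<Otimes>\<^sub>M std_gauss \<rightarrow>\<^sub>M PiM (insert b (insert a J)) (\<lambda>_. std_gauss)"
    using measurable_add_dim by (simp add: split_beta)
  have m: "(\<lambda>(x, y). F (x(b := y))) \<in> borel_measurable (PiM (insert a J) (\<lambda>_. std_gauss) \<Otimes>\<^sub>M std_gauss)"
    using measurable_compose[OF measurable_add_dim F] by (simp add: split_beta')
  have "(\<lambda>x. \<integral>\<^sup>+z. F (x(b := z)) \<partial>std_gauss) \<in> borel_measurable (PiM (insert a J) (\<lambda>_. std_gauss))"
    by (rule sigma_finite_measure.borel_measurable_nn_integral[OF _ m])
       (simp add: prob_space_std_gauss prob_space_imp_sigma_finite)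
  then show ?thesis
    using J by (subst nn_integral_gauss_insert, simp_all add: nn_integral_gauss_insert F)
qed

lemma nn_integral_gauss_rot2:
  assumes I: "finite I" "a \<in> I" "b \<in> I" "a \<noteq> b" and cs: "c\<^sup>2 + s\<^sup>2 = 1"
    and F: "F \<in> borel_measurable (PiM I (\<lambda>_. std_gauss))"
  shows "(\<integral>\<^sup>+x. F (plane_rot a b c s x) \<partial>PiM I (\<lambda>_. std_gauss)) = (\<integral>\<^sup>+x. F x \<partial>PiM I (\<lambda>_. std_gauss))"
proof -
  define J where "J = I - {a, b}"
  have J: "finite J" "a \<notin> J" "b \<notin> J" "a \<noteq> b" "I = insert b (insert a J)" using I by (auto simp: J_def)
  have 1: "(\<lambda>x. F (plane_rot a b c s x)) \<in> borel_measurable (PiM I (\<lambda>_. std_gauss))"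
    by (rule measurable_compose[OF measurable_plane_rot F]) (use I in auto)
  show ?thesis
    unfolding J(5) nn_integral_gauss_insert2[OF J(1-4) 1[unfolded J(5)]] nn_integral_gauss_insert2[OF J(1-4) F[unfolded J(5)]]
  proof (rule nn_integral_cong)
    fix x assume x: "x \<in> space (PiM J (\<lambda>_. std_gauss))"
    have m: "(\<lambda>p. x(a := fst p, b := snd p)) \<in> borel \<Otimes>\<^sub>M borel \<rightarrow>\<^sub>M PiM I (\<lambda>_. std_gauss)"
      unfolding J(5)
      apply (rule measurable_fun_upd[where J="insert a J"])
        apply auto[1]
       apply (rule measurable_fun_upd[where J=J])
      using x by auto
    have "(\<lambda>(y, z). F (x(a := y, b := z))) \<in> borel_measurable (borel \<Otimes>\<^sub>M borel)"
      using measurable_compose[OF m F] by (simp add: split_beta')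
    from nn_integral_std_gauss_rot[OF this cs]
    show "(\<integral>\<^sup>+y. \<integral>\<^sup>+z. F (plane_rot a b c s (x(a := y, b := z))) \<partial>std_gauss \<partial>std_gauss) =
          (\<integral>\<^sup>+y. \<integral>\<^sup>+z. F (x(a := y, b := z)) \<partial>std_gauss \<partial>std_gauss)"
      using J(4) by (simp add: plane_rot_def fun_upd_twist)
  qed
qed

text \<open>Separating the set \<open>J\<close> of shifted coordinates from the index set
  \<open>I\<close> lets the induction add one shifted coordinate at a time while the measure stays
  the same; the density factors multiply.\<close>

lemma nn_integral_gauss_shift:
  assumes I: "finite I" and J: "J \<subseteq> I" and F: "F \<in> borel_measurable (PiM I (\<lambda>_. std_gauss))"
  shows "(\<integral>\<^sup>+x. F (\<lambda>i. if i \<in> J then x i + v i else x i) \<partial>PiM I (\<lambda>_. std_gauss))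
       = (\<integral>\<^sup>+x. F x * ennreal (exp (\<Sum>i\<in>J. v i * x i - (v i)\<^sup>2 / 2)) \<partial>PiM I (\<lambda>_. std_gauss))"
proof -
  have "finite J" using I J finite_subset by auto
  then show ?thesis using J F
  proof (induction J arbitrary: F)
    case (insert a J)
    have aI: "a \<in> I" and JI: "J \<subseteq> I" using insert by auto
    note insert.prems(2)[measurable]
    have [measurable]: "(\<lambda>x. x i) \<in> borel_measurable (PiM I (\<lambda>_. std_gauss))" if "i \<in> I" for i
      using measurable_component_singleton[OF that, of "\<lambda>_. std_gauss"] by (simp cong: measurable_cong_sets)
    have u: "(\<lambda>x. x(a := x a + v a)) \<in> PiM I (\<lambda>_. std_gauss) \<rightarrow>\<^sub>M PiM I (\<lambda>_. std_gauss)"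
      using aI by (intro measurable_PiM_upd measurable_ident_sets refl) (auto cong: measurable_cong_sets)
    have e: "(\<lambda>x. exp (\<Sum>i\<in>J. v i * x i - (v i)\<^sup>2 / 2)) \<in> borel_measurable (PiM I (\<lambda>_. std_gauss))"
      using JI by (intro measurable_compose[OF _ borel_measurable_exp] borel_measurable_sum borel_measurable_diff) (auto simp: subset_iff)
    have "(\<integral>\<^sup>+x. F (\<lambda>i. if i \<in> insert a J then x i + v i else x i) \<partial>PiM I (\<lambda>_. std_gauss))
       = (\<integral>\<^sup>+x. (\<lambda>x. F (x(a := x a + v a))) (\<lambda>i. if i \<in> J then x i + v i else x i) \<partial>PiM I (\<lambda>_. std_gauss))"
      using insert.hyps by (intro nn_integral_cong arg_cong[where f=F]) auto
    also have "\<dots> = (\<integral>\<^sup>+x. F (x(a := x a + v a)) * ennreal (exp (\<Sum>i\<in>J. v i * x i - (v i)\<^sup>2 / 2)) \<partial>PiM I (\<lambda>_. std_gauss))"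
      by (rule insert.IH[OF JI measurable_compose[OF u insert.prems(2)]])
    also have "\<dots> = (\<integral>\<^sup>+x. (\<lambda>x. F x * ennreal (exp (\<Sum>i\<in>J. v i * x i - (v i)\<^sup>2 / 2))) (x(a := x a + v a)) \<partial>PiM I (\<lambda>_. std_gauss))"
      using insert.hyps by (intro nn_integral_cong arg_cong2[where f="(*)"] arg_cong[where f=ennreal] arg_cong[where f=exp] sum.cong) auto
    also have "\<dots> = (\<integral>\<^sup>+x. F x * ennreal (exp (\<Sum>i\<in>J. v i * x i - (v i)\<^sup>2 / 2)) * ennreal (exp (v a * x a - (v a)\<^sup>2 / 2)) \<partial>PiM I (\<lambda>_. std_gauss))"
      by (intro nn_integral_gauss_shift1 I aI borel_measurable_times_ennreal insert.prems(2) measurable_compose[OF e measurable_ennreal])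
    also have "\<dots> = (\<integral>\<^sup>+x. F x * ennreal (exp (\<Sum>i\<in>insert a J. v i * x i - (v i)\<^sup>2 / 2)) \<partial>PiM I (\<lambda>_. std_gauss))"
      using insert.hyps by (intro nn_integral_cong) (simp add: exp_add ennreal_mult mult_ac)
    finally show ?case .
  qed simp
qed

lemma measurable_gauss_vec_component [measurable]:
  "i < n \<Longrightarrow> (\<lambda>x. x i) \<in> borel_measurable (gauss_vec n)"
  using measurable_component_singleton[of i "{..<n}" "\<lambda>_. std_gauss"]
  by (simp add: gauss_vec_def cong: measurable_cong_sets)

lemma measurable_ip:
  assumes "\<And>i. i < n \<Longrightarrow> (\<lambda>x. f x i) \<in> borel_measurable M" "\<And>i. i < n \<Longrightarrow> (\<lambda>x. g x i) \<in> borel_measurable M"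
  shows "(\<lambda>x. ip n (f x) (g x)) \<in> borel_measurable M"
  unfolding ip_def using assms by (intro borel_measurable_sum borel_measurable_times) auto

lemma measurable_plane_rot_gauss_vec:
  "a < n \<Longrightarrow> b < n \<Longrightarrow> plane_rot a b c s \<in> gauss_vec n \<rightarrow>\<^sub>M gauss_vec n"
  unfolding gauss_vec_def by (rule measurable_plane_rot) auto

lemma distr_gauss_vec_rot:
  assumes "a \<noteq> b" "a < n" "b < n" "c\<^sup>2 + s\<^sup>2 = 1"
  shows "distr (gauss_vec n) (gauss_vec n) (plane_rot a b c s) = gauss_vec n"
proof (rule measure_eqI)
  fix A assume "A \<in> sets (distr (gauss_vec n) (gauss_vec n) (plane_rot a b c s))"
  then have A: "A \<in> sets (gauss_vec n)" by simp
  note m = measurable_plane_rot_gauss_vec[OF assms(2,3)]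
  have "emeasure (distr (gauss_vec n) (gauss_vec n) (plane_rot a b c s)) A
     = (\<integral>\<^sup>+x. indicator A x \<partial>distr (gauss_vec n) (gauss_vec n) (plane_rot a b c s))"
    using A by simp
  also have "\<dots> = (\<integral>\<^sup>+x. indicator A (plane_rot a b c s x) \<partial>gauss_vec n)"
    using A m by (subst nn_integral_distr) auto
  also have "\<dots> = (\<integral>\<^sup>+x. indicator A x \<partial>gauss_vec n)"
    using A assms unfolding gauss_vec_def by (intro nn_integral_gauss_rot2) auto
  finally show "emeasure (distr (gauss_vec n) (gauss_vec n) (plane_rot a b c s)) A = emeasure (gauss_vec n) A"
    using A by simp
qed simp

text \<open>Cameron-Martin formula in dimension \<open>n\<close>. Indices from \<open>n\<close> on
  are left alone because points of the product space have a fixed default value there.\<close>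

lemma nn_integral_gauss_vec_shift:
  assumes "F \<in> borel_measurable (gauss_vec n)"
  shows "(\<integral>\<^sup>+x. F (\<lambda>i. if i < n then x i + v i else x i) \<partial>gauss_vec n)
       = (\<integral>\<^sup>+x. F x * ennreal (exp (ip n v x - ip n v v / 2)) \<partial>gauss_vec n)"
  using nn_integral_gauss_shift[of "{..<n}" "{..<n}" F v] assms
  by (simp add: gauss_vec_def ip_def sum_subtractf sum_divide_distrib power2_eq_square)

text \<open>Applied to the constant function 1, the shift formula says that the density factor has
  mean 1; this is the moment generating function of \<open>ip n v x\<close>.\<close>

lemma nn_integral_gauss_vec_exp_ip:
  "(\<integral>\<^sup>+x. ennreal (exp (ip n v x)) \<partial>gauss_vec n) = ennreal (exp (ip n v v / 2))"
proof -
  interpret prob_space "gauss_vec n" by (rule prob_space_gauss_vec)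
  have [measurable]: "(\<lambda>x. ip n v x) \<in> borel_measurable (gauss_vec n)"
    by (rule measurable_ip) auto
  have "(\<integral>\<^sup>+x. ennreal (exp (ip n v x)) \<partial>gauss_vec n) =
    (\<integral>\<^sup>+x. ennreal (exp (ip n v v / 2)) * (1 * ennreal (exp (ip n v x - ip n v v / 2))) \<partial>gauss_vec n)"
    by (intro nn_integral_cong) (simp flip: ennreal_mult exp_add)
  also have "\<dots> = ennreal (exp (ip n v v / 2)) * (\<integral>\<^sup>+x. 1 * ennreal (exp (ip n v x - ip n v v / 2)) \<partial>gauss_vec n)"
    by (rule nn_integral_cmult) measurable
  also have "(\<integral>\<^sup>+x. 1 * ennreal (exp (ip n v x - ip n v v / 2)) \<partial>gauss_vec n) = 1"
    by (subst nn_integral_gauss_vec_shift[symmetric, of "\<lambda>_. 1"]) (auto simp: emeasure_space_1)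
  finally show ?thesis by simp
qed

lemma emeasure_std_gauss_singleton: "emeasure std_gauss {y} = 0"
  unfolding std_gauss_def by (subst emeasure_density) (auto simp: nn_integral_indicator_singleton)

text \<open>If \<open>v a \<noteq> 0\<close> and all coordinates but \<open>a\<close> are fixed, the
  equation determines coordinate \<open>a\<close>, and single points are null.\<close>

lemma emeasure_ip_eq_0:
  assumes "0 < ip n v v"
  shows "emeasure (gauss_vec n) {x \<in> space (gauss_vec n). ip n v x = 0} = 0"
proof -
  obtain a where a: "a < n" "v a \<noteq> 0" using assms by (auto simp: ip_self_pos_iff)
  define J where "J = {..<n} - {a}"
  have J: "finite J" "a \<notin> J" "{..<n} = insert a J" using a by (auto simp: J_def)
  have [measurable]: "(\<lambda>x. ip n v x) \<in> borel_measurable (gauss_vec n)"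
    by (rule measurable_ip) auto
  define F where "F x = (indicator {x. ip n v x = 0} x :: ennreal)" for x
  have F: "F \<in> borel_measurable (gauss_vec n)"
    unfolding F_def by measurable
  have "emeasure (gauss_vec n) {x \<in> space (gauss_vec n). ip n v x = 0} = (\<integral>\<^sup>+x. indicator {x \<in> space (gauss_vec n). ip n v x = 0} x \<partial>gauss_vec n)"
    by simp
  also have "\<dots> = (\<integral>\<^sup>+x. F x \<partial>gauss_vec n)"
    by (intro nn_integral_cong) (auto simp: F_def indicator_def)
  also have "\<dots> = (\<integral>\<^sup>+x. \<integral>\<^sup>+y. F (x(a := y)) \<partial>std_gauss \<partial>PiM J (\<lambda>_. std_gauss))"
    using nn_integral_gauss_insert[OF J(1,2), of F] F by (simp add: gauss_vec_def J(3))
  also have "\<dots> = (\<integral>\<^sup>+x. 0 \<partial>PiM J (\<lambda>_. std_gauss))"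
  proof (rule nn_integral_cong)
    fix x
    have "ip n v (x(a := y)) = v a * y + (\<Sum>i\<in>J. v i * x i)" for y
    proof -
      have "(\<Sum>i\<in>J. v i * (x(a := y)) i) = (\<Sum>i\<in>J. v i * x i)"
        using J(2) by (intro sum.cong) auto
      then show ?thesis unfolding ip_def J(3) using J by simp
    qed
    then have "F (x(a := y)) = indicator {- (\<Sum>i\<in>J. v i * x i) / v a} y" for y
      using a(2) by (auto simp: F_def indicator_def field_simps)
    then show "(\<integral>\<^sup>+y. F (x(a := y)) \<partial>std_gauss) = 0"
      by (simp add: emeasure_std_gauss_singleton)
  qed
  finally show ?thesis by simp
qed

section \<open>Second moments and the trace of the projection\<close>

lemma integrable_std_gauss_iff:
  "f \<in> borel_measurable borel \<Longrightarrow> integrable std_gauss f \<longleftrightarrow> integrable lborel (\<lambda>x. std_normal_density x * f x)"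
  for f :: "real \<Rightarrow> real"
  unfolding std_gauss_def by (subst integrable_density) auto

lemma integral_std_gauss:
  "f \<in> borel_measurable borel \<Longrightarrow> (\<integral>x. f x \<partial>std_gauss) = (\<integral>x. std_normal_density x * f x \<partial>lborel)"
  for f :: "real \<Rightarrow> real"
  unfolding std_gauss_def by (subst integral_density) auto

lemma std_gauss_moments:
  "integrable std_gauss (\<lambda>x. x)" "(\<integral>x. x \<partial>std_gauss) = 0"
  "integrable std_gauss (\<lambda>x. x * x)" "(\<integral>x. x * x \<partial>std_gauss) = 1"
  using integrable_std_normal_moment[of 1] integral_std_normal_moment_odd[of 0]
    integrable_std_normal_moment[of 2] integral_std_normal_moment_even[of 1]
  by (simp_all add: integrable_std_gauss_iff integral_std_gauss power2_eq_square fact_numeral)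

lemma gauss_vec_cov:
  assumes "i < n" "j < n"
  shows "integrable (gauss_vec n) (\<lambda>x. x i * x j)"
    and "(\<integral>x. x i * x j \<partial>gauss_vec n) = (if i = j then 1 else 0)"
proof -
  \<comment> \<open>One factor per index, so that the integral of \<open>x i * x j\<close> becomes a
    product of one-dimensional integrals; for \<open>i = j\<close> both conditionals apply at the
    same \<open>k\<close> and yield the square.\<close>
  define f :: "nat \<Rightarrow> real \<Rightarrow> real" where "f k x = (if k = i then x else 1) * (if k = j then x else 1)" for k x
  interpret N: finite_measure std_gauss by (rule prob_space.finite_measure[OF prob_space_std_gauss])
  have [simp]: "measure std_gauss UNIV = 1"
    using prob_space.prob_space[OF prob_space_std_gauss] by simp
  have f: "f k = (if k = i then (if i = j then (\<lambda>x. x * x) else (\<lambda>x. x)) else if k = j then (\<lambda>x. x) else (\<lambda>x. 1))" for k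
    by (auto simp: f_def)
  have int: "integrable std_gauss (f k)" for k
    unfolding f by (simp add: std_gauss_moments)
  have I: "(\<integral>x. f k x \<partial>std_gauss) = (if k = i then (if i = j then 1 else 0) else if k = j then 0 else 1)" for k
    unfolding f by (simp add: std_gauss_moments)
  have e: "(\<Prod>k\<in>{..<n}. f k (x k)) = x i * x j" for x
    unfolding f_def using assms by (simp add: prod.distrib)
  show "integrable (gauss_vec n) (\<lambda>x. x i * x j)"
    using SG.product_integrable_prod[of "{..<n}" f] int by (simp add: e gauss_vec_def)
  have "(\<integral>x. x i * x j \<partial>gauss_vec n) = (\<Prod>k\<in>{..<n}. \<integral>x. f k x \<partial>std_gauss)"
    using SG.product_integral_prod[of "{..<n}" f] int by (simp add: e gauss_vec_def)
  also have "\<dots> = (if i = j then 1 else 0)"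
    unfolding I using assms by (auto simp: prod.If_cases intro!: prod_zero bexI[of _ i])
  finally show "(\<integral>x. x i * x j \<partial>gauss_vec n) = (if i = j then 1 else 0)" .
qed

lemma integral_ip_sq:
  shows "integrable (gauss_vec n) (\<lambda>x. (ip n x v)\<^sup>2)"
    and "(\<integral>x. (ip n x v)\<^sup>2 \<partial>gauss_vec n) = ip n v v"
proof -
  have e: "(ip n x v)\<^sup>2 = (\<Sum>i<n. \<Sum>j<n. v i * v j * (x i * x j))" for x
    by (simp add: ip_def power2_eq_square sum_product mult_ac)
  show "integrable (gauss_vec n) (\<lambda>x. (ip n x v)\<^sup>2)"
    unfolding e by (intro Bochner_Integration.integrable_sum integrable_mult_right gauss_vec_cov) auto
  have "(\<integral>x. (ip n x v)\<^sup>2 \<partial>gauss_vec n) = (\<Sum>i<n. \<Sum>j<n. v i * v j * (\<integral>x. x i * x j \<partial>gauss_vec n))"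
    unfolding e
    by (subst Bochner_Integration.integral_sum)
       (auto intro!: Bochner_Integration.integrable_sum integrable_mult_right gauss_vec_cov sum.cong
             simp: Bochner_Integration.integral_sum gauss_vec_cov(1))
  also have "\<dots> = (\<Sum>i<n. \<Sum>j<n. if i = j then v i * v j else 0)"
    by (intro sum.cong refl) (auto simp: gauss_vec_cov)
  also have "\<dots> = ip n v v" by (simp add: ip_def)
  finally show "(\<integral>x. (ip n x v)\<^sup>2 \<partial>gauss_vec n) = ip n v v" .
qed

lemma integral_norm_sq:
  shows "integrable (gauss_vec n) (\<lambda>x. ip n x x)"
    and "(\<integral>x. ip n x x \<partial>gauss_vec n) = real n"
  unfolding ip_def by (auto intro!: Bochner_Integration.integrable_sum simp: gauss_vec_cov)

text \<open>Every nonzero Gram-Schmidt vector removes the component along one unit vector, whose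
  second moment is 1. The value is the trace of the projection. Rank defects are counted instead of
  excluded, so the formula is available before the rows are known to be almost surely
  independent.\<close>

lemma integral_gs_proj_norm_sq:
  shows "integrable (gauss_vec n) (\<lambda>x. ip n (gs_proj n A j x) (gs_proj n A j x))"
    and "(\<integral>x. ip n (gs_proj n A j x) (gs_proj n A j x) \<partial>gauss_vec n)
      = real n - real (card {i. i < j \<and> 0 < ip n (gs_proj n A i (A i)) (gs_proj n A i (A i))})"
proof -
  have "integrable (gauss_vec n) (\<lambda>x. ip n (gs_proj n A j x) (gs_proj n A j x)) \<and>
    (\<integral>x. ip n (gs_proj n A j x) (gs_proj n A j x) \<partial>gauss_vec n)
      = real n - real (card {i. i < j \<and> 0 < ip n (gs_proj n A i (A i)) (gs_proj n A i (A i))})"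
  proof (induction j)
    case 0 then show ?case by (simp add: integral_norm_sq)
  next
    case (Suc j)
    define b where "b = (\<lambda>i. gs_proj n A i (A i))"
    have e: "ip n (gs_proj n A (Suc j) x) (gs_proj n A (Suc j) x) =
       ip n (gs_proj n A j x) (gs_proj n A j x) - (ip n x (b j))\<^sup>2 / ip n (b j) (b j)" for x
      by (simp add: gs_proj_norm_Suc b_def del: gs_proj.simps)
    have I: "integrable (gauss_vec n) (\<lambda>x. (ip n x (b j))\<^sup>2 / ip n (b j) (b j))"
      by (intro integrable_divide integral_ip_sq)
    have J: "(\<integral>x. (ip n x (b j))\<^sup>2 / ip n (b j) (b j) \<partial>gauss_vec n) = (if 0 < ip n (b j) (b j) then 1 else 0)"
      using ip_self_nonneg[of n "b j"] by (auto simp: integral_ip_sq less_le)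
    have "{i. i < Suc j \<and> 0 < ip n (b i) (b i)} = {i. i < j \<and> 0 < ip n (b i) (b i)} \<union> (if 0 < ip n (b j) (b j) then {j} else {})"
      by (auto simp: less_Suc_eq)
    then have "card {i. i < Suc j \<and> 0 < ip n (b i) (b i)} = card {i. i < j \<and> 0 < ip n (b i) (b i)} + (if 0 < ip n (b j) (b j) then 1 else 0)"
      by (auto simp: card_insert_if)
    moreover have bs: "gs_proj n A i (A i) = b i" for i by (simp add: b_def)
    ultimately show ?case
      using I J Suc unfolding e bs by (cases "0 < ip n (b j) (b j)") (simp_all del: gs_proj.simps)
  qed
  then show "integrable (gauss_vec n) (\<lambda>x. ip n (gs_proj n A j x) (gs_proj n A j x))"
    and "(\<integral>x. ip n (gs_proj n A j x) (gs_proj n A j x) \<partial>gauss_vec n)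
      = real n - real (card {i. i < j \<and> 0 < ip n (gs_proj n A i (A i)) (gs_proj n A i (A i))})" by auto
qed

section \<open>Gaussian matrices\<close>

text \<open>Grouped by rows, because Gram-Schmidt reads one row at a time and the rows are
  independent Gaussian vectors. Uncurrying recovers the entrywise measure
  \<open>gauss_matrix\<close> at the end.\<close>

definition gauss_rows :: "nat \<Rightarrow> nat \<Rightarrow> (nat \<Rightarrow> nat \<Rightarrow> real) measure" where
  "gauss_rows m n = PiM {..<m} (\<lambda>_. gauss_vec n)"

lemma prob_space_gauss_rows: "prob_space (gauss_rows m n)"
  unfolding gauss_rows_def by (rule prob_space_PiM) (rule prob_space_gauss_vec)

lemma measurable_gauss_rows_component:
  assumes "i < m" "k < n"
  shows "(\<lambda>A. A i k) \<in> borel_measurable (gauss_rows m n)"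
proof -
  have "(\<lambda>A. A i) \<in> gauss_rows m n \<rightarrow>\<^sub>M gauss_vec n"
    unfolding gauss_rows_def using assms by (intro measurable_component_singleton) auto
  from measurable_compose[OF this measurable_gauss_vec_component[OF assms(2)]] show ?thesis .
qed

lemma distr_gauss_rows_rot:
  assumes "a \<noteq> b" "a < n" "b < n" "c\<^sup>2 + s\<^sup>2 = 1"
  shows "distr (gauss_rows m n) (gauss_rows m n) (\<lambda>A. \<lambda>i\<in>{..<m}. plane_rot a b c s (A i)) = gauss_rows m n"
proof -
  have "compose {..<m} (plane_rot a b c s) = (\<lambda>A. \<lambda>i\<in>{..<m}. plane_rot a b c s (A i))"
    by (auto simp: compose_def fun_eq_iff)
  then show ?thesis
  using distr_PiM_finite_prob_space'[of "{..<m}" "\<lambda>_. gauss_vec n" "\<lambda>_. gauss_vec n" "plane_rot a b c s"]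
  by (simp add: gauss_rows_def prob_space_gauss_vec measurable_plane_rot_gauss_vec
      distr_gauss_vec_rot assms)
qed

lemma measurable_rows_rot:
  assumes "a < n" "b < n"
  shows "(\<lambda>A. \<lambda>i\<in>{..<m}. plane_rot a b c s (A i)) \<in> gauss_rows m n \<rightarrow>\<^sub>M gauss_rows m n"
  unfolding gauss_rows_def
  by (intro measurable_restrict measurable_compose[OF measurable_component_singleton]
      measurable_plane_rot_gauss_vec assms) auto

lemma measurable_gs_proj:
  assumes "\<And>i k. i < j \<Longrightarrow> k < n \<Longrightarrow> (\<lambda>\<omega>. A \<omega> i k) \<in> borel_measurable M"
    and "\<And>k. k < n \<Longrightarrow> (\<lambda>\<omega>. x \<omega> k) \<in> borel_measurable M" and "k < n"
  shows "(\<lambda>\<omega>. gs_proj n (A \<omega>) j (x \<omega>) k) \<in> borel_measurable M"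
  using assms
proof (induction j arbitrary: x k)
  case (Suc j)
  have b: "(\<lambda>\<omega>. gs_proj n (A \<omega>) j (A \<omega> j) k) \<in> borel_measurable M" if "k < n" for k
    using Suc.prems that by (intro Suc.IH) auto
  have x: "(\<lambda>\<omega>. gs_proj n (A \<omega>) j (x \<omega>) k) \<in> borel_measurable M" if "k < n" for k
    using Suc.prems that by (intro Suc.IH) auto
  show ?case
    unfolding gs_proj.simps
    by (intro borel_measurable_diff borel_measurable_times borel_measurable_divide measurable_ip b x Suc.prems(2,3))
qed auto

text \<open>A trace computation replaces the dimension count: the mean squared norm of the projection is at least
  \<open>n - j > 0\<close>, so some \<open>w \<noteq> 0\<close> is orthogonal to the first \<open>j\<close> rows, and the next row is almost surely not orthogonal to \<open>w\<close>.\<close>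

lemma emeasure_gs_proj_degenerate:
  assumes "j < n" "j < m"
  shows "emeasure (gauss_rows m n)
    {A \<in> space (gauss_rows m n). ip n (gs_proj n A j (A j)) (gs_proj n A j (A j)) = 0} = 0"
proof -
  interpret GV: product_prob_space "\<lambda>_. gauss_vec n" I for I :: "nat set"
    by (simp add: product_prob_spaceI prob_space_gauss_vec)
  define J where "J = {..<m} - {j}"
  have J: "finite J" "j \<notin> J" "{..<m} = insert j J" using assms by (auto simp: J_def)
  define D where "D = (\<lambda>A. ip n (gs_proj n A j (A j)) (gs_proj n A j (A j)))"
  have D: "D \<in> borel_measurable (gauss_rows m n)"
    unfolding D_def using assms by (intro measurable_ip measurable_gs_proj measurable_gauss_rows_component) auto
  note D[measurable]
  define F where "F A = (indicator {A. D A = 0} A :: ennreal)" for A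
  have F: "F \<in> borel_measurable (gauss_rows m n)"
    unfolding F_def by measurable
  have "emeasure (gauss_rows m n) {A \<in> space (gauss_rows m n). D A = 0} = (\<integral>\<^sup>+A. indicator {A \<in> space (gauss_rows m n). D A = 0} A \<partial>gauss_rows m n)"
    by simp
  also have "\<dots> = (\<integral>\<^sup>+A. F A \<partial>gauss_rows m n)"
    by (intro nn_integral_cong) (auto simp: F_def indicator_def)
  also have "\<dots> = (\<integral>\<^sup>+A. \<integral>\<^sup>+y. F (A(j := y)) \<partial>gauss_vec n \<partial>PiM J (\<lambda>_. gauss_vec n))"
    using GV.product_nn_integral_insert[OF J(1,2), of F] F by (simp add: gauss_rows_def J(3))
  also have "\<dots> = (\<integral>\<^sup>+x. 0 \<partial>PiM J (\<lambda>_. gauss_vec n))"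
  proof (rule nn_integral_cong)
    fix A
    have card: "card {i. i < j \<and> 0 < ip n (gs_proj n A i (A i)) (gs_proj n A i (A i))} \<le> j"
      by (rule order_trans[OF card_mono[of "{..<j}"]]) auto
    have "\<exists>h. ip n (gs_proj n A j h) (gs_proj n A j h) \<noteq> 0"
    proof (rule ccontr)
      assume "\<not> ?thesis"
      then have "(\<integral>x. ip n (gs_proj n A j x) (gs_proj n A j x) \<partial>gauss_vec n) = 0" by simp
      then show False using card assms unfolding integral_gs_proj_norm_sq by simp
    qed
    then obtain h where h: "ip n (gs_proj n A j h) (gs_proj n A j h) \<noteq> 0" by auto
    \<comment> \<open>\<open>w\<close> is computed from the rows before \<open>j\<close> only, so it
      does not change when row \<open>j\<close> is replaced by \<open>y\<close>. By symmetry of the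
      projection, a vanishing projection of \<open>y\<close> makes \<open>y\<close> orthogonal to
      \<open>w\<close>.\<close>
    define w where "w = gs_proj n A j h"
    have w: "0 < ip n w w" using h ip_self_nonneg[of n w] by (simp add: w_def less_le)
    have imp: "ip n w y = 0" if "F (A(j := y)) \<noteq> 0" for y
    proof -
      have "gs_proj n (A(j := y)) j y = gs_proj n A j y" by (rule gs_proj_cong) auto
      then have "ip n (gs_proj n A j y) (gs_proj n A j y) = 0"
        using that by (auto simp: F_def D_def indicator_def split: if_splits)
      then have "ip n h (gs_proj n A j y) = 0" by (rule ip_self_eq_0D)
      then show ?thesis by (simp add: w_def gs_proj_symmetric)
    qed
    have [measurable]: "(\<lambda>y. ip n w y) \<in> borel_measurable (gauss_vec n)"
      by (rule measurable_ip) auto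
    have "(\<integral>\<^sup>+y. F (A(j := y)) \<partial>gauss_vec n) \<le> (\<integral>\<^sup>+y. indicator {y \<in> space (gauss_vec n). ip n w y = 0} y \<partial>gauss_vec n)"
      using imp by (intro nn_integral_mono) (auto simp: F_def indicator_def split: if_splits)
    also have "\<dots> = 0" using emeasure_ip_eq_0[OF w] by simp
    finally show "(\<integral>\<^sup>+y. F (A(j := y)) \<partial>gauss_vec n) = 0" by simp
  qed
  finally show ?thesis by (simp add: D_def)
qed

lemma gs_proj_cong_arg:
  assumes "\<And>i. i < n \<Longrightarrow> x i = y i" "k < n"
  shows "gs_proj n A j x k = gs_proj n A j y k"
  using assms(2)
proof (induction j arbitrary: k)
  case (Suc j)
  have "ip n x b = ip n y b" for b using assms(1) by (intro ip_cong) auto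
  then show ?case using Suc by simp
qed (use assms in auto)

text \<open>With probability at least 1/2 both the projected norm is within four times its mean and
  \<open>ip n v h \<le> 2\<close>; on that event the density of the shifted Gaussian is bounded below.\<close>

lemma gauss_vec_shift_lower:
  assumes E: "(\<integral>x. ip n (gs_proj n A j x) (gs_proj n A j x) \<partial>gauss_vec n) \<le> e" "0 < e"
    and v: "ip n v v = 1" "gs_proj n A j v = v" and s: "0 \<le> s"
  shows "ennreal (exp (- 2 * s - s\<^sup>2 / 2) / 2) \<le> emeasure (gauss_vec n) {h \<in> space (gauss_vec n).
     ip n (\<lambda>i. gs_proj n A j h i - s * v i) (\<lambda>i. gs_proj n A j h i - s * v i) \<le> 4 * e}"
proof -
  interpret prob_space "gauss_vec n" by (rule prob_space_gauss_vec)
  define W where "W h = ip n (gs_proj n A j h) (gs_proj n A j h)" for h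
  have W[measurable]: "W \<in> borel_measurable (gauss_vec n)"
    unfolding W_def by (intro measurable_ip measurable_gs_proj) auto
  have [measurable]: "(\<lambda>h. ip n v h) \<in> borel_measurable (gauss_vec n)"
    by (rule measurable_ip) auto
  \<comment> \<open>Markov's inequality; the factor 4 leaves failure probability 1/4 here, and the
    same amount is left for the event below.\<close>
  have "prob {h \<in> space (gauss_vec n). W h \<ge> 4 * e} \<le> (\<integral>x. W x \<partial>gauss_vec n) / (4 * e)"
    using E(2) integral_gs_proj_norm_sq[of n A j]
    by (intro integral_Markov_inequality_measure[where A="{}"]) (auto simp: W_def)
  also have "\<dots> \<le> 1/4" using E by (simp add: W_def field_simps)
  finally have B: "prob {h \<in> space (gauss_vec n). W h \<ge> 4 * e} \<le> 1/4" .
  \<comment> \<open>Exponential Markov inequality with exponent 1: since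
    \<open>ip n v v = 1\<close>, the bound is exp (-2) times exp (1/2).\<close>
  have "emeasure (gauss_vec n) {h \<in> space (gauss_vec n). 2 \<le> ip n v h}
     \<le> (\<integral>\<^sup>+h. ennreal (exp (-2)) * ennreal (exp (ip n v h)) \<partial>gauss_vec n)"
    by (subst nn_integral_indicator[symmetric], measurable, rule nn_integral_mono)
       (auto simp: indicator_def simp flip: ennreal_mult exp_add)
  also have "\<dots> = ennreal (exp (-2)) * ennreal (exp (1/2))"
    by (subst nn_integral_cmult) (auto simp: nn_integral_gauss_vec_exp_ip v)
  also have "\<dots> = ennreal (exp (-3/2))" by (simp flip: ennreal_mult exp_add)
  also have "\<dots> \<le> ennreal (1/4)"
  proof -
    \<comment> \<open>The Taylor bound gives 1 + 1/2 + 1/8 = 13/8, and the cube of 13/8 exceeds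
      4.\<close>
    have "(13/8)^3 \<le> exp (1/2::real)^3"
      using exp_lower_Taylor_quadratic[of "1/2"] by (intro power_mono) (auto simp: power2_eq_square)
    moreover have "exp (3/2::real) = exp (1/2) ^ 3"
      by (simp add: power3_eq_cube flip: exp_add)
    ultimately have "4 \<le> exp (3/2::real)"
      by (simp add: power3_eq_cube)
    then show ?thesis by (simp add: exp_minus field_simps)
  qed
  finally have C: "prob {h \<in> space (gauss_vec n). 2 \<le> ip n v h} \<le> 1/4"
    by (simp add: emeasure_eq_measure)
  define G where "G = {h \<in> space (gauss_vec n). W h \<le> 4 * e \<and> ip n v h \<le> 2}"
  have G[measurable]: "G \<in> sets (gauss_vec n)" unfolding G_def by measurable
  have "space (gauss_vec n) - G \<subseteq> {h \<in> space (gauss_vec n). W h \<ge> 4 * e} \<union> {h \<in> space (gauss_vec n). 2 \<le> ip n v h}"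
    by (auto simp: G_def)
  then have "prob (space (gauss_vec n) - G) \<le> prob ({h \<in> space (gauss_vec n). W h \<ge> 4 * e} \<union> {h \<in> space (gauss_vec n). 2 \<le> ip n v h})"
    by (intro finite_measure_mono) measurable
  also have "\<dots> \<le> prob {h \<in> space (gauss_vec n). W h \<ge> 4 * e} + prob {h \<in> space (gauss_vec n). 2 \<le> ip n v h}"
    by (rule measure_Un_le) measurable
  finally have "1/2 \<le> prob G" using B C prob_compl[OF G] by simp
  then have half: "ennreal (1/2) \<le> emeasure (gauss_vec n) G" unfolding emeasure_eq_measure by (rule ennreal_leI)
  define F where "F h = (indicator {h. W h \<le> 4 * e} h :: ennreal)" for h
  have F[measurable]: "F \<in> borel_measurable (gauss_vec n)" unfolding F_def by measurable
  have "ennreal (exp (- 2 * s - s\<^sup>2 / 2) / 2) = ennreal (exp (- 2 * s - s\<^sup>2 / 2)) * ennreal (1/2)"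
    by (subst ennreal_mult[symmetric]) auto
  also have "\<dots> \<le> ennreal (exp (- 2 * s - s\<^sup>2 / 2)) * emeasure (gauss_vec n) G"
    by (rule mult_left_mono[OF half]) simp
  also have "\<dots> = (\<integral>\<^sup>+h. ennreal (exp (- 2 * s - s\<^sup>2 / 2)) * indicator G h \<partial>gauss_vec n)"
    by (simp add: nn_integral_cmult_indicator)
  \<comment> \<open>The density factor for the shift by \<open>- s * v\<close> has exponent
    \<open>- s * ip n v h - s\<^sup>2 / 2\<close>, which on \<open>G\<close> is at least the
    constant because \<open>ip n v h \<le> 2\<close> and \<open>0 \<le> s\<close>. Since
    \<open>v\<close> is fixed by the projection, the shifted vector is projected to the projection
    of \<open>h\<close> minus \<open>s * v\<close>.\<close>
  also have "\<dots> \<le> (\<integral>\<^sup>+h. F h * ennreal (exp (ip n (\<lambda>i. - s * v i) h - ip n (\<lambda>i. - s * v i) (\<lambda>i. - s * v i) / 2)) \<partial>gauss_vec n)"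
  proof (rule nn_integral_mono)
    fix h
    have "ip n (\<lambda>i. - s * v i) h - ip n (\<lambda>i. - s * v i) (\<lambda>i. - s * v i) / 2 = - s * ip n v h - s\<^sup>2 / 2"
      by (simp only: ip_scale_left ip_scale_right v) (simp add: power2_eq_square)
    moreover have "s * ip n v h \<le> s * 2" if "h \<in> G"
      using that s by (intro mult_left_mono) (auto simp: G_def)
    ultimately show "ennreal (exp (- 2 * s - s\<^sup>2 / 2)) * indicator G h \<le> F h * ennreal (exp (ip n (\<lambda>i. - s * v i) h - ip n (\<lambda>i. - s * v i) (\<lambda>i. - s * v i) / 2))"
      by (auto simp: indicator_def F_def G_def)
  qed
  also have "\<dots> = (\<integral>\<^sup>+h. F (\<lambda>i. if i < n then h i + (- s * v i) else h i) \<partial>gauss_vec n)"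
    by (rule nn_integral_gauss_vec_shift[symmetric]) measurable
  also have "\<dots> = (\<integral>\<^sup>+h. indicator {h \<in> space (gauss_vec n). ip n (\<lambda>i. gs_proj n A j h i - s * v i) (\<lambda>i. gs_proj n A j h i - s * v i) \<le> 4 * e} h \<partial>gauss_vec n)"
  proof (rule nn_integral_cong)
    fix h assume h: "h \<in> space (gauss_vec n)"
    have "W (\<lambda>i. if i < n then h i + (- s * v i) else h i) = ip n (gs_proj n A j (\<lambda>i. h i - s * v i)) (gs_proj n A j (\<lambda>i. h i - s * v i))"
      unfolding W_def by (rule ip_cong; rule gs_proj_cong_arg; simp)
    also have "\<dots> = ip n (\<lambda>i. gs_proj n A j h i - s * v i) (\<lambda>i. gs_proj n A j h i - s * v i)"
      by (simp add: gs_proj_linear v)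
    finally show "F (\<lambda>i. if i < n then h i + (- s * v i) else h i) = indicator {h \<in> space (gauss_vec n). ip n (\<lambda>i. gs_proj n A j h i - s * v i) (\<lambda>i. gs_proj n A j h i - s * v i) \<le> 4 * e} h"
      using h by (simp add: F_def indicator_def)
  qed
  also have "\<dots> = emeasure (gauss_vec n) {h \<in> space (gauss_vec n). ip n (\<lambda>i. gs_proj n A j h i - s * v i) (\<lambda>i. gs_proj n A j h i - s * v i) \<le> 4 * e}"
  proof (rule nn_integral_indicator)
    have "(\<lambda>h. ip n (\<lambda>i. gs_proj n A j h i - s * v i) (\<lambda>i. gs_proj n A j h i - s * v i)) \<in> borel_measurable (gauss_vec n)"
      by (intro measurable_ip borel_measurable_diff measurable_gs_proj) auto
    then show "{h \<in> space (gauss_vec n). ip n (\<lambda>i. gs_proj n A j h i - s * v i) (\<lambda>i. gs_proj n A j h i - s * v i) \<le> 4 * e} \<in> sets (gauss_vec n)"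
      by measurable
  qed
  finally show ?thesis .
qed

section \<open>Spherical caps and rotation-invariant random directions\<close>

text \<open>Closeness of directions, with \<open>\<kappa>\<close> as the cosine of the opening
  angle. The zero vector has no direction and is excluded on both sides; this matters because the
  projected vector can vanish with positive probability.\<close>

definition cap :: "nat \<Rightarrow> real \<Rightarrow> (nat \<Rightarrow> real) \<Rightarrow> (nat \<Rightarrow> real) \<Rightarrow> bool" where
  "cap n \<kappa> x y \<longleftrightarrow> 0 < ip n x x \<and> 0 < ip n y y \<and> \<kappa> * (sqrt (ip n x x) * sqrt (ip n y y)) \<le> ip n x y"

lemma cap_commute: "cap n \<kappa> x y \<longleftrightarrow> cap n \<kappa> y x"
  by (auto simp: cap_def ip_commute[of n x y] mult.commute)

lemma cap_plane_rot:
  assumes "a \<noteq> b" "a < n" "b < n" "c\<^sup>2 + s\<^sup>2 = 1"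
  shows "cap n \<kappa> (plane_rot a b c s x) (plane_rot a b c s y) \<longleftrightarrow> cap n \<kappa> x y"
  by (simp add: cap_def plane_rot_ip[OF assms])

lemma cap_cong: "(\<And>i. i < n \<Longrightarrow> y i = y' i) \<Longrightarrow> cap n \<kappa> x y \<longleftrightarrow> cap n \<kappa> x y'"
  unfolding cap_def using ip_cong[of n y y' y y'] ip_cong[of n x x y y'] by simp

lemma cap_scale: "0 < t \<Longrightarrow> cap n \<kappa> x (\<lambda>i. t * y i) \<longleftrightarrow> cap n \<kappa> x y"
proof -
  assume t: "0 < t"
  have "sqrt (t * (t * ip n y y)) = t * sqrt (ip n y y)"
    using t by (simp add: real_sqrt_mult flip: mult.assoc)
  then have "cap n \<kappa> x (\<lambda>i. t * y i) \<longleftrightarrow> 0 < ip n x x \<and> 0 < t * (t * ip n y y)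
      \<and> \<kappa> * (sqrt (ip n x x) * (t * sqrt (ip n y y))) \<le> t * ip n x y"
    by (simp only: cap_def ip_scale_left ip_scale_right)
  also have "\<kappa> * (sqrt (ip n x x) * (t * sqrt (ip n y y))) = t * (\<kappa> * (sqrt (ip n x x) * sqrt (ip n y y)))"
    by simp
  finally show ?thesis
    using t by (simp only: cap_def mult_le_cancel_left_pos) (simp add: zero_less_mult_iff)
qed

lemma measurable_cap:
  assumes "\<And>i. i < n \<Longrightarrow> (\<lambda>\<omega>. X \<omega> i) \<in> borel_measurable M" "\<And>i. i < n \<Longrightarrow> (\<lambda>\<omega>. Y \<omega> i) \<in> borel_measurable M"
  shows "Measurable.pred M (\<lambda>\<omega>. cap n \<kappa> (X \<omega>) (Y \<omega>))"
proof -
  have [measurable]: "(\<lambda>\<omega>. ip n (X \<omega>) (X \<omega>)) \<in> borel_measurable M" "(\<lambda>\<omega>. ip n (X \<omega>) (Y \<omega>)) \<in> borel_measurable M"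
     "(\<lambda>\<omega>. ip n (Y \<omega>) (Y \<omega>)) \<in> borel_measurable M"
    using assms by (auto intro!: measurable_ip)
  show ?thesis unfolding cap_def by measurable
qed

text \<open>Invariance is required of the cap probabilities only. That is weaker than invariance of
  the law of \<open>X\<close>, and it is what the double counting consumes.\<close>

lemma cap_prob_const:
  assumes n: "2 \<le> n"
    and rot: "\<And>a b c s y. a \<noteq> b \<Longrightarrow> a < n \<Longrightarrow> b < n \<Longrightarrow> c\<^sup>2 + s\<^sup>2 = 1 \<Longrightarrow>
       emeasure M {\<omega> \<in> space M. cap n \<kappa> (X \<omega>) (plane_rot a b c s y)} = emeasure M {\<omega> \<in> space M. cap n \<kappa> (X \<omega>) y}"
    and "0 < ip n y y" "0 < ip n y' y'"
  shows "emeasure M {\<omega> \<in> space M. cap n \<kappa> (X \<omega>) y} = emeasure M {\<omega> \<in> space M. cap n \<kappa> (X \<omega>) y'}"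
proof (rule rot_invariant_const[where \<phi> = "\<lambda>y. emeasure M {\<omega> \<in> space M. cap n \<kappa> (X \<omega>) y}", OF n rot _ _ assms(3,4)])
  fix y y' assume "\<And>i. i < n \<Longrightarrow> y i = (y' i :: real)"
  then show "emeasure M {\<omega> \<in> space M. cap n \<kappa> (X \<omega>) y} = emeasure M {\<omega> \<in> space M. cap n \<kappa> (X \<omega>) y'}"
    using cap_cong[of n y y'] by simp
qed (simp_all add: cap_scale)

lemma gauss_vec_cap_rot:
  assumes "a \<noteq> b" "a < n" "b < n" "c\<^sup>2 + s\<^sup>2 = 1"
  shows "emeasure (gauss_vec n) {h \<in> space (gauss_vec n). cap n \<kappa> h (plane_rot a b c s y)} =
    emeasure (gauss_vec n) {h \<in> space (gauss_vec n). cap n \<kappa> h y}"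
proof -
  have [measurable]: "Measurable.pred (gauss_vec n) (\<lambda>h. cap n \<kappa> h y)" for y
    by (rule measurable_cap) auto
  have "emeasure (gauss_vec n) {h \<in> space (gauss_vec n). cap n \<kappa> h (plane_rot a b c s y)} =
     emeasure (distr (gauss_vec n) (gauss_vec n) (plane_rot a b c s)) {h \<in> space (gauss_vec n). cap n \<kappa> h (plane_rot a b c s y)}"
    by (simp add: distr_gauss_vec_rot[OF assms])
  also have "\<dots> = emeasure (gauss_vec n) (plane_rot a b c s -` {h \<in> space (gauss_vec n). cap n \<kappa> h (plane_rot a b c s y)} \<inter> space (gauss_vec n))"
    using assms by (intro emeasure_distr measurable_plane_rot_gauss_vec) measurable
  also have "plane_rot a b c s -` {h \<in> space (gauss_vec n). cap n \<kappa> h (plane_rot a b c s y)} \<inter> space (gauss_vec n) = {h \<in> space (gauss_vec n). cap n \<kappa> h y}"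
    using measurable_space[OF measurable_plane_rot_gauss_vec[OF assms(2,3), of c s]] by (auto simp: cap_plane_rot[OF assms])
  finally show ?thesis .
qed

text \<open>Double counting of the pairs \<open>(X, h)\<close> whose directions are within one cap. It takes the place of the uniqueness of
  the rotation-invariant measure on the sphere.\<close>

lemma rot_invariant_compare:
  assumes n: "2 \<le> n"
    and M: "prob_space M" and X: "\<And>i. i < n \<Longrightarrow> (\<lambda>\<omega>. X \<omega> i) \<in> borel_measurable M"
    and rot: "\<And>a b c s y. a \<noteq> b \<Longrightarrow> a < n \<Longrightarrow> b < n \<Longrightarrow> c\<^sup>2 + s\<^sup>2 = 1 \<Longrightarrow>
       emeasure M {\<omega> \<in> space M. cap n \<kappa> (X \<omega>) (plane_rot a b c s y)} = emeasure M {\<omega> \<in> space M. cap n \<kappa> (X \<omega>) y}"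
    and K1[measurable]: "Measurable.pred M (\<lambda>\<omega>. K1 (X \<omega>))" and K2[measurable]: "Measurable.pred (gauss_vec n) K2"
    and K1_pos: "\<And>x. K1 x \<Longrightarrow> 0 < ip n x x" and K12: "\<And>x y. K1 x \<Longrightarrow> cap n \<kappa> x y \<Longrightarrow> K2 y"
    and pos: "0 < emeasure (gauss_vec n) {h \<in> space (gauss_vec n). cap n \<kappa> h (\<lambda>i. 1)}"
  shows "emeasure M {\<omega> \<in> space M. K1 (X \<omega>)} \<le> emeasure (gauss_vec n) {h \<in> space (gauss_vec n). K2 h}"
proof -
  interpret M: prob_space M by (rule M)
  interpret G: prob_space "gauss_vec n" by (rule prob_space_gauss_vec)
  interpret P: pair_prob_space M "gauss_vec n" ..
  define e :: "nat \<Rightarrow> real" where "e = (\<lambda>i. 1)"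
  have e: "0 < ip n e e" using n by (auto simp: ip_self_pos_iff e_def intro!: exI[of _ 0])
  \<comment> \<open>The common probability of all caps for \<open>h\<close>;
    \<open>\<gamma>'\<close> is the one for \<open>X\<close>. Neither depends on the center as long
    as that is nonzero.\<close>
  define \<gamma> where "\<gamma> = emeasure (gauss_vec n) {h \<in> space (gauss_vec n). cap n \<kappa> h e}"
  define \<gamma>' where "\<gamma>' = emeasure M {\<omega> \<in> space M. cap n \<kappa> (X \<omega>) e}"
  have \<gamma>: "emeasure (gauss_vec n) {h \<in> space (gauss_vec n). cap n \<kappa> h y} = \<gamma>" if "0 < ip n y y" for y
    unfolding \<gamma>_def by (rule cap_prob_const[OF n gauss_vec_cap_rot that e])
  have \<gamma>': "emeasure M {\<omega> \<in> space M. cap n \<kappa> (X \<omega>) y} = \<gamma>'" if "0 < ip n y y" for y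
    unfolding \<gamma>'_def by (rule cap_prob_const[OF n rot that e])
  have cap0: "\<not> cap n \<kappa> x y" if "\<not> 0 < ip n y y" for x y using that by (simp add: cap_def)
  have capc[measurable]: "Measurable.pred (M \<Otimes>\<^sub>M gauss_vec n) (\<lambda>p. cap n \<kappa> (X (fst p)) (snd p))"
    by (rule measurable_cap) (auto intro: measurable_compose[OF measurable_fst X] measurable_compose[OF measurable_snd])
  have [measurable]: "Measurable.pred (gauss_vec n) (\<lambda>h. cap n \<kappa> x h)" for x
    by (rule measurable_cap) auto
  have [measurable]: "Measurable.pred (gauss_vec n) (\<lambda>h. cap n \<kappa> h x)" for x
    by (rule measurable_cap) auto
  have [measurable]: "Measurable.pred M (\<lambda>\<omega>. cap n \<kappa> (X \<omega>) y)" for y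
    by (rule measurable_cap) (auto intro: X)
  have ipm[measurable]: "(\<lambda>h. ip n h h) \<in> borel_measurable (gauss_vec n)"
    by (rule measurable_ip) auto
  have I1: "(\<integral>\<^sup>+h. indicator {h. cap n \<kappa> x h} h \<partial>gauss_vec n) = (if 0 < ip n x x then \<gamma> else 0)" for x
  proof -
    have "(\<integral>\<^sup>+h. indicator {h. cap n \<kappa> x h} h \<partial>gauss_vec n) = (\<integral>\<^sup>+h. indicator {h \<in> space (gauss_vec n). cap n \<kappa> h x} h \<partial>gauss_vec n)"
      by (intro nn_integral_cong) (auto simp: indicator_def cap_commute)
    also have "\<dots> = emeasure (gauss_vec n) {h \<in> space (gauss_vec n). cap n \<kappa> h x}" by simp
    finally show ?thesis using \<gamma>[of x] cap0[of x] by simp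
  qed
  have I2: "(\<integral>\<^sup>+\<omega>. indicator {\<omega>. cap n \<kappa> (X \<omega>) y} \<omega> \<partial>M) = (if 0 < ip n y y then \<gamma>' else 0)" for y
  proof -
    have "(\<integral>\<^sup>+\<omega>. indicator {\<omega>. cap n \<kappa> (X \<omega>) y} \<omega> \<partial>M) = (\<integral>\<^sup>+\<omega>. indicator {\<omega> \<in> space M. cap n \<kappa> (X \<omega>) y} \<omega> \<partial>M)"
      by (intro nn_integral_cong) (auto simp: indicator_def)
    also have "\<dots> = emeasure M {\<omega> \<in> space M. cap n \<kappa> (X \<omega>) y}" by simp
    finally show ?thesis using \<gamma>'[of y] cap0[of y] by simp
  qed
  have one: "emeasure (gauss_vec n) {h \<in> space (gauss_vec n). 0 < ip n h h} = 1"
  proof -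
    have "AE h in gauss_vec n. ip n e h \<noteq> 0"
      using emeasure_ip_eq_0[OF e] by (intro AE_I[where N="{h \<in> space (gauss_vec n). ip n e h = 0}"])
        (auto intro!: measurable_ip borel_measurable_eq)
    then have "AE h in gauss_vec n. 0 < ip n h h"
    proof eventually_elim
      case (elim h)
      then show ?case using ip_self_eq_0D[of n h e] ip_self_nonneg[of n h] by (auto simp: less_le)
    qed
    then show ?thesis by (intro G.emeasure_eq_1_AE) measurable
  qed
  \<comment> \<open>The probability that \<open>X\<close> and \<open>h\<close> are within one cap,
    computed in both orders: conditioning on \<open>h\<close>, which is almost surely nonzero, gives
    \<open>\<gamma>'\<close>, and conditioning on \<open>X\<close> gives \<open>\<gamma>\<close>
    times the probability that \<open>X\<close> is nonzero.\<close>
  have "\<gamma>' \<le> \<gamma>"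
  proof -
    have "\<gamma>' = (\<integral>\<^sup>+h. \<gamma>' * indicator {h \<in> space (gauss_vec n). 0 < ip n h h} h \<partial>gauss_vec n)"
      by (subst nn_integral_cmult_indicator) (auto simp: one)
    also have "\<dots> = (\<integral>\<^sup>+h. \<integral>\<^sup>+\<omega>. indicator {\<omega>. cap n \<kappa> (X \<omega>) h} \<omega> \<partial>M \<partial>gauss_vec n)"
      unfolding I2 by (intro nn_integral_cong) (auto simp: indicator_def)
    also have "\<dots> = (\<integral>\<^sup>+h. \<integral>\<^sup>+\<omega>. indicator {p. cap n \<kappa> (X (fst p)) (snd p)} (\<omega>, h) \<partial>M \<partial>gauss_vec n)"
      by (intro nn_integral_cong) (simp add: indicator_def)
    also have "\<dots> = (\<integral>\<^sup>+\<omega>. \<integral>\<^sup>+h. indicator {p. cap n \<kappa> (X (fst p)) (snd p)} (\<omega>, h) \<partial>gauss_vec n \<partial>M)"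
      by (rule P.Fubini') measurable
    also have "\<dots> = (\<integral>\<^sup>+\<omega>. (\<integral>\<^sup>+h. indicator {h. cap n \<kappa> (X \<omega>) h} h \<partial>gauss_vec n) \<partial>M)"
      by (intro nn_integral_cong) (simp add: indicator_def)
    also have "\<dots> \<le> (\<integral>\<^sup>+\<omega>. \<gamma> \<partial>M)"
      unfolding I1 by (intro nn_integral_mono) auto
    also have "\<dots> = \<gamma>" by (simp add: M.emeasure_space_1)
    finally show ?thesis .
  qed
  \<comment> \<open>The same count restricted to pairs with \<open>K1 (X \<omega>)\<close>: each
    such \<open>X\<close> has partners \<open>h\<close> of mass \<open>\<gamma>\<close>, and every
    partner satisfies \<open>K2\<close> and has in turn at most mass \<open>\<gamma>'\<close> of
    partners \<open>X\<close>.\<close>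
  have "emeasure M {\<omega> \<in> space M. K1 (X \<omega>)} * \<gamma> = (\<integral>\<^sup>+\<omega>. \<gamma> * indicator {\<omega> \<in> space M. K1 (X \<omega>)} \<omega> \<partial>M)"
    by (subst nn_integral_cmult_indicator) (auto simp: mult.commute)
  also have "\<dots> = (\<integral>\<^sup>+\<omega>. indicator {\<omega>. K1 (X \<omega>)} \<omega> * (\<integral>\<^sup>+h. indicator {h. cap n \<kappa> (X \<omega>) h} h \<partial>gauss_vec n) \<partial>M)"
    unfolding I1 by (intro nn_integral_cong) (use K1_pos in \<open>auto simp: indicator_def\<close>)
  also have "\<dots> = (\<integral>\<^sup>+\<omega>. \<integral>\<^sup>+h. indicator {p. K1 (X (fst p)) \<and> cap n \<kappa> (X (fst p)) (snd p)} (\<omega>, h) \<partial>gauss_vec n \<partial>M)"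
    by (intro nn_integral_cong) (auto simp: indicator_def simp flip: nn_integral_cmult intro!: nn_integral_cong)
  also have "\<dots> = (\<integral>\<^sup>+h. \<integral>\<^sup>+\<omega>. indicator {p. K1 (X (fst p)) \<and> cap n \<kappa> (X (fst p)) (snd p)} (\<omega>, h) \<partial>M \<partial>gauss_vec n)"
    by (rule P.Fubini'[symmetric]) measurable
  also have "\<dots> \<le> (\<integral>\<^sup>+h. \<integral>\<^sup>+\<omega>. indicator {h \<in> space (gauss_vec n). K2 h} h * indicator {\<omega>. cap n \<kappa> (X \<omega>) h} \<omega> \<partial>M \<partial>gauss_vec n)"
    by (intro nn_integral_mono) (auto simp: indicator_def K12)
  also have "\<dots> = (\<integral>\<^sup>+h. indicator {h \<in> space (gauss_vec n). K2 h} h * (if 0 < ip n h h then \<gamma>' else 0) \<partial>gauss_vec n)"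
  proof (rule nn_integral_cong)
    fix h
    have "(\<integral>\<^sup>+\<omega>. indicator {h \<in> space (gauss_vec n). K2 h} h * indicator {\<omega>. cap n \<kappa> (X \<omega>) h} \<omega> \<partial>M)
      = indicator {h \<in> space (gauss_vec n). K2 h} h * (\<integral>\<^sup>+\<omega>. indicator {\<omega>. cap n \<kappa> (X \<omega>) h} \<omega> \<partial>M)"
      by (rule nn_integral_cmult) measurable
    then show "(\<integral>\<^sup>+\<omega>. indicator {h \<in> space (gauss_vec n). K2 h} h * indicator {\<omega>. cap n \<kappa> (X \<omega>) h} \<omega> \<partial>M)
      = indicator {h \<in> space (gauss_vec n). K2 h} h * (if 0 < ip n h h then \<gamma>' else 0)"
      by (simp add: I2)
  qed
  also have "\<dots> \<le> (\<integral>\<^sup>+h. \<gamma> * indicator {h \<in> space (gauss_vec n). K2 h} h \<partial>gauss_vec n)"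
    using \<open>\<gamma>' \<le> \<gamma>\<close> by (intro nn_integral_mono) (auto simp: indicator_def)
  also have "\<dots> = emeasure (gauss_vec n) {h \<in> space (gauss_vec n). K2 h} * \<gamma>"
    by (subst nn_integral_cmult_indicator) (auto simp: mult.commute)
  finally have le: "emeasure M {\<omega> \<in> space M. K1 (X \<omega>)} * \<gamma> \<le> emeasure (gauss_vec n) {h \<in> space (gauss_vec n). K2 h} * \<gamma>" .
  have "\<gamma> < top" unfolding \<gamma>_def by (simp add: G.emeasure_eq_measure)
  moreover have "0 < \<gamma>" using pos by (simp add: \<gamma>_def e_def)
  ultimately show ?thesis
    using le by (simp add: mult.commute[of _ \<gamma>] ennreal_mult_le_mult_iff)
qed

section \<open>The random test vector in the null space\<close>

text \<open>Rotating the rows and \<open>h\<close> by the same plane rotation preserves their joint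
  law and rotates the projection, and a cap relation does not change when both arguments rotate. The
  law of the rows is rotated in the outer integral and that of \<open>h\<close> in the inner
  one.\<close>

lemma gs_proj_cap_rot:
  assumes V: "a \<noteq> b" "a < n" "b < n" "c\<^sup>2 + s\<^sup>2 = 1" and j: "j \<le> m"
  shows "emeasure (gauss_rows m n \<Otimes>\<^sub>M gauss_vec n)
      {p \<in> space (gauss_rows m n \<Otimes>\<^sub>M gauss_vec n). cap n \<kappa> (gs_proj n (fst p) j (snd p)) (plane_rot a b c s y)}
    = emeasure (gauss_rows m n \<Otimes>\<^sub>M gauss_vec n)
      {p \<in> space (gauss_rows m n \<Otimes>\<^sub>M gauss_vec n). cap n \<kappa> (gs_proj n (fst p) j (snd p)) y}"
proof -
  interpret M: prob_space "gauss_rows m n" by (rule prob_space_gauss_rows)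
  interpret G: prob_space "gauss_vec n" by (rule prob_space_gauss_vec)
  have m: "Measurable.pred (gauss_rows m n \<Otimes>\<^sub>M gauss_vec n) (\<lambda>p. cap n \<kappa> (gs_proj n (fst p) j (snd p)) y)" for y
    using j by (intro measurable_cap measurable_gs_proj measurable_compose[OF measurable_fst measurable_gauss_rows_component]
       measurable_compose[OF measurable_snd measurable_gauss_vec_component]) auto
  have m2: "(\<lambda>h. indicator {h. cap n \<kappa> (gs_proj n A j h) y} h :: ennreal) \<in> borel_measurable (gauss_vec n)" for A y
  proof -
    have [measurable]: "Measurable.pred (gauss_vec n) (\<lambda>h. cap n \<kappa> (gs_proj n A j h) y)"
      by (intro measurable_cap measurable_gs_proj) auto
    show ?thesis by measurable
  qed
  define f :: "_ \<Rightarrow> _ \<Rightarrow> ennreal" where "f y A = (\<integral>\<^sup>+h. indicator {h. cap n \<kappa> (gs_proj n A j h) y} h \<partial>gauss_vec n)" for y A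
  have e: "emeasure (gauss_rows m n \<Otimes>\<^sub>M gauss_vec n)
      {p \<in> space (gauss_rows m n \<Otimes>\<^sub>M gauss_vec n). cap n \<kappa> (gs_proj n (fst p) j (snd p)) y} = (\<integral>\<^sup>+A. f y A \<partial>gauss_rows m n)" for y
    unfolding f_def
    by (subst G.emeasure_pair_measure, use m[of y] in measurable)
       (auto intro!: nn_integral_cong simp: indicator_def space_pair_measure)
  have fm: "f y \<in> borel_measurable (gauss_rows m n)" for y
  proof -
    have "(\<lambda>(A, h). indicator {p. cap n \<kappa> (gs_proj n (fst p) j (snd p)) y} (A, h) :: ennreal) \<in> borel_measurable (gauss_rows m n \<Otimes>\<^sub>M gauss_vec n)"
      using m[of y] by (simp add: split_beta') 
    from G.borel_measurable_nn_integral[OF this] show ?thesis by (simp add: f_def[abs_def] indicator_def[abs_def])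
  qed
  let ?V = "plane_rot a b c s"
  let ?R = "\<lambda>A. \<lambda>i\<in>{..<m}. plane_rot a b c s (A i)"
  have "(\<integral>\<^sup>+A. f (?V y) A \<partial>gauss_rows m n) = (\<integral>\<^sup>+A. f (?V y) A \<partial>distr (gauss_rows m n) (gauss_rows m n) ?R)"
    by (simp add: distr_gauss_rows_rot[OF V])
  also have "\<dots> = (\<integral>\<^sup>+A. f (?V y) (?R A) \<partial>gauss_rows m n)"
    by (subst nn_integral_distr) (use V fm in \<open>auto intro: measurable_rows_rot\<close>)
  also have "\<dots> = (\<integral>\<^sup>+A. f y A \<partial>gauss_rows m n)"
  proof (rule nn_integral_cong)
    fix A
    have "f (?V y) (?R A) = (\<integral>\<^sup>+h. indicator {h. cap n \<kappa> (gs_proj n (?R A) j h) (?V y)} h \<partial>distr (gauss_vec n) (gauss_vec n) ?V)"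
      by (simp add: f_def distr_gauss_vec_rot[OF V])
    also have "\<dots> = (\<integral>\<^sup>+h. indicator {h. cap n \<kappa> (gs_proj n (?R A) j h) (?V y)} (?V h) \<partial>gauss_vec n)"
      by (subst nn_integral_distr) (use V m2 in \<open>auto intro: measurable_plane_rot_gauss_vec\<close>)
    also have "\<dots> = f y A"
    proof -
      have "gs_proj n (?R A) j (?V h) = ?V (gs_proj n A j h)" for h
        using gs_proj_plane_rot[OF V, of A j h] gs_proj_cong[of j "?R A" "\<lambda>i. ?V (A i)" n "?V h"] j by simp
      then show ?thesis unfolding f_def
        by (intro nn_integral_cong) (simp add: indicator_def cap_plane_rot[OF V])
    qed
    finally show "f (?V y) (?R A) = f y A" .
  qed
  finally show ?thesis unfolding e .
qed

text \<open>The argument for abstract nested sets: \<open>K0\<close> is to be avoided,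
  \<open>K1\<close> absorbs projection noise of squared size \<open>4 * e\<close> around
  \<open>s * v\<close>, and \<open>K2\<close> absorbs a further turn within a cap. The first
  \<open>j\<close> rows are used, and \<open>e\<close> bounds the mean squared norm
  \<open>n - j\<close> of the projection.\<close>

lemma null_space_avoids:
  assumes n: "2 \<le> n" and j: "j \<le> m" "j \<le> n" and e: "real n - real j \<le> e" "0 < e" and s: "0 \<le> s"
    and K1: "Measurable.pred (gauss_rows m n \<Otimes>\<^sub>M gauss_vec n) (\<lambda>p. K1 (gs_proj n (fst p) j (snd p)))"
    and K2: "Measurable.pred (gauss_vec n) K2"
    and K01: "\<And>v x. K0 v \<Longrightarrow> ip n v v = 1 \<Longrightarrow> ip n (\<lambda>i. x i - s * v i) (\<lambda>i. x i - s * v i) \<le> 4 * e \<Longrightarrow> K1 x"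
    and K1_pos: "\<And>x. K1 x \<Longrightarrow> 0 < ip n x x" and K12: "\<And>x y. K1 x \<Longrightarrow> cap n \<kappa> x y \<Longrightarrow> K2 y"
    and pos: "0 < emeasure (gauss_vec n) {h \<in> space (gauss_vec n). cap n \<kappa> h (\<lambda>i. 1)}"
  shows "\<exists>S\<in>sets (gauss_rows m n). (\<forall>A\<in>S. \<forall>v. ip n v v = 1 \<and> (\<forall>i<j. ip n (A i) v = 0) \<longrightarrow> \<not> K0 v) \<and>
     1 - 2 * exp (2 * s + s\<^sup>2 / 2) * measure (gauss_vec n) {h \<in> space (gauss_vec n). K2 h} \<le> measure (gauss_rows m n) S"
proof -
  interpret M: prob_space "gauss_rows m n" by (rule prob_space_gauss_rows)
  interpret G: prob_space "gauss_vec n" by (rule prob_space_gauss_vec)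
  interpret P: pair_prob_space "gauss_rows m n" "gauss_vec n" ..
  let ?P = "gauss_rows m n \<Otimes>\<^sub>M gauss_vec n"
  \<comment> \<open>Lower bound for the conditional probability of \<open>K1\<close>, given a
    full-rank matrix whose null space contains a unit vector of \<open>K0\<close>.\<close>
  define q where "q = exp (- 2 * s - s\<^sup>2 / 2) / 2"
  have q: "0 < q" by (simp add: q_def)
  define f :: "_ \<Rightarrow> ennreal" where "f A = (\<integral>\<^sup>+h. indicator {h. K1 (gs_proj n A j h)} h \<partial>gauss_vec n)" for A
  have f[measurable]: "f \<in> borel_measurable (gauss_rows m n)"
  proof -
    have "(\<lambda>(A, h). indicator {p. K1 (gs_proj n (fst p) j (snd p))} (A, h) :: ennreal) \<in> borel_measurable ?P"
      using K1 by (simp add: split_beta')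
    from G.borel_measurable_nn_integral[OF this] show ?thesis by (simp add: f_def[abs_def] indicator_def[abs_def])
  qed
  define B where "B i A = ip n (gs_proj n A i (A i)) (gs_proj n A i (A i))" for i A
  have B[measurable]: "B i \<in> borel_measurable (gauss_rows m n)" if "i < j" for i
    unfolding B_def[abs_def] using that j by (intro measurable_ip measurable_gs_proj measurable_gauss_rows_component) auto
  \<comment> \<open>The good event is defined through the conditional probability \<open>f\<close>,
    which is measurable in the matrix; the statement about all null vectors is an uncountable
    intersection and is only derived on \<open>S\<close>.\<close>
  define S where "S = {A \<in> space (gauss_rows m n). f A < ennreal q \<and> (\<forall>i\<in>{..<j}. 0 < B i A)}"
  have S[measurable]: "S \<in> sets (gauss_rows m n)"
    unfolding S_def by measurable
  have fK: "(\<integral>\<^sup>+A. f A \<partial>gauss_rows m n) \<le> emeasure (gauss_vec n) {h \<in> space (gauss_vec n). K2 h}"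
  proof -
    have "(\<integral>\<^sup>+A. f A \<partial>gauss_rows m n) = emeasure ?P {p \<in> space ?P. K1 (gs_proj n (fst p) j (snd p))}"
      unfolding f_def
      by (subst G.emeasure_pair_measure, use K1 in measurable)
         (auto intro!: nn_integral_cong simp: indicator_def space_pair_measure)
    also have "\<dots> \<le> emeasure (gauss_vec n) {h \<in> space (gauss_vec n). K2 h}"
    proof (rule rot_invariant_compare[OF n _ _ _ K1 K2 K1_pos K12 pos])
      show "prob_space ?P" by (rule P.prob_space_axioms)
      show "(\<lambda>p. gs_proj n (fst p) j (snd p) i) \<in> borel_measurable ?P" if "i < n" for i
        using j that by (intro measurable_gs_proj measurable_compose[OF measurable_fst measurable_gauss_rows_component]
         measurable_compose[OF measurable_snd measurable_gauss_vec_component]) auto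
    qed (use j in \<open>auto intro: gs_proj_cap_rot\<close>)
    finally show ?thesis .
  qed
  have "emeasure (gauss_rows m n) {A \<in> space (gauss_rows m n). ennreal q \<le> f A} * ennreal q
    = (\<integral>\<^sup>+A. ennreal q * indicator {A \<in> space (gauss_rows m n). ennreal q \<le> f A} A \<partial>gauss_rows m n)"
    by (subst nn_integral_cmult_indicator) (auto simp: mult.commute)
  also have "\<dots> \<le> (\<integral>\<^sup>+A. f A \<partial>gauss_rows m n)"
    by (intro nn_integral_mono) (auto simp: indicator_def)
  also note fK
  finally have "M.prob {A \<in> space (gauss_rows m n). ennreal q \<le> f A} * q \<le> G.prob {h \<in> space (gauss_vec n). K2 h}"
    using q by (simp add: M.emeasure_eq_measure G.emeasure_eq_measure flip: ennreal_mult)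
  then have 1: "M.prob {A \<in> space (gauss_rows m n). ennreal q \<le> f A} \<le> G.prob {h \<in> space (gauss_vec n). K2 h} / q"
    using q by (simp add: field_simps)
  have ae: "AE A in gauss_rows m n. \<forall>i\<in>{..<j}. 0 < B i A"
  proof (rule AE_finite_allI)
    fix i assume i: "i \<in> {..<j}"
    have "AE A in gauss_rows m n. B i A \<noteq> 0"
    proof (rule AE_I)
      have [measurable]: "B i \<in> borel_measurable (gauss_rows m n)" using i B by auto
      show "{A \<in> space (gauss_rows m n). B i A = 0} \<in> sets (gauss_rows m n)" by measurable
      show "emeasure (gauss_rows m n) {A \<in> space (gauss_rows m n). B i A = 0} = 0"
        using emeasure_gs_proj_degenerate[of i n m] i j by (simp add: B_def)
    qed auto
    then show "AE A in gauss_rows m n. 0 < B i A"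
      by eventually_elim (auto simp: B_def less_le)
  qed simp
  have "M.prob (space (gauss_rows m n) - S) \<le> M.prob {A \<in> space (gauss_rows m n). ennreal q \<le> f A}"
    using ae by (intro M.finite_measure_mono_AE) (auto simp: S_def)
  also note 1
  finally have "1 - G.prob {h \<in> space (gauss_vec n). K2 h} / q \<le> M.prob S"
    using M.prob_compl[OF S] by simp
  moreover have "G.prob {h \<in> space (gauss_vec n). K2 h} / q = 2 * exp (2 * s + s\<^sup>2 / 2) * G.prob {h \<in> space (gauss_vec n). K2 h}"
  proof -
    have "exp (- 2 * s - s\<^sup>2 / 2) * exp (2 * s + s\<^sup>2 / 2) = 1" by (simp flip: exp_add)
    then have a: "inverse (exp (- 2 * s - s\<^sup>2 / 2)) = exp (2 * s + s\<^sup>2 / 2)" by (rule inverse_unique)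
    have b: "x / (y / 2) = 2 * inverse y * x" for x y :: real by (simp add: field_simps)
    show ?thesis unfolding q_def b a ..
  qed
  moreover have "\<not> K0 v" if A: "A \<in> S" and v: "ip n v v = 1" "\<forall>i<j. ip n (A i) v = 0" for A v
  proof
    assume K0: "K0 v"
    \<comment> \<open>Full rank makes the mean squared norm exactly \<open>n - j\<close>, so the
      shift bound applies with \<open>e\<close>.\<close>
    have "{i. i < j \<and> 0 < ip n (gs_proj n A i (A i)) (gs_proj n A i (A i))} = {..<j}"
      using A by (auto simp: S_def B_def)
    then have "(\<integral>x. ip n (gs_proj n A j x) (gs_proj n A j x) \<partial>gauss_vec n) \<le> e"
      using e by (simp add: integral_gs_proj_norm_sq)
    from gauss_vec_shift_lower[OF this e(2) v(1) gs_proj_fix s] v(2)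
    have "ennreal q \<le> emeasure (gauss_vec n) {h \<in> space (gauss_vec n).
       ip n (\<lambda>i. gs_proj n A j h i - s * v i) (\<lambda>i. gs_proj n A j h i - s * v i) \<le> 4 * e}"
      by (simp add: q_def)
    also have "\<dots> = (\<integral>\<^sup>+h. indicator {h \<in> space (gauss_vec n). ip n (\<lambda>i. gs_proj n A j h i - s * v i) (\<lambda>i. gs_proj n A j h i - s * v i) \<le> 4 * e} h \<partial>gauss_vec n)"
    proof (rule nn_integral_indicator[symmetric])
      have [measurable]: "(\<lambda>h. ip n (\<lambda>i. gs_proj n A j h i - s * v i) (\<lambda>i. gs_proj n A j h i - s * v i)) \<in> borel_measurable (gauss_vec n)"
        by (intro measurable_ip borel_measurable_diff measurable_gs_proj) auto
      show "{h \<in> space (gauss_vec n). ip n (\<lambda>i. gs_proj n A j h i - s * v i) (\<lambda>i. gs_proj n A j h i - s * v i) \<le> 4 * e} \<in> sets (gauss_vec n)"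
        by measurable
    qed
    also have "\<dots> \<le> f A"
      unfolding f_def using K01[OF K0 v(1)] by (intro nn_integral_mono) (auto simp: indicator_def)
    finally show False using A by (auto simp: S_def)
  qed
  ultimately show ?thesis using S by (intro bexI[of _ S]) auto
qed

section \<open>The threshold\<close>

lemma powr_le_one_plus_sq:
  fixes x :: real
  assumes "0 \<le> x" "0 < p" "p \<le> 2"
  shows "x powr p \<le> 1 + x\<^sup>2"
proof (cases "x \<le> 1")
  case True
  then have "x powr p \<le> 1" using assms by (simp add: powr_le1)
  then show ?thesis using zero_le_power2[of x] by linarith
next
  case False
  then have "x powr p \<le> x powr 2" using assms by (intro powr_mono) auto
  then show ?thesis using False by (simp add: powr_numeral)
qed

lemma fhn_eq: "fhn x = 2 * std_normal_density x"
proof -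
  have "sqrt (2 / pi) = 2 / sqrt (2 * pi)"
    by (simp add: real_sqrt_divide real_sqrt_mult field_simps)
  then show ?thesis by (simp add: fhn_def std_normal_density_def)
qed

lemma fhn_pos: "0 < fhn x"
  by (simp add: fhn_def)

text \<open>\<open>fhn\<close> is twice the normal density, hence on the half-line the density of
  the absolute value of a standard Gaussian.\<close>

lemma integral_std_gauss_abs:
  fixes F :: "real \<Rightarrow> real"
  assumes F[measurable]: "F \<in> borel_measurable borel" and int: "integrable std_gauss (\<lambda>x. F \<bar>x\<bar>)"
  shows "set_integrable lborel {0..} (\<lambda>x. F x * fhn x)"
    and "(\<integral>x. F \<bar>x\<bar> \<partial>std_gauss) = (LBINT x:{0..}. F x * fhn x)"
proof -
  define f where "f x = std_normal_density x * F \<bar>x\<bar>" for x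
  have f: "integrable lborel f"
    using int by (simp add: f_def[abs_def] integrable_std_gauss_iff)
  have fi: "integrable lborel (\<lambda>x. indicator {0..} x *\<^sub>R f x)"
    using f by (intro integrable_mult_indicator) auto
  define I where "I = (\<integral>x. indicator {0..} x *\<^sub>R f x \<partial>lborel)"
  have "has_bochner_integral lborel f (2 *\<^sub>R I)"
    using fi by (intro has_bochner_integral_even_function)
      (auto simp: I_def has_bochner_integral_iff f_def std_normal_density_def)
  then have "(\<integral>x. f x \<partial>lborel) = 2 * I" by (simp add: has_bochner_integral_integral_eq)
  have e: "indicator {0..} x *\<^sub>R (F x * fhn x) = 2 * (indicator {0..} x *\<^sub>R f x)" for x
    by (auto simp: f_def fhn_eq indicator_def)
  show "set_integrable lborel {0..} (\<lambda>x. F x * fhn x)"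
    unfolding set_integrable_def e using fi by (intro integrable_mult_right)
  have "(LBINT x:{0..}. F x * fhn x) = 2 * I"
    unfolding set_lebesgue_integral_def e I_def by simp
  then show "(\<integral>x. F \<bar>x\<bar> \<partial>std_gauss) = (LBINT x:{0..}. F x * fhn x)"
    using \<open>(\<integral>x. f x \<partial>lborel) = 2 * I\<close> by (simp add: integral_std_gauss f_def[abs_def])
qed

lemma finite_measure_std_gauss: "finite_measure std_gauss"
  by (rule prob_space.finite_measure[OF prob_space_std_gauss])

lemma integrable_std_gauss_sq: "integrable std_gauss (\<lambda>x. x\<^sup>2)"
  using std_gauss_moments(3) by (simp add: power2_eq_square)

lemma integrable_std_gauss_bounded:
  fixes g :: "real \<Rightarrow> real"
  assumes [measurable]: "g \<in> borel_measurable borel" and "\<And>x. \<bar>g x\<bar> \<le> C + D * x\<^sup>2"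
  shows "integrable std_gauss g"
proof -
  interpret finite_measure std_gauss by (rule finite_measure_std_gauss)
  have "integrable std_gauss (\<lambda>x. C + D * x\<^sup>2)" using integrable_std_gauss_sq by simp
  then show ?thesis
  proof (rule Bochner_Integration.integrable_bound)
    show "AE x in std_gauss. norm (g x) \<le> norm (C + D * x\<^sup>2)"
      using assms(2) by (auto intro!: AE_I2 order_trans[OF _ abs_ge_self])
    show "g \<in> borel_measurable std_gauss" using assms(1) by (simp cong: measurable_cong_sets)
  qed
qed

text \<open>The definite description in \<open>z_star\<close> is legitimate: the mass up to
  \<open>z\<close> is continuous and strictly increasing, and it runs from 0 to the total mass
  \<open>T\<close>. So it equals \<open>T / 2\<close> at exactly one point, which is the balance
  condition.\<close>

lemma z_star_props:
  assumes p: "0 < p" "p \<le> 1"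
  shows "0 < z_star p"
    and "(LBINT x:{0..z_star p}. x powr p * fhn x) = (LBINT x:{z_star p<..}. x powr p * fhn x)"
proof -
  define g where "g x = x powr p * fhn x" for x
  have gm[measurable]: "g \<in> borel_measurable borel" unfolding g_def fhn_def by measurable
  have "set_integrable lborel {0..} g"
    unfolding g_def
  proof (rule integral_std_gauss_abs)
    show "integrable std_gauss (\<lambda>x. \<bar>x\<bar> powr p)"
      using powr_le_one_plus_sq[of "\<bar>_\<bar>" p] p by (intro integrable_std_gauss_bounded[where C=1 and D=1]) auto
  qed measurable
  then have gi: "set_integrable lborel S g" if "S \<in> sets borel" "S \<subseteq> {0..}" for S
    by (rule set_integrable_subset) (use that in auto)
  define H where "H z = (LBINT x:{0..z}. g x)" for z
  define R where "R z = (LBINT x:{z<..}. g x)" for z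
  define T where "T = (LBINT x:{0..}. g x)"
  have HR: "H z + R z = T" if "0 \<le> z" for z
  proof -
    have "{0..} = {0..z} \<union> {z<..}" using that by auto
    then show ?thesis unfolding T_def H_def R_def
      using that by (subst set_integral_Un[symmetric]) (auto intro: gi)
  qed
  have cont: "continuous_on {0..b} g" for b
    unfolding g_def fhn_def using p by (intro continuous_intros continuous_on_powr') auto
  have Hint: "H z = integral {0..z} g" for z
    unfolding H_def by (rule set_borel_integral_eq_integral(2)) (auto intro: gi)
  have Hcont: "continuous_on {0..b} H" for b
    unfolding Hint[abs_def] by (intro indefinite_integral_continuous_1 integrable_continuous_real cont)
  have Hmono: "H a < H b" if ab: "0 \<le> a" "a < b" for a b
  proof (rule DERIV_pos_imp_increasing_open[OF ab(2)])
    show "continuous_on {a..b} H" by (rule continuous_on_subset[OF Hcont[of b]]) (use ab in auto)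
    fix x assume x: "a < x" "x < b"
    have "(H has_real_derivative g x) (at x within {0..b})"
      unfolding Hint[abs_def] using x ab by (intro integral_has_real_derivative cont) auto
    then have "(H has_real_derivative g x) (at x)"
      using x ab by (subst (asm) at_within_Icc_at) auto
    moreover have "0 < g x" using x ab by (simp add: g_def fhn_pos)
    ultimately show "\<exists>y. DERIV H x :> y \<and> 0 < y" by auto
  qed
  have H0: "H 0 = 0" by (simp add: Hint)
  have lim: "(H \<longlongrightarrow> T) at_top"
  proof -
    have "integrable lborel (\<lambda>x. indicator {0..} x *\<^sub>R g x)"
      using gi[of "{0..}"] by (simp add: set_integrable_def)
    from tendsto_integral_at_top[OF _ this]
    have "((\<lambda>y. \<integral>x. indicator {..y} x *\<^sub>R (indicator {0..} x *\<^sub>R g x) \<partial>lborel) \<longlongrightarrow> T) at_top"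
      by (simp add: T_def set_lebesgue_integral_def)
    moreover have "(\<integral>x. indicator {..y} x *\<^sub>R (indicator {0..} x *\<^sub>R g x) \<partial>lborel) = H y" for y
      unfolding H_def set_lebesgue_integral_def by (intro Bochner_Integration.integral_cong) (auto simp: indicator_def)
    ultimately show ?thesis by simp
  qed
  have T: "0 < T"
  proof -
    have "0 < H 1" using Hmono[of 0 1] H0 by simp
    moreover have "0 \<le> R 1" unfolding R_def set_lebesgue_integral_def
      by (intro integral_nonneg_AE) (auto simp: g_def fhn_pos less_imp_le)
    ultimately show ?thesis using HR[of 1] by simp
  qed
  have "eventually (\<lambda>z. T / 2 < H z) at_top"
    using T by (intro order_tendstoD(1)[OF lim]) auto
  then obtain b where b: "0 < b" "T / 2 < H b"
    using eventually_conj[OF eventually_gt_at_top[of 0]] by (metis (mono_tags, lifting) eventually_at_top_linorder order_refl)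
  then obtain z where z: "0 \<le> z" "z \<le> b" "H z = T / 2"
    using IVT'[of H 0 "T/2" b] Hcont[of b] H0 T by auto
  have z0: "0 < z" using z H0 T by (cases "z = 0") auto
  define Q where "Q z \<longleftrightarrow> z > 0 \<and> (LBINT x=0..z. x powr p * fhn x) = (LBINT x=ereal z..\<infinity>. x powr p * fhn x)" for z :: real
  have Q: "Q z \<longleftrightarrow> 0 < z \<and> H z = R z" for z
    unfolding Q_def using interval_integral_Icc[of 0 z g]
    by (auto simp: interval_integral_to_infinity_eq H_def R_def g_def zero_ereal_def)
  have "Q z" using z0 z HR[of z] by (simp add: Q)
  moreover have "z' = z" if "Q z'" for z'
  proof -
    have "0 < z'" "H z' = T / 2" using that HR[of z'] by (auto simp: Q)
    then show ?thesis using z z0 Hmono[of z z'] Hmono[of z' z] by (cases z z' rule: linorder_cases) auto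
  qed
  ultimately have "Q (z_star p)" unfolding z_star_def Q_def[symmetric] by (rule theI)
  then show "0 < z_star p"
    and "(LBINT x:{0..z_star p}. x powr p * fhn x) = (LBINT x:{z_star p<..}. x powr p * fhn x)"
    by (auto simp: Q H_def R_def g_def)
qed

lemma fhn_integrable: "set_integrable lborel {0..} fhn" and fhn_integral: "(LBINT x:{0..}. fhn x) = 1"
  using integral_std_gauss_abs[of "\<lambda>_. 1"] finite_measure_std_gauss prob_space.prob_space[OF prob_space_std_gauss]
  by (auto simp: finite_measure.integrable_const)

text \<open>The threshold is the probability that a standard Gaussian exceeds
  \<open>z_star p\<close> in absolute value, by the substitution y = x / sqrt 2 in the error
  function.\<close>

lemma rho_star_eq:
  assumes "0 < z_star p"
  shows "rho_star p = (LBINT x:{z_star p<..}. fhn x)"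
proof -
  define z where "z = z_star p"
  have z: "0 < z" using assms by (simp add: z_def)
  have "(LBINT x=0..z. (1 / sqrt 2) *\<^sub>R exp (- (x / sqrt 2)\<^sup>2)) = (LBINT y=ereal (0 / sqrt 2)..ereal (z / sqrt 2). exp (- y\<^sup>2))"
    unfolding zero_ereal_def using z
    by (intro interval_integral_substitution_finite) (auto intro!: derivative_eq_intros continuous_intros simp: field_simps)
  then have "erf (z / sqrt 2) = 2 / sqrt pi * (LBINT x=0..z. (1 / sqrt 2) *\<^sub>R exp (- (x / sqrt 2)\<^sup>2))"
    by (simp add: erf_def zero_ereal_def)
  also have "\<dots> = (LBINT x=0..z. 2 / sqrt pi * ((1 / sqrt 2) *\<^sub>R exp (- (x / sqrt 2)\<^sup>2)))"
    by (rule interval_lebesgue_integral_mult_right[symmetric]) 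
  also have "(\<lambda>x. 2 / sqrt pi * ((1 / sqrt 2) *\<^sub>R exp (- (x / sqrt 2)\<^sup>2))) = fhn"
  proof -
    have "sqrt (2 / pi) = 2 / sqrt pi * (1 / sqrt 2)"
      by (simp add: real_sqrt_divide field_simps)
    then show ?thesis by (simp add: fhn_def fun_eq_iff power_divide)
  qed
  also have "(LBINT x=0..z. fhn x) = (LBINT x:{0..z}. fhn x)"
    using interval_integral_Icc[of 0 z fhn] z by (simp add: zero_ereal_def)
  finally have "erf (z / sqrt 2) = (LBINT x:{0..z}. fhn x)" .
  moreover have "(LBINT x:{0..z}. fhn x) + (LBINT x:{z<..}. fhn x) = 1"
  proof -
    have "{0..} = {0..z} \<union> {z<..}" using z by auto
    then have "(LBINT x:{0..}. fhn x) = (LBINT x:{0..z}. fhn x) + (LBINT x:{z<..}. fhn x)"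
      using z by (auto intro!: set_integral_Un set_integrable_subset[OF fhn_integrable])
    then show ?thesis by (simp add: fhn_integral)
  qed
  ultimately show ?thesis by (simp add: rho_star_def z_def)
qed

text \<open>Write u = |x|^p. The integrand is -u for u \<le> \<tau> and u - 2 \<tau> beyond. The
  choice of \<tau> puts the kink at \<open>z_star p\<close>, where the two integrals of u cancel by
  the definition of \<open>z_star\<close>; what is left is -2 \<tau> times the tail
  probability.\<close>

lemma std_gauss_balance:
  assumes p: "0 < p" "p \<le> 1"
  defines "\<tau> \<equiv> z_star p powr p"
  shows "integrable std_gauss (\<lambda>x. \<bar>\<bar>x\<bar> powr p - \<tau>\<bar> - \<tau>)"
    and "(\<integral>x. \<bar>\<bar>x\<bar> powr p - \<tau>\<bar> - \<tau> \<partial>std_gauss) = - 2 * \<tau> * rho_star p"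
proof -
  note zs = z_star_props[OF p]
  have tau: "0 < \<tau>" using zs by (simp add: \<tau>_def)
  show int: "integrable std_gauss (\<lambda>x. \<bar>\<bar>x\<bar> powr p - \<tau>\<bar> - \<tau>)"
  proof (rule integrable_std_gauss_bounded[where C=1 and D=1])
    fix x :: real
    have "\<bar>\<bar>\<bar>x\<bar> powr p - \<tau>\<bar> - \<tau>\<bar> \<le> \<bar>x\<bar> powr p" using tau by (auto simp: abs_if)
    then show "\<bar>\<bar>\<bar>x\<bar> powr p - \<tau>\<bar> - \<tau>\<bar> \<le> 1 + 1 * x\<^sup>2" using powr_le_one_plus_sq[of "\<bar>x\<bar>" p] p by simp
  qed measurable
  define z where "z = z_star p"
  have z: "0 < z" using zs by (simp add: z_def)
  have gint: "set_integrable lborel {0..} (\<lambda>x. x powr p * fhn x)"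
  proof (rule integral_std_gauss_abs)
    show "integrable std_gauss (\<lambda>x. \<bar>x\<bar> powr p)"
      using powr_le_one_plus_sq[of "\<bar>_\<bar>" p] p by (intro integrable_std_gauss_bounded[where C=1 and D=1]) auto
  qed measurable
  have i1: "set_integrable lborel {0..z} (\<lambda>x. x powr p * fhn x)"
    by (rule set_integrable_subset[OF gint]) auto
  have i2: "set_integrable lborel {z<..} (\<lambda>x. x powr p * fhn x)"
    by (rule set_integrable_subset[OF gint]) (use z in auto)
  have i3: "set_integrable lborel {z<..} fhn"
    by (rule set_integrable_subset[OF fhn_integrable]) (use z in auto)
  have "(\<integral>x. \<bar>\<bar>x\<bar> powr p - \<tau>\<bar> - \<tau> \<partial>std_gauss) = (LBINT x:{0..}. (\<bar>x powr p - \<tau>\<bar> - \<tau>) * fhn x)"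
    by (rule integral_std_gauss_abs(2)[OF _ int]) measurable
  also have "\<dots> = (\<integral>x. - (indicator {0..z} x *\<^sub>R (x powr p * fhn x)) + indicator {z<..} x *\<^sub>R (x powr p * fhn x)
       - 2 * \<tau> * (indicator {z<..} x *\<^sub>R fhn x) \<partial>lborel)"
    unfolding set_lebesgue_integral_def
  proof (intro Bochner_Integration.integral_cong refl)
    fix x :: real
    consider "x < 0" | "0 \<le> x" "x \<le> z" | "z < x" by linarith
    then show "indicator {0..} x *\<^sub>R ((\<bar>x powr p - \<tau>\<bar> - \<tau>) * fhn x) = - (indicator {0..z} x *\<^sub>R (x powr p * fhn x)) + indicator {z<..} x *\<^sub>R (x powr p * fhn x)
       - 2 * \<tau> * (indicator {z<..} x *\<^sub>R fhn x)"
    proof cases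
      case 2
      then have "x powr p \<le> \<tau>" unfolding \<tau>_def z_def[symmetric] using p by (intro powr_mono2) auto
      then show ?thesis using 2 by (simp add: algebra_simps)
    next
      case 3
      then have "\<tau> \<le> x powr p" unfolding \<tau>_def z_def[symmetric] using p z by (intro powr_mono2) auto
      then show ?thesis using 3 z by (simp add: algebra_simps)
    qed (use z in auto)
  qed
  also have "\<dots> = - (LBINT x:{0..z}. x powr p * fhn x) + (LBINT x:{z<..}. x powr p * fhn x) - 2 * \<tau> * (LBINT x:{z<..}. fhn x)"
    unfolding set_lebesgue_integral_def using i1 i2 i3 unfolding set_integrable_def by simp
  also have "\<dots> = - 2 * \<tau> * rho_star p"
    using zs rho_star_eq[OF zs(1)] by (simp add: z_def)
  finally show "(\<integral>x. \<bar>\<bar>x\<bar> powr p - \<tau>\<bar> - \<tau> \<partial>std_gauss) = - 2 * \<tau> * rho_star p" .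
qed

section \<open>Concentration of the power sums\<close>

text \<open>A substitute for differentiating the moment generating function at 0: for
  \<open>y = l * Y x\<close> with 0 \<le> l \<le> 1 the remainder is at most l^2 times a function
  that does not depend on \<open>l\<close>.\<close>

lemma exp_le_quadratic_remainder: "exp y \<le> 1 + y + y\<^sup>2 * exp \<bar>y\<bar>" for y :: real
proof (cases "0 \<le> y")
  case True
  show ?thesis
  proof (cases "1 \<le> y")
    case True
    then have "1 \<le> y\<^sup>2" by (rule one_le_power)
    then have "1 * exp y \<le> y\<^sup>2 * exp y" by (rule mult_right_mono) simp
    then show ?thesis using True by linarith
  next
    case False
    \<comment> \<open>Multiplying exp y (1 - y) \<le> 1 by 1 + y gives exp y (1 - y^2) \<le> 1 + y,
      which is the claim.\<close>
    have "exp y * (1 - y) \<le> exp y * exp (- y)"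
      using exp_ge_add_one_self[of "-y"] by (intro mult_left_mono) auto
    then have "exp y * (1 - y) * (1 + y) \<le> 1 * (1 + y)"
      using True by (intro mult_right_mono) (auto simp flip: exp_add)
    then show ?thesis using True by (simp add: algebra_simps power2_eq_square)
  qed
next
  case False
  then have y: "y < 0" by simp
  have "1 \<le> (1 + y + y\<^sup>2) * (1 - y)"
  proof -
    have "(1 + y + y\<^sup>2) * (1 - y) = 1 - y * y\<^sup>2" by (simp add: power2_eq_square algebra_simps)
    moreover have "y * y\<^sup>2 \<le> 0" using y by (intro mult_nonpos_nonneg) auto
    ultimately show ?thesis by simp
  qed
  moreover have pos: "0 \<le> 1 + y + y\<^sup>2"
  proof -
    have "1 + y + y\<^sup>2 = (y + 1/2)\<^sup>2 + 3/4" by (simp add: power2_eq_square algebra_simps)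
    then show ?thesis using zero_le_power2[of "y + 1/2"] by linarith
  qed
  moreover have "1 - y \<le> exp (- y)" using exp_ge_add_one_self[of "-y"] by simp
  ultimately have "1 \<le> (1 + y + y\<^sup>2) * exp (- y)"
    using mult_left_mono[of "1 - y" "exp (- y)" "1 + y + y\<^sup>2"] by linarith
  then have "1 * exp y \<le> ((1 + y + y\<^sup>2) * exp (- y)) * exp y" by (intro mult_right_mono) auto
  then have "exp y \<le> 1 + y + y\<^sup>2" by (simp add: mult.assoc flip: exp_add)
  moreover have "y\<^sup>2 * 1 \<le> y\<^sup>2 * exp \<bar>y\<bar>" by (intro mult_left_mono) auto
  ultimately show ?thesis by simp
qed

lemma integrable_std_gauss_exp_sq: "integrable std_gauss (\<lambda>x. exp (x\<^sup>2 / 4))"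
proof -
  have "std_normal_density x * exp (x\<^sup>2 / 4) = sqrt 2 * normal_density 0 (sqrt 2) x" for x
  proof -
    have "exp (- x\<^sup>2 / 2) * exp (x\<^sup>2 / 4) = exp (- x\<^sup>2 / 4)" by (simp flip: exp_add)
    then have "std_normal_density x * exp (x\<^sup>2 / 4) = exp (- x\<^sup>2 / 4) / sqrt (2 * pi)"
      by (simp add: std_normal_density_def)
    also have "\<dots> = sqrt 2 * normal_density 0 (sqrt 2) x"
      by (simp add: normal_density_def real_sqrt_mult field_simps)
    finally show ?thesis .
  qed
  then show ?thesis by (simp add: integrable_std_gauss_iff)
qed

text \<open>The constant 1/8 in the growth bound makes exp (2 |Y|) integrable, and the factor 2
  there covers the weight Y^2 exp |Y| of the second-order term. A negative mean then yields a moment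
  generating function below 1 at some \<open>l > 0\<close>, whose \<open>n\<close>-th power is the
  bound.\<close>

lemma gauss_vec_chernoff:
  assumes [measurable]: "Y \<in> borel_measurable borel" and bound: "\<And>x. \<bar>Y x\<bar> \<le> C + x\<^sup>2 / 8"
    and neg: "(\<integral>x. Y x \<partial>std_gauss) < 0"
  shows "\<exists>a>0. \<forall>n. measure (gauss_vec n) {h \<in> space (gauss_vec n). 0 \<le> (\<Sum>i<n. Y (h i))} \<le> exp (- a * real n)"
proof -
  have dom: "integrable std_gauss f" if [measurable]: "f \<in> borel_measurable borel"
    and "\<And>x. \<bar>f x\<bar> \<le> D * exp (x\<^sup>2 / 4)" for f D
  proof (rule Bochner_Integration.integrable_bound)
    show "integrable std_gauss (\<lambda>x. D * exp (x\<^sup>2 / 4))" using integrable_std_gauss_exp_sq by simp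
    show "f \<in> borel_measurable std_gauss" using that(1) by (simp cong: measurable_cong_sets)
    show "AE x in std_gauss. norm (f x) \<le> norm (D * exp (x\<^sup>2 / 4))"
      using that(2) by (intro AE_I2) (metis abs_ge_self order_trans real_norm_def)
  qed
  have eY: "exp (2 * \<bar>Y x\<bar>) \<le> exp (2 * C) * exp (x\<^sup>2 / 4)" for x
    using bound[of x] by (simp flip: exp_add)
  have sq: "y\<^sup>2 \<le> 2 * exp \<bar>y\<bar>" for y :: real
    using exp_lower_Taylor_quadratic[of "\<bar>y\<bar>"] by simp
  define K where "K = (\<integral>x. (Y x)\<^sup>2 * exp \<bar>Y x\<bar> \<partial>std_gauss)"
  have iK: "integrable std_gauss (\<lambda>x. (Y x)\<^sup>2 * exp \<bar>Y x\<bar>)"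
  proof (rule dom)
    fix x
    have "(Y x)\<^sup>2 * exp \<bar>Y x\<bar> \<le> 2 * exp \<bar>Y x\<bar> * exp \<bar>Y x\<bar>" using sq by (intro mult_right_mono) auto
    also have "\<dots> = 2 * exp (2 * \<bar>Y x\<bar>)" by (simp flip: exp_add)
    also have "\<dots> \<le> 2 * (exp (2 * C) * exp (x\<^sup>2 / 4))" using eY[of x] by simp
    finally show "\<bar>(Y x)\<^sup>2 * exp \<bar>Y x\<bar>\<bar> \<le> (2 * exp (2 * C)) * exp (x\<^sup>2 / 4)" by simp
  qed measurable
  have ie: "integrable std_gauss (\<lambda>x. exp (l * Y x))" if "0 \<le> l" "l \<le> 1" for l
  proof (rule dom)
    fix x
    have "l * \<bar>Y x\<bar> \<le> \<bar>Y x\<bar>" using that by (intro mult_left_le_one_le) auto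
    moreover have "l * Y x \<le> l * \<bar>Y x\<bar>" using that by (intro mult_left_mono) auto
    ultimately have "l * Y x \<le> 2 * \<bar>Y x\<bar>" using abs_ge_zero[of "Y x"] by linarith
    then have "exp (l * Y x) \<le> exp (2 * \<bar>Y x\<bar>)" by (simp only: exp_le_cancel_iff)
    from order_trans[OF this eY] show "\<bar>exp (l * Y x)\<bar> \<le> exp (2 * C) * exp (x\<^sup>2 / 4)" by (simp only: abs_exp_cancel)
  qed measurable
  have iY: "integrable std_gauss Y"
  proof (rule dom)
    fix x
    have "\<bar>Y x\<bar> \<le> exp (2 * \<bar>Y x\<bar>)" using exp_ge_add_one_self[of "2 * \<bar>Y x\<bar>"] abs_ge_zero[of "Y x"] by linarith
    then show "\<bar>Y x\<bar> \<le> exp (2 * C) * exp (x\<^sup>2 / 4)" using eY[of x] by simp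
  qed measurable
  define \<mu> where "\<mu> = (\<integral>x. Y x \<partial>std_gauss)"
  have \<mu>: "\<mu> < 0" using neg by (simp add: \<mu>_def)
  have K0: "0 \<le> K" unfolding K_def by (intro integral_nonneg_AE) auto
  \<comment> \<open>Small enough that the quadratic term l^2 K uses up at most half of the drift;
    \<open>K + 1\<close> keeps the denominator positive when \<open>K = 0\<close>, and
    \<open>l \<le> 1\<close> gives integrability.\<close>
  define l where "l = min 1 (- \<mu> / (2 * (K + 1)))"
  have l: "0 < l" "l \<le> 1" using \<mu> K0 divide_pos_pos[of "- \<mu>" "2 * (K + 1)"] by (auto simp: l_def)
  have lK: "l * K \<le> - \<mu> / 2"
  proof -
    have "l * K \<le> - \<mu> / (2 * (K + 1)) * (K + 1)" using K0 l \<mu> by (intro mult_mono) (auto simp: l_def)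
    also have "\<dots> = - \<mu> / 2" using K0 by (simp add: field_simps)
    finally show ?thesis .
  qed
  interpret finite_measure std_gauss by (rule prob_space.finite_measure[OF prob_space_std_gauss])
  have m1: "measure std_gauss UNIV = 1" using prob_space.prob_space[OF prob_space_std_gauss] by simp
  have "(\<integral>x. exp (l * Y x) \<partial>std_gauss) \<le> (\<integral>x. 1 + l * Y x + l\<^sup>2 * ((Y x)\<^sup>2 * exp \<bar>Y x\<bar>) \<partial>std_gauss)"
  proof (rule integral_mono)
    fix x
    have "\<bar>l * Y x\<bar> \<le> \<bar>Y x\<bar>" using l mult_left_le_one_le[of "\<bar>Y x\<bar>" l] by (simp add: abs_mult)
    then have "(l * Y x)\<^sup>2 * exp \<bar>l * Y x\<bar> \<le> (l * Y x)\<^sup>2 * exp \<bar>Y x\<bar>" by (intro mult_left_mono) auto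
    then show "exp (l * Y x) \<le> 1 + l * Y x + l\<^sup>2 * ((Y x)\<^sup>2 * exp \<bar>Y x\<bar>)"
      using exp_le_quadratic_remainder[of "l * Y x"] by (simp add: power_mult_distrib)
  qed (use ie l iY iK in auto)
  also have "\<dots> = 1 + l * \<mu> + l\<^sup>2 * K"
    using iY iK by (simp add: \<mu>_def K_def m1)
  also have "\<dots> = 1 + l * \<mu> + l * (l * K)" by (simp add: power2_eq_square)
  also have "\<dots> \<le> 1 + l * \<mu> + l * (- \<mu> / 2)" by (intro add_left_mono mult_left_mono lK) (use l in auto)
  also have "\<dots> = 1 + l * \<mu> / 2" by simp
  also have "\<dots> \<le> exp (l * \<mu> / 2)" by (rule exp_ge_add_one_self)
  finally have mgf: "(\<integral>x. exp (l * Y x) \<partial>std_gauss) \<le> exp (l * \<mu> / 2)" .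
  have nnmgf: "(\<integral>\<^sup>+x. ennreal (exp (l * Y x)) \<partial>std_gauss) \<le> ennreal (exp (l * \<mu> / 2))"
    using ie[of l] l mgf by (subst nn_integral_eq_integral) auto
  define a where "a = - (l * \<mu> / 2)"
  have a: "0 < a" using l \<mu> by (simp add: a_def mult_pos_neg)
  have "measure (gauss_vec n) {h \<in> space (gauss_vec n). 0 \<le> (\<Sum>i<n. Y (h i))} \<le> exp (- a * real n)" for n
  proof -
    interpret G: prob_space "gauss_vec n" by (rule prob_space_gauss_vec)
    have Ym: "(\<lambda>h. \<Sum>i<n. Y (h i)) \<in> borel_measurable (gauss_vec n)"
      by (intro borel_measurable_sum measurable_compose[OF measurable_gauss_vec_component assms(1)]) auto
    have "emeasure (gauss_vec n) {h \<in> space (gauss_vec n). 0 \<le> (\<Sum>i<n. Y (h i))}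
      = (\<integral>\<^sup>+h. indicator {h \<in> space (gauss_vec n). 0 \<le> (\<Sum>i<n. Y (h i))} h \<partial>gauss_vec n)"
      using Ym by (intro nn_integral_indicator[symmetric]) measurable
    also have "\<dots> \<le> (\<integral>\<^sup>+h. (\<Prod>i\<in>{..<n}. ennreal (exp (l * Y (h i)))) \<partial>gauss_vec n)"
    proof (rule nn_integral_mono)
      fix h
      have "(\<Prod>i\<in>{..<n}. ennreal (exp (l * Y (h i)))) = ennreal (exp (l * (\<Sum>i<n. Y (h i))))"
        by (subst prod_ennreal) (auto simp: exp_sum sum_distrib_left)
      then show "indicator {h \<in> space (gauss_vec n). 0 \<le> (\<Sum>i<n. Y (h i))} h \<le> (\<Prod>i\<in>{..<n}. ennreal (exp (l * Y (h i))))"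
        using l by (auto simp: indicator_def)
    qed
    also have "\<dots> = (\<Prod>i\<in>{..<n}. \<integral>\<^sup>+x. ennreal (exp (l * Y x)) \<partial>std_gauss)"
      unfolding gauss_vec_def by (rule SG.product_nn_integral_prod) (auto cong: measurable_cong_sets)
    also have "\<dots> \<le> (\<Prod>i\<in>{..<n}. ennreal (exp (l * \<mu> / 2)))"
      by (intro prod_mono_ennreal nnmgf)
    also have "\<dots> = ennreal (exp (- a * real n))"
      by (simp add: a_def ennreal_power flip: exp_of_nat_mult)
    finally show ?thesis by (simp add: G.emeasure_eq_measure)
  qed
  then show ?thesis using a by blast
qed

section \<open>Cones of concentrated vectors: homogeneity, perturbation and an additive test\<close>

lemma abs_add_powr_le:
  fixes a b p :: real
  assumes "0 < p" "p \<le> 1"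
  shows "\<bar>a + b\<bar> powr p \<le> \<bar>a\<bar> powr p + \<bar>b\<bar> powr p"
proof (cases "\<bar>a\<bar> + \<bar>b\<bar> = 0")
  case False
  define s where "s = \<bar>a\<bar> + \<bar>b\<bar>"
  have s: "0 < s" using False by (simp add: s_def)
  \<comment> \<open>On [0, 1] one has t \<le> t^p. Applied to the fractions of \<open>s\<close> due
    to \<open>a\<close> and \<open>b\<close>, which add up to 1, this gives subadditivity.\<close>
  have *: "x / s \<le> x powr p / s powr p" if "0 \<le> x" "x \<le> s" for x
  proof -
    have "(x / s) powr 1 \<le> (x / s) powr p" using that s assms by (intro powr_mono') auto
    then show ?thesis using that s by (simp add: powr_divide)
  qed
  have "1 = \<bar>a\<bar> / s + \<bar>b\<bar> / s" using s by (simp add: s_def flip: add_divide_distrib)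
  also have "\<dots> \<le> \<bar>a\<bar> powr p / s powr p + \<bar>b\<bar> powr p / s powr p"
    by (intro add_mono *) (auto simp: s_def)
  finally have "s powr p \<le> \<bar>a\<bar> powr p + \<bar>b\<bar> powr p"
    using s by (simp add: field_simps)
  moreover have "\<bar>a + b\<bar> powr p \<le> s powr p" using assms by (intro powr_mono2) (auto simp: s_def)
  ultimately show ?thesis by simp
next
  case True
  then have "a = 0" "b = 0" by linarith+
  then show ?thesis by simp
qed

text \<open>For \<open>\<eta> = 0\<close> this is the cone of nonzero vectors that violate the null space property; the slack term is scaled
  so that the condition is homogeneous of degree \<open>p\<close>.\<close>

definition near_concentrated :: "nat \<Rightarrow> real \<Rightarrow> real \<Rightarrow> real \<Rightarrow> (nat \<Rightarrow> real) \<Rightarrow> bool" where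
  "near_concentrated n p \<rho> \<eta> x \<longleftrightarrow> 0 < ip n x x \<and> (\<exists>T\<in>Pow {..<n}. real (card T) \<le> \<rho> * real n \<and>
     (\<Sum>i\<in>{..<n} - T. \<bar>x i\<bar> powr p) \<le> (\<Sum>i\<in>T. \<bar>x i\<bar> powr p) + \<eta> * real n * (ip n x x / real n) powr (p / 2))"

lemma measurable_near_concentrated:
  assumes X: "\<And>i. i < n \<Longrightarrow> (\<lambda>\<omega>. X \<omega> i) \<in> borel_measurable M"
  shows "Measurable.pred M (\<lambda>\<omega>. near_concentrated n p \<rho> \<eta> (X \<omega>))"
proof -
  define q where "q \<omega> = ip n (X \<omega>) (X \<omega>)" for \<omega>
  define S where "S T \<omega> = (\<Sum>i\<in>T. \<bar>X \<omega> i\<bar> powr p)" for T \<omega>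
  have q[measurable]: "q \<in> borel_measurable M"
    unfolding q_def[abs_def] by (intro measurable_ip X)
  have S: "S T \<in> borel_measurable M" if "T \<subseteq> {..<n}" for T
    unfolding S_def[abs_def]
  proof (rule borel_measurable_sum)
    fix i assume "i \<in> T"
    then have "i < n" using that by auto
    moreover have "(\<lambda>x::real. \<bar>x\<bar> powr p) \<in> borel_measurable borel" by measurable
    ultimately show "(\<lambda>\<omega>. \<bar>X \<omega> i\<bar> powr p) \<in> borel_measurable M"
      using measurable_compose[OF X] by fast
  qed
  define E where "E \<omega> \<longleftrightarrow> (\<exists>T\<in>Pow {..<n}. real (card T) \<le> \<rho> * real n \<and>
     S ({..<n} - T) \<omega> \<le> S T \<omega> + \<eta> * real n * (q \<omega> / real n) powr (p / 2))" for \<omega>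
  have [measurable]: "Measurable.pred M E"
    unfolding E_def[abs_def]
  proof (rule pred_intros_finite(4))
    fix T assume "T \<in> Pow {..<n}"
    then have [measurable]: "S T \<in> borel_measurable M" "S ({..<n} - T) \<in> borel_measurable M"
      by (auto intro!: S)
    show "Measurable.pred M (\<lambda>\<omega>. real (card T) \<le> \<rho> * real n \<and>
     S ({..<n} - T) \<omega> \<le> S T \<omega> + \<eta> * real n * (q \<omega> / real n) powr (p / 2))"
      by measurable
  qed simp
  have "Measurable.pred M (\<lambda>\<omega>. 0 < q \<omega> \<and> E \<omega>)"
    by measurable
  then show ?thesis
    unfolding near_concentrated_def q_def S_def E_def .
qed

lemma near_concentrated_mono:
  assumes "near_concentrated n p \<rho> \<eta> x" "\<eta> \<le> \<eta>'"
  shows "near_concentrated n p \<rho> \<eta>' x"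
proof -
  have "\<eta> * real n * (ip n x x / real n) powr (p / 2) \<le> \<eta>' * real n * (ip n x x / real n) powr (p / 2)"
    using assms(2) by (intro mult_right_mono) auto
  then show ?thesis using assms(1) unfolding near_concentrated_def by (meson add_left_mono order_trans)
qed

lemma near_concentrated_scale:
  assumes t: "0 < t" and nc: "near_concentrated n p \<rho> \<eta> x"
  shows "near_concentrated n p \<rho> \<eta> (\<lambda>i. t * x i)"
proof -
  from nc obtain T where T: "T \<subseteq> {..<n}" "real (card T) \<le> \<rho> * real n" and pos: "0 < ip n x x" and
     le: "(\<Sum>i\<in>{..<n} - T. \<bar>x i\<bar> powr p) \<le> (\<Sum>i\<in>T. \<bar>x i\<bar> powr p) + \<eta> * real n * (ip n x x / real n) powr (p / 2)"
    by (auto simp: near_concentrated_def)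
  have s: "(\<Sum>i\<in>U. \<bar>t * x i\<bar> powr p) = t powr p * (\<Sum>i\<in>U. \<bar>x i\<bar> powr p)" for U
    using t by (simp add: abs_mult powr_mult sum_distrib_left)
  have i: "ip n (\<lambda>i. t * x i) (\<lambda>i. t * x i) = t\<^sup>2 * ip n x x"
    by (simp add: ip_scale_left ip_scale_right power2_eq_square)
  have "(t\<^sup>2 * ip n x x / real n) powr (p / 2) = (t\<^sup>2) powr (p / 2) * (ip n x x / real n) powr (p / 2)"
    by (simp add: powr_mult flip: times_divide_eq_right)
  also have "(t\<^sup>2) powr (p / 2) = t powr p"
    using t by (simp add: powr_powr flip: powr_numeral)
  finally have q: "(t\<^sup>2 * ip n x x / real n) powr (p / 2) = t powr p * (ip n x x / real n) powr (p / 2)" .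
  have "t powr p * (\<Sum>i\<in>{..<n} - T. \<bar>x i\<bar> powr p) \<le> t powr p * ((\<Sum>i\<in>T. \<bar>x i\<bar> powr p) + \<eta> * real n * (ip n x x / real n) powr (p / 2))"
    using le by (intro mult_left_mono) auto
  then show ?thesis
    unfolding near_concentrated_def i s q using T pos t by (intro conjI bexI[of _ T]) (auto simp: algebra_simps)
qed

text \<open>The perturbation \<open>w\<close> is small in the Euclidean norm but enters through its
  p-mass. Comparing each coordinate with the root mean square size \<open>a\<close> allowed for it
  bounds the p-mass by \<open>2 * n * a powr p\<close>. The parts on \<open>T\<close> and on its
  complement add up to this total once; the outer factor 2 pays for replacing the norm of
  \<open>x\<close> in the slack by that of \<open>y\<close>.\<close>

lemma near_concentrated_perturb:
  assumes p: "0 < p" "p \<le> 1" and \<eta>: "0 \<le> \<eta>" and \<epsilon>: "0 < \<epsilon>" "\<epsilon> \<le> 1/2"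
    and nc: "near_concentrated n p \<rho> \<eta> x"
    and close: "ip n (\<lambda>i. y i - x i) (\<lambda>i. y i - x i) \<le> \<epsilon>\<^sup>2 * ip n x x"
  shows "near_concentrated n p \<rho> (2 * (\<eta> + 2 * \<epsilon> powr p)) y"
proof -
  from nc obtain T where T: "T \<subseteq> {..<n}" "real (card T) \<le> \<rho> * real n" and pos: "0 < ip n x x" and
     le: "(\<Sum>i\<in>{..<n} - T. \<bar>x i\<bar> powr p) \<le> (\<Sum>i\<in>T. \<bar>x i\<bar> powr p) + \<eta> * real n * (ip n x x / real n) powr (p / 2)"
    by (auto simp: near_concentrated_def)
  have n: "0 < n" using pos by (auto simp: ip_self_pos_iff)
  define q where "q = ip n x x / real n"
  have q: "0 < q" using pos n by (simp add: q_def)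
  define w where "w i = y i - x i" for i
  define a where "a = \<epsilon> * sqrt q"
  have a: "0 < a" using \<epsilon> q by (simp add: a_def)
  have apow: "a powr p = \<epsilon> powr p * q powr (p / 2)"
    using \<epsilon> q by (simp add: a_def powr_mult powr_half_sqrt[symmetric] powr_powr)
  have w: "(\<Sum>i<n. \<bar>w i\<bar> powr p) \<le> 2 * \<epsilon> powr p * real n * q powr (p / 2)"
  proof -
    have "\<bar>w i\<bar> powr p \<le> a powr p * (1 + (w i)\<^sup>2 / a\<^sup>2)" for i
    proof -
      have 1: "\<bar>w i\<bar> powr p = a powr p * (\<bar>w i\<bar> / a) powr p" using a by (simp flip: powr_mult)
      have 2: "(\<bar>w i\<bar> / a) powr p \<le> 1 + (\<bar>w i\<bar> / a)\<^sup>2"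
      proof (cases "\<bar>w i\<bar> / a \<le> 1")
        case True
        then have "(\<bar>w i\<bar> / a) powr p \<le> 1" using p a by (intro powr_le1) auto
        then show ?thesis using zero_le_power2[of "\<bar>w i\<bar> / a"] by linarith
      next
        case False
        then have "(\<bar>w i\<bar> / a) powr p \<le> (\<bar>w i\<bar> / a) powr 2" using p by (intro powr_mono) auto
        then show ?thesis using a by (simp add: powr_numeral del: power_divide) 
      qed
      show ?thesis using mult_left_mono[OF 2, of "a powr p"] unfolding 1 by (simp add: power_divide)
    qed
    then have "(\<Sum>i<n. \<bar>w i\<bar> powr p) \<le> (\<Sum>i<n. a powr p * (1 + (w i)\<^sup>2 / a\<^sup>2))" by (rule sum_mono)
    also have "\<dots> = a powr p * (real n + ip n w w / a\<^sup>2)"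
      by (simp add: sum.distrib ip_def power2_eq_square flip: sum_distrib_left sum_divide_distrib)
    also have "\<dots> \<le> a powr p * (real n + real n)"
    proof -
      have "a\<^sup>2 * real n = \<epsilon>\<^sup>2 * ip n x x" using q n by (simp add: a_def q_def power_mult_distrib)
      then have "ip n w w \<le> real n * a\<^sup>2" using close by (simp add: w_def[abs_def] mult.commute)
      then have "ip n w w / a\<^sup>2 \<le> real n" using a by (simp add: field_simps)
      then show ?thesis by (intro mult_left_mono add_left_mono) auto
    qed
    finally show ?thesis by (simp add: apow mult_ac)
  qed
  \<comment> \<open>|x|^2 \<le> 2 |y|^2 + 2 |w|^2 together with |w|^2 \<le> |x|^2 / 4, which comes
    from \<open>\<epsilon> \<le> 1/2\<close>, solved for |x|^2.\<close>
  have ipxy: "ip n x x \<le> 4 * ip n y y"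
  proof -
    have "ip n x x \<le> (\<Sum>i<n. 2 * (y i * y i) + 2 * (w i * w i))"
      unfolding ip_def
    proof (rule sum_mono)
      fix i
      have "2 * (y i * y i) + 2 * (w i * w i) - x i * x i = (2 * y i - x i)\<^sup>2"
        by (simp add: w_def power2_eq_square algebra_simps)
      then show "x i * x i \<le> 2 * (y i * y i) + 2 * (w i * w i)" using zero_le_power2[of "2 * y i - x i"] by linarith
    qed
    also have "\<dots> = 2 * ip n y y + 2 * ip n w w" by (simp add: ip_def sum.distrib sum_distrib_left)
    also have "ip n w w \<le> 1/4 * ip n x x"
    proof -
      have "\<epsilon>\<^sup>2 \<le> (1/2)\<^sup>2" using \<epsilon> by (intro power_mono) auto
      then have "\<epsilon>\<^sup>2 * ip n x x \<le> 1/4 * ip n x x" using pos by (intro mult_right_mono) (auto simp: power2_eq_square)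
      then show ?thesis using close by (simp add: w_def[abs_def])
    qed
    finally show ?thesis by simp
  qed
  have q': "q powr (p / 2) \<le> 2 * (ip n y y / real n) powr (p / 2)"
  proof -
    have "q powr (p / 2) \<le> (4 * (ip n y y / real n)) powr (p / 2)"
      using ipxy n p q by (intro powr_mono2) (auto simp: q_def divide_right_mono)
    also have "\<dots> = 4 powr (p / 2) * (ip n y y / real n) powr (p / 2)" by (rule powr_mult)
    also have "(4::real) powr (p / 2) \<le> 4 powr (1 / 2)" using p by (intro powr_mono) auto
    also have "(4::real) powr (1 / 2) = 2" by (simp add: powr_half_sqrt)
    finally show ?thesis by (simp add: mult_right_mono)
  qed
  have "(\<Sum>i\<in>{..<n} - T. \<bar>y i\<bar> powr p) \<le> (\<Sum>i\<in>{..<n} - T. \<bar>x i\<bar> powr p + \<bar>w i\<bar> powr p)"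
  proof (rule sum_mono)
    fix i show "\<bar>y i\<bar> powr p \<le> \<bar>x i\<bar> powr p + \<bar>w i\<bar> powr p"
      using abs_add_powr_le[OF p, of "x i" "w i"] by (simp add: w_def)
  qed
  also have "\<dots> = (\<Sum>i\<in>{..<n} - T. \<bar>x i\<bar> powr p) + (\<Sum>i\<in>{..<n} - T. \<bar>w i\<bar> powr p)" by (simp add: sum.distrib)
  also have "\<dots> \<le> (\<Sum>i\<in>T. \<bar>x i\<bar> powr p) + \<eta> * real n * q powr (p / 2) + (\<Sum>i\<in>{..<n} - T. \<bar>w i\<bar> powr p)"
    using le by (simp add: q_def)
  also have "(\<Sum>i\<in>T. \<bar>x i\<bar> powr p) \<le> (\<Sum>i\<in>T. \<bar>y i\<bar> powr p + \<bar>w i\<bar> powr p)"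
  proof (rule sum_mono)
    fix i show "\<bar>x i\<bar> powr p \<le> \<bar>y i\<bar> powr p + \<bar>w i\<bar> powr p"
      using abs_add_powr_le[OF p, of "y i" "- w i"] by (simp add: w_def abs_minus_commute)
  qed
  also have "(\<Sum>i\<in>T. \<bar>y i\<bar> powr p + \<bar>w i\<bar> powr p) = (\<Sum>i\<in>T. \<bar>y i\<bar> powr p) + (\<Sum>i\<in>T. \<bar>w i\<bar> powr p)" by (simp add: sum.distrib)
  finally have "(\<Sum>i\<in>{..<n} - T. \<bar>y i\<bar> powr p) \<le> (\<Sum>i\<in>T. \<bar>y i\<bar> powr p) + \<eta> * real n * q powr (p / 2) +
     ((\<Sum>i\<in>{..<n} - T. \<bar>w i\<bar> powr p) + (\<Sum>i\<in>T. \<bar>w i\<bar> powr p))" by simp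
  also have "(\<Sum>i\<in>{..<n} - T. \<bar>w i\<bar> powr p) + (\<Sum>i\<in>T. \<bar>w i\<bar> powr p) = (\<Sum>i<n. \<bar>w i\<bar> powr p)"
    using T(1) by (intro sum.subset_diff[symmetric]) auto
  also have "(\<Sum>i\<in>T. \<bar>y i\<bar> powr p) + \<eta> * real n * q powr (p / 2) + (\<Sum>i<n. \<bar>w i\<bar> powr p)
      \<le> (\<Sum>i\<in>T. \<bar>y i\<bar> powr p) + (\<eta> + 2 * \<epsilon> powr p) * real n * q powr (p / 2)"
    using w by (simp add: algebra_simps)
  also have "(\<eta> + 2 * \<epsilon> powr p) * real n * q powr (p / 2) \<le> (\<eta> + 2 * \<epsilon> powr p) * real n * (2 * (ip n y y / real n) powr (p / 2))"
    using q' \<eta> by (intro mult_left_mono) auto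
  finally have "(\<Sum>i\<in>{..<n} - T. \<bar>y i\<bar> powr p) \<le> (\<Sum>i\<in>T. \<bar>y i\<bar> powr p) + 2 * (\<eta> + 2 * \<epsilon> powr p) * real n * (ip n y y / real n) powr (p / 2)"
    by (simp add: algebra_simps)
  then show ?thesis
    unfolding near_concentrated_def using T pos ipxy by (intro conjI bexI[of _ T]) auto
qed

text \<open>After rescaling \<open>y\<close> to the length of \<open>x\<close>, the squared distance
  is 2 |x|^2 times one minus the cosine, so a cosine of at least
  \<open>1 - \<epsilon>\<^sup>2 / 2\<close> gives relative distance at most
  \<open>\<epsilon>\<close>.\<close>

lemma near_concentrated_cap:
  assumes p: "0 < p" "p \<le> 1" and \<eta>: "0 \<le> \<eta>" and \<epsilon>: "0 < \<epsilon>" "\<epsilon> \<le> 1/2"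
    and nc: "near_concentrated n p \<rho> \<eta> x" and cap: "cap n (1 - \<epsilon>\<^sup>2 / 2) x y"
  shows "near_concentrated n p \<rho> (2 * (\<eta> + 2 * \<epsilon> powr p)) y"
proof -
  define X where "X = sqrt (ip n x x)"
  define Y where "Y = sqrt (ip n y y)"
  have XY: "0 < X" "0 < Y" "X * X = ip n x x" "Y * Y = ip n y y" "(1 - \<epsilon>\<^sup>2 / 2) * (X * Y) \<le> ip n x y"
    using cap by (auto simp: cap_def X_def Y_def)
  define t where "t = X / Y"
  have t: "0 < t" using XY by (simp add: t_def)
  have tY: "t * Y = X" using XY by (simp add: t_def)
  have "ip n (\<lambda>i. t * y i - x i) (\<lambda>i. t * y i - x i) = t * t * ip n y y - 2 * t * ip n x y + ip n x x"
    by (simp add: ip_def sum_distrib_left sum.distrib sum_subtractf algebra_simps) 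
  also have "t * t * ip n y y = (t * Y) * (t * Y)" by (simp only: XY(4)[symmetric] mult_ac)
  also have "(t * Y) * (t * Y) = X * X" by (simp only: tY)
  also have "X * X - 2 * t * ip n x y + ip n x x = 2 * (X * X) - 2 * (t * ip n x y)" using XY by simp
  also have "\<dots> \<le> 2 * (X * X) - 2 * (t * ((1 - \<epsilon>\<^sup>2 / 2) * (X * Y)))"
    using XY(5) t by (intro diff_left_mono mult_left_mono) auto
  also have "t * ((1 - \<epsilon>\<^sup>2 / 2) * (X * Y)) = (1 - \<epsilon>\<^sup>2 / 2) * X * (t * Y)" by (simp add: mult_ac)
  also have "2 * (X * X) - 2 * ((1 - \<epsilon>\<^sup>2 / 2) * X * (t * Y)) = \<epsilon>\<^sup>2 * ip n x x"
    unfolding tY XY(3)[symmetric] by (simp add: algebra_simps)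
  finally have "near_concentrated n p \<rho> (2 * (\<eta> + 2 * \<epsilon> powr p)) (\<lambda>i. t * y i)"
    by (intro near_concentrated_perturb[OF p \<eta> \<epsilon> nc])
  from near_concentrated_scale[OF _ this, of "1 / t"] t show ?thesis by simp
qed

text \<open>This removes the quantifier over \<open>T\<close>. For u = |x i|^p one has 2 (u -
  \<tau>) \<le> |u - \<tau>| + (u - \<tau>), and the right side is nonnegative, so its sum over
  \<open>T\<close> can be extended to all indices; the bound on \<open>card T\<close> turns
  \<open>2 * \<tau>\<close> per index of \<open>T\<close> into \<open>2 * \<rho> * \<tau>\<close>
  per coordinate. The slack becomes additive through
  \<open>q powr (p / 2) \<le> 1 + q\<close>.\<close>

lemma near_concentrated_sum_nonneg:
  assumes p: "0 < p" "p \<le> 1" and \<eta>: "0 \<le> \<eta>" and \<tau>: "0 \<le> \<tau>" and nc: "near_concentrated n p \<rho> \<eta> x"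
  shows "0 \<le> (\<Sum>i<n. \<bar>\<bar>x i\<bar> powr p - \<tau>\<bar> - \<tau> + (2 * \<rho> * \<tau> + \<eta> + \<eta> * (x i)\<^sup>2))"
proof -
  from nc obtain T where T: "T \<subseteq> {..<n}" "real (card T) \<le> \<rho> * real n" and pos: "0 < ip n x x" and
     le: "(\<Sum>i\<in>{..<n} - T. \<bar>x i\<bar> powr p) \<le> (\<Sum>i\<in>T. \<bar>x i\<bar> powr p) + \<eta> * real n * (ip n x x / real n) powr (p / 2)"
    by (auto simp: near_concentrated_def)
  have n: "0 < n" using pos by (auto simp: ip_self_pos_iff)
  define q where "q = ip n x x / real n"
  have q: "0 < q" using pos n by (simp add: q_def)
  define u where "u i = \<bar>x i\<bar> powr p" for i
  have "q powr (p / 2) \<le> 1 + q"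
  proof (cases "q \<le> 1")
    case True
    then have "q powr (p / 2) \<le> 1" using p q by (intro powr_le1) auto
    then show ?thesis using q by simp
  next
    case False
    then have "q powr (p / 2) \<le> q powr 1" using p by (intro powr_mono) auto
    then show ?thesis using q by simp
  qed
  then have "\<eta> * real n * q powr (p / 2) \<le> \<eta> * real n * (1 + q)" using \<eta> by (intro mult_left_mono) auto
  also have "\<dots> = \<eta> * real n + \<eta> * ip n x x" using n by (simp add: q_def field_simps)
  finally have 1: "(\<Sum>i\<in>{..<n} - T. u i) \<le> (\<Sum>i\<in>T. u i) + \<eta> * real n + \<eta> * ip n x x"
    using le by (simp add: u_def q_def)
  have 2: "(\<Sum>i<n. u i) = (\<Sum>i\<in>{..<n} - T. u i) + (\<Sum>i\<in>T. u i)"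
    using T(1) by (intro sum.subset_diff) auto
  have "2 * (\<Sum>i\<in>T. u i) = (\<Sum>i\<in>T. 2 * u i)" by (simp add: sum_distrib_left)
  also have "\<dots> \<le> (\<Sum>i\<in>T. 2 * \<tau> + (\<bar>u i - \<tau>\<bar> + (u i - \<tau>)))"
    by (intro sum_mono) auto
  also have "\<dots> = 2 * \<tau> * real (card T) + (\<Sum>i\<in>T. \<bar>u i - \<tau>\<bar> + (u i - \<tau>))" by (simp add: sum.distrib sum_subtractf)
  also have "\<dots> \<le> 2 * \<tau> * (\<rho> * real n) + (\<Sum>i<n. \<bar>u i - \<tau>\<bar> + (u i - \<tau>))"
    using T \<tau> by (intro add_mono mult_left_mono sum_mono2) auto
  finally have 3: "2 * (\<Sum>i\<in>T. u i) \<le> 2 * \<tau> * (\<rho> * real n) + (\<Sum>i<n. \<bar>u i - \<tau>\<bar>) + (\<Sum>i<n. u i) - real n * \<tau>"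
    by (simp add: sum.distrib sum_subtractf)
  have "(\<Sum>i<n. \<bar>u i - \<tau>\<bar> - \<tau> + (2 * \<rho> * \<tau> + \<eta> + \<eta> * (x i)\<^sup>2))
     = (\<Sum>i<n. \<bar>u i - \<tau>\<bar>) - real n * \<tau> + (real n * (2 * \<rho> * \<tau>) + real n * \<eta> + \<eta> * ip n x x)"
    by (simp add: sum.distrib sum_subtractf ip_def power2_eq_square sum_distrib_left algebra_simps)
  also have "0 \<le> \<dots>" using 1 2 3 by (simp add: algebra_simps)
  finally show ?thesis by (simp add: u_def)
qed

text \<open>A ball of fixed radius fits into the cone of the cap once its center is far enough out
  along the axis, and the shift bound gives it positive probability.\<close>

lemma cap_prob_pos:
  assumes n: "0 < n" and \<kappa>: "0 < \<kappa>" "\<kappa> < 1"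
  shows "0 < emeasure (gauss_vec n) {h \<in> space (gauss_vec n). cap n \<kappa> h (\<lambda>i. 1)}"
proof -
  interpret prob_space "gauss_vec n" by (rule prob_space_gauss_vec)
  \<comment> \<open>The trailing factor \<open>* 1\<close> displays \<open>v\<close> as a multiple
    of the constant vector, as \<open>cap_scale\<close> needs it at the end.\<close>
  define v :: "nat \<Rightarrow> real" where "v = (\<lambda>i. 1 / sqrt (real n) * 1)"
  have v: "ip n v v = 1" using n by (simp add: ip_def v_def)
  \<comment> \<open>The radius 2 sqrt n of the ball equals \<open>s\<close> times the sine that
    belongs to the cosine \<open>\<kappa>\<close>, so the ball around \<open>s * v\<close> touches
    the cone from inside.\<close>
  define s where "s = sqrt (4 * real n / (1 - \<kappa>\<^sup>2))"
  have k2: "\<kappa>\<^sup>2 < 1" using \<kappa> by (simp add: power_less_one_iff)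
  have s2: "s\<^sup>2 * (1 - \<kappa>\<^sup>2) = 4 * real n" using k2 by (simp add: s_def)
  have s: "0 < s" using n k2 by (simp add: s_def)
  \<comment> \<open>Zero rows make the projection the identity, so the shift bound speaks about
    \<open>h\<close> itself.\<close>
  have "(\<integral>x. ip n (gs_proj n (\<lambda>_. v) 0 x) (gs_proj n (\<lambda>_. v) 0 x) \<partial>gauss_vec n) \<le> real n"
    by (simp add: integral_norm_sq)
  from gauss_vec_shift_lower[OF this _ v] n s
  have "ennreal (exp (- 2 * s - s\<^sup>2 / 2) / 2) \<le> emeasure (gauss_vec n) {h \<in> space (gauss_vec n).
     ip n (\<lambda>i. h i - s * v i) (\<lambda>i. h i - s * v i) \<le> 4 * real n}" by simp
  also have "\<dots> \<le> emeasure (gauss_vec n) {h \<in> space (gauss_vec n). cap n \<kappa> h v}"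
  proof (rule emeasure_mono)
    show "{h \<in> space (gauss_vec n). ip n (\<lambda>i. h i - s * v i) (\<lambda>i. h i - s * v i) \<le> 4 * real n}
        \<subseteq> {h \<in> space (gauss_vec n). cap n \<kappa> h v}"
    proof safe
      fix h assume h: "ip n (\<lambda>i. h i - s * v i) (\<lambda>i. h i - s * v i) \<le> 4 * real n"
      have "ip n (\<lambda>i. h i - s * v i) (\<lambda>i. h i - s * v i) = ip n h h - 2 * s * ip n h v + s\<^sup>2"
        by (simp only: ip_diff_scale_left ip_diff_scale_right v ip_commute[of n v h]) (simp add: power2_eq_square algebra_simps)
      then have 1: "ip n h h - 2 * s * ip n h v + s\<^sup>2 \<le> s\<^sup>2 * (1 - \<kappa>\<^sup>2)" using h s2 by simp
      define X where "X = sqrt (ip n h h)"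
      have X: "X\<^sup>2 = ip n h h" "0 \<le> X" by (simp_all add: X_def)
      have "(X - s * \<kappa>)\<^sup>2 \<ge> 0" by simp
      then have "2 * s * (\<kappa> * X) \<le> X\<^sup>2 + s\<^sup>2 * \<kappa>\<^sup>2" by (simp add: power2_eq_square algebra_simps)
      also have "\<dots> \<le> 2 * s * ip n h v" using 1 X by (simp add: algebra_simps)
      finally have "\<kappa> * X \<le> ip n h v" using s by simp
      moreover have "0 < ip n h h"
      proof (rule ccontr)
        assume "\<not> ?thesis"
        then have z: "ip n h h = 0" using ip_self_nonneg[of n h] by linarith
        then have "ip n h v = 0" using ip_self_eq_0D[OF z, of v] by (simp add: ip_commute)
        then have "s\<^sup>2 \<le> s\<^sup>2 * (1 - \<kappa>\<^sup>2)" using 1 z by simp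
        then have "s\<^sup>2 * \<kappa>\<^sup>2 \<le> 0" by (simp add: algebra_simps)
        moreover have "0 < s\<^sup>2 * \<kappa>\<^sup>2" using s \<kappa> by simp
        ultimately show False by simp
      qed
      ultimately show "cap n \<kappa> h v" by (simp add: cap_def v X_def)
    qed
    have [measurable]: "Measurable.pred (gauss_vec n) (\<lambda>h. cap n \<kappa> h v)" by (rule measurable_cap) auto
    show "{h \<in> space (gauss_vec n). cap n \<kappa> h v} \<in> sets (gauss_vec n)" by measurable
  qed
  also have "(\<lambda>h. cap n \<kappa> h v) = (\<lambda>h. cap n \<kappa> h (\<lambda>i. 1))"
    unfolding v_def using n by (intro ext cap_scale) simp
  finally show ?thesis by (rule less_le_trans[rotated]) simp
qed

section \<open>Exact recovery\<close>

lemma near_concentrated_chernoff: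
  assumes p: "0 < p" "p \<le> 1" and \<rho>: "\<rho> < rho_star p"
  shows "\<exists>\<eta> a. 0 < \<eta> \<and> 0 < a \<and>
    (\<forall>n. measure (gauss_vec n) {h \<in> space (gauss_vec n). near_concentrated n p \<rho> \<eta> h} \<le> exp (- a * real n))"
proof -
  define \<tau> where "\<tau> = z_star p powr p"
  have \<tau>: "0 < \<tau>" using z_star_props(1)[OF p] by (simp add: \<tau>_def)
  define d where "d = \<tau> * (rho_star p - \<rho>)"
  have d: "0 < d" using \<tau> \<rho> by (simp add: d_def)
  \<comment> \<open>\<open>\<eta> \<le> d / 2\<close> keeps the mean
    \<open>- 2 * d + 2 * \<eta>\<close> of \<open>Y\<close> negative, and 1/16 is half of the growth
    allowance x^2 / 8; the other half goes to |x|^p.\<close>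
  define \<eta> where "\<eta> = min (1/16) (d / 2)"
  have \<eta>: "0 < \<eta>" "\<eta> \<le> 1/16" "2 * \<eta> \<le> d" using d by (auto simp: \<eta>_def)
  define Y where "Y x = \<bar>\<bar>x\<bar> powr p - \<tau>\<bar> - \<tau> + (2 * \<rho> * \<tau> + \<eta> + \<eta> * x\<^sup>2)" for x :: real
  have Ym[measurable]: "Y \<in> borel_measurable borel" unfolding Y_def[abs_def] by measurable
  note bal = std_gauss_balance[OF p, folded \<tau>_def]
  interpret finite_measure std_gauss by (rule finite_measure_std_gauss)
  have m1: "measure std_gauss UNIV = 1" using prob_space.prob_space[OF prob_space_std_gauss] by simp
  have sq: "(\<integral>x. x\<^sup>2 \<partial>std_gauss) = 1" using std_gauss_moments(4) by (simp add: power2_eq_square)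
  have "(\<integral>x. Y x \<partial>std_gauss) = - 2 * \<tau> * rho_star p + (2 * \<rho> * \<tau> + \<eta> + \<eta>)"
    unfolding Y_def using bal integrable_std_gauss_sq by (simp add: m1 sq)
  also have "\<dots> = - 2 * d + 2 * \<eta>" by (simp add: d_def algebra_simps)
  also have "\<dots> < 0" using \<eta> d by linarith
  finally have neg: "(\<integral>x. Y x \<partial>std_gauss) < 0" .
  have bound: "\<bar>Y x\<bar> \<le> (5 + \<bar>2 * \<rho> * \<tau>\<bar> + \<eta>) + x\<^sup>2 / 8" for x
  proof -
    have "\<bar>x\<bar> powr p \<le> 1 + \<bar>x\<bar>"
    proof (cases "\<bar>x\<bar> \<le> 1")
      case True
      then have "\<bar>x\<bar> powr p \<le> 1" using p by (simp add: powr_le1)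
      then show ?thesis by simp
    next
      case False
      then have "\<bar>x\<bar> powr p \<le> \<bar>x\<bar> powr 1" using p by (intro powr_mono) auto
      then show ?thesis by simp
    qed
    moreover have "\<bar>x\<bar> \<le> 4 + x\<^sup>2 / 16"
    proof -
      have "0 \<le> (\<bar>x\<bar> / 4 - 2)\<^sup>2" by simp
      then show ?thesis by (simp add: power2_eq_square algebra_simps)
    qed
    moreover have "\<bar>\<bar>\<bar>x\<bar> powr p - \<tau>\<bar> - \<tau>\<bar> \<le> \<bar>x\<bar> powr p" using \<tau> by (auto simp: abs_if)
    moreover have "\<eta> * x\<^sup>2 \<le> 1/16 * x\<^sup>2" by (rule mult_right_mono[OF \<eta>(2) zero_le_power2])
    moreover have "0 \<le> \<eta> * x\<^sup>2" using \<eta> by simp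
    ultimately show ?thesis unfolding Y_def using \<eta>(1) by linarith
  qed
  obtain a where a: "0 < a"
    "\<And>n. measure (gauss_vec n) {h \<in> space (gauss_vec n). 0 \<le> (\<Sum>i<n. Y (h i))} \<le> exp (- a * real n)"
    using gauss_vec_chernoff[OF Ym bound neg] by auto
  have "measure (gauss_vec n) {h \<in> space (gauss_vec n). near_concentrated n p \<rho> \<eta> h} \<le> exp (- a * real n)" for n
  proof -
    interpret G: prob_space "gauss_vec n" by (rule prob_space_gauss_vec)
    have [measurable]: "(\<lambda>h. \<Sum>i<n. Y (h i)) \<in> borel_measurable (gauss_vec n)"
      by (intro borel_measurable_sum measurable_compose[OF measurable_gauss_vec_component Ym]) auto
    have "G.prob {h \<in> space (gauss_vec n). near_concentrated n p \<rho> \<eta> h} \<le> G.prob {h \<in> space (gauss_vec n). 0 \<le> (\<Sum>i<n. Y (h i))}"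
    proof (rule G.finite_measure_mono)
      show "{h \<in> space (gauss_vec n). near_concentrated n p \<rho> \<eta> h} \<subseteq> {h \<in> space (gauss_vec n). 0 \<le> (\<Sum>i<n. Y (h i))}"
        using near_concentrated_sum_nonneg[OF p, of \<eta> \<tau> n \<rho>] \<eta> \<tau> by (auto simp: Y_def)
    qed measurable
    then show ?thesis using a(2)[of n] by linarith
  qed
  then show ?thesis using \<eta>(1) a(1) by blast
qed

lemma null_space_concentrated_prob:
  assumes p: "0 < p" "p \<le> 1" and \<rho>: "\<rho> < rho_star p"
  shows "\<exists>c c' N. 0 < c \<and> c < 1 \<and> 0 < c' \<and> (\<forall>m n. N \<le> n \<and> c * real n < real m \<longrightarrow>
    (\<exists>S\<in>sets (gauss_rows m n). (\<forall>A\<in>S. \<forall>v. ip n v v = 1 \<and> (\<forall>i<m. ip n (A i) v = 0) \<longrightarrow> \<not> near_concentrated n p \<rho> 0 v) \<and>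
       1 - exp (- c' * real n) \<le> measure (gauss_rows m n) S))"
proof -
  obtain \<eta> a where \<eta>: "0 < \<eta>" and a: "0 < a" and
    bnd: "\<And>n. measure (gauss_vec n) {h \<in> space (gauss_vec n). near_concentrated n p \<rho> \<eta> h} \<le> exp (- a * real n)"
    using near_concentrated_chernoff[OF assms] by auto
  \<comment> \<open>The projection noise enlarges the slack from 0 to
    \<open>4 * \<epsilon> powr p\<close>, and the cap then to
    \<open>2 * (4 + 2) * \<epsilon> powr p\<close>; hence the 12.\<close>
  define \<epsilon> where "\<epsilon> = min (1/2) ((\<eta> / 12) powr (1 / p))"
  have \<epsilon>: "0 < \<epsilon>" "\<epsilon> \<le> 1/2" using \<eta> by (auto simp: \<epsilon>_def)
  have \<epsilon>p: "12 * \<epsilon> powr p \<le> \<eta>"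
  proof -
    have "\<epsilon> powr p \<le> ((\<eta> / 12) powr (1 / p)) powr p" using p \<epsilon> by (intro powr_mono2) (auto simp: \<epsilon>_def)
    also have "\<dots> = \<eta> / 12" using p \<eta> by (simp add: powr_powr)
    finally show ?thesis by simp
  qed
  \<comment> \<open>Shift energy per coordinate. With \<open>b \<le> a / 2\<close> the price exp
    (s^2) of the shift takes half of the Chernoff rate; a quarter absorbs the factor 2, and a
    quarter remains as the final rate.\<close>
  define b where "b = min (a / 2) 1"
  have b: "0 < b" "b \<le> a / 2" "b \<le> 1" using a by (auto simp: b_def)
  \<comment> \<open>The admissible fraction of missing rows: the squared noise
    \<open>4 * k * n\<close> is then the fraction \<open>\<epsilon>\<^sup>2\<close> of the squared
    shift length \<open>b * n\<close>.\<close>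
  define k where "k = b * \<epsilon>\<^sup>2 / 4"
  have e2: "\<epsilon>\<^sup>2 \<le> 1/4" using power_mono[of \<epsilon> "1/2" 2] \<epsilon> by (simp add: power2_eq_square)
  have "b * \<epsilon>\<^sup>2 \<le> 1 * (1/4)" using b e2 by (intro mult_mono) auto
  then have k: "0 < k" "k < 1" using b \<epsilon> by (auto simp: k_def)
  define \<kappa> where "\<kappa> = 1 - \<epsilon>\<^sup>2 / 2"
  have \<kappa>: "0 < \<kappa>" "\<kappa> < 1" using e2 \<epsilon> by (auto simp: \<kappa>_def)
  \<comment> \<open>\<open>n \<ge> 2\<close> is for the rotations, \<open>16 / b\<close> gives
    \<open>s \<ge> 4\<close> and so \<open>2 * s \<le> s\<^sup>2 / 2\<close>, and
    \<open>4 / a\<close> lets exp (a n / 4) absorb the factor 2.\<close>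
  define N where "N = nat \<lceil>max 2 (max (16 / b) (4 / a))\<rceil>"
  have "\<exists>S\<in>sets (gauss_rows m n). (\<forall>A\<in>S. \<forall>v. ip n v v = 1 \<and> (\<forall>i<m. ip n (A i) v = 0) \<longrightarrow> \<not> near_concentrated n p \<rho> 0 v) \<and>
       1 - exp (- (a / 4) * real n) \<le> measure (gauss_rows m n) S"
    if n: "N \<le> n" and m: "(1 - k) * real n < real m" for m n
  proof -
    have "real N \<le> real n" using n by simp
    then have "max 2 (max (16 / b) (4 / a)) \<le> real n" unfolding N_def by linarith
    then have "2 \<le> real n" and nb': "16 / b \<le> real n" and na': "4 / a \<le> real n" by auto
    then have n2: "2 \<le> n" by simp
    have nb: "16 \<le> b * real n" using nb' b(1) by (simp add: field_simps)
    have na: "4 \<le> a * real n" using na' a by (simp add: field_simps)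
    define s where "s = sqrt (b * real n)"
    have s2: "s\<^sup>2 = b * real n" using b by (simp add: s_def)
    have "sqrt (4\<^sup>2) \<le> s" unfolding s_def using nb by (intro real_sqrt_le_mono) simp
    then have s4: "4 \<le> s" by simp
    have ke: "4 * (k * real n) = \<epsilon>\<^sup>2 * s\<^sup>2" by (simp add: k_def s2)
    \<comment> \<open>\<open>m\<close> may exceed \<open>n\<close>. Then the first \<open>n\<close>
      rows are used, whose common null space contains that of the whole matrix.\<close>
    define j where "j = min m n"
    have j: "j \<le> m" "j \<le> n" by (auto simp: j_def)
    have je: "real n - real j \<le> k * real n"
      using m k by (cases "m \<le> n") (auto simp: j_def algebra_simps)
    have ke0: "0 < k * real n" using k n2 by simp
    have nc_meas: "Measurable.pred (gauss_rows m n \<Otimes>\<^sub>M gauss_vec n) (\<lambda>q. near_concentrated n p \<rho> (4 * \<epsilon> powr p) (gs_proj n (fst q) j (snd q)))"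
      using j by (intro measurable_near_concentrated measurable_gs_proj measurable_compose[OF measurable_fst measurable_gauss_rows_component]
       measurable_compose[OF measurable_snd measurable_gauss_vec_component]) auto
    have nc_meas2: "Measurable.pred (gauss_vec n) (near_concentrated n p \<rho> \<eta>)"
      using measurable_near_concentrated[of n "\<lambda>x. x" "gauss_vec n"] measurable_gauss_vec_component by auto
    have "\<exists>S\<in>sets (gauss_rows m n). (\<forall>A\<in>S. \<forall>v. ip n v v = 1 \<and> (\<forall>i<j. ip n (A i) v = 0) \<longrightarrow> \<not> near_concentrated n p \<rho> 0 v) \<and>
       1 - 2 * exp (2 * s + s\<^sup>2 / 2) * measure (gauss_vec n) {h \<in> space (gauss_vec n). near_concentrated n p \<rho> \<eta> h} \<le> measure (gauss_rows m n) S"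
    proof (rule null_space_avoids[OF n2 j je ke0 _ nc_meas nc_meas2])
      show "0 \<le> s" using s4 by simp
      show "near_concentrated n p \<rho> (4 * \<epsilon> powr p) x"
        if v: "near_concentrated n p \<rho> 0 v" "ip n v v = 1" and close: "ip n (\<lambda>i. x i - s * v i) (\<lambda>i. x i - s * v i) \<le> 4 * (k * real n)" for v x
      proof -
        have "near_concentrated n p \<rho> 0 (\<lambda>i. s * v i)" using s4 by (intro near_concentrated_scale v) simp
        moreover have "ip n (\<lambda>i. s * v i) (\<lambda>i. s * v i) = s\<^sup>2" by (simp add: ip_scale_left ip_scale_right v power2_eq_square)
        ultimately have "near_concentrated n p \<rho> (2 * (0 + 2 * \<epsilon> powr p)) x"
          using close unfolding ke by (intro near_concentrated_perturb[OF p _ \<epsilon>]) auto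
        then show ?thesis by simp
      qed
      show "0 < ip n x x" if "near_concentrated n p \<rho> (4 * \<epsilon> powr p) x" for x
        using that by (simp add: near_concentrated_def)
      show "near_concentrated n p \<rho> \<eta> y" if "near_concentrated n p \<rho> (4 * \<epsilon> powr p) x" "cap n \<kappa> x y" for x y
      proof -
        have "near_concentrated n p \<rho> (2 * (4 * \<epsilon> powr p + 2 * \<epsilon> powr p)) y"
          using that unfolding \<kappa>_def by (intro near_concentrated_cap[OF p _ \<epsilon>]) auto
        then show ?thesis by (rule near_concentrated_mono) (use \<epsilon>p in simp)
      qed
      show "0 < emeasure (gauss_vec n) {h \<in> space (gauss_vec n). cap n \<kappa> h (\<lambda>i. 1)}"
        using n2 \<kappa> by (intro cap_prob_pos) auto
    qed
    then obtain S where S: "S \<in> sets (gauss_rows m n)"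
      "\<And>A v. A \<in> S \<Longrightarrow> ip n v v = 1 \<Longrightarrow> (\<forall>i<j. ip n (A i) v = 0) \<Longrightarrow> \<not> near_concentrated n p \<rho> 0 v"
      "1 - 2 * exp (2 * s + s\<^sup>2 / 2) * measure (gauss_vec n) {h \<in> space (gauss_vec n). near_concentrated n p \<rho> \<eta> h} \<le> measure (gauss_rows m n) S"
      by blast
    have "2 * exp (2 * s + s\<^sup>2 / 2) * measure (gauss_vec n) {h \<in> space (gauss_vec n). near_concentrated n p \<rho> \<eta> h}
       \<le> exp (a * real n / 4) * exp (a * real n / 2) * exp (- a * real n)"
    proof (intro mult_mono bnd)
      have "2 \<le> 1 + a * real n / 4" using na by simp
      also have "\<dots> \<le> exp (a * real n / 4)" by (rule exp_ge_add_one_self)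
      finally show "2 \<le> exp (a * real n / 4)" .
      have "4 * s \<le> s * s" using s4 by (intro mult_right_mono) auto
      then have "2 * s + s\<^sup>2 / 2 \<le> s\<^sup>2" by (simp add: power2_eq_square)
      also have "\<dots> \<le> a / 2 * real n" unfolding s2 using b by (intro mult_right_mono) auto
      finally show "exp (2 * s + s\<^sup>2 / 2) \<le> exp (a * real n / 2)" by simp
    qed auto
    also have "\<dots> = exp (- (a / 4) * real n)" by (simp flip: exp_add)
    finally show ?thesis using S j by (intro bexI[of _ S]) auto
  qed
  then show ?thesis using k a by (intro exI[of _ "1 - k"] exI[of _ "a / 4"] exI[of _ N]) auto
qed

section \<open>Transfer to the entrywise matrix measure and the null space criterion\<close>

lemma distr_gauss_rows_uncurry:
  "distr (gauss_rows m n) (gauss_matrix m n) (\<lambda>A. \<lambda>q\<in>{..<m} \<times> {..<n}. A (fst q) (snd q)) = gauss_matrix m n"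
  (is "distr _ _ ?u = _")
proof -
  have gm: "gauss_matrix m n = PiM ({..<m} \<times> {..<n}) (\<lambda>_. std_gauss)"
    by (simp add: gauss_matrix_def std_gauss_def)
  have u: "?u \<in> gauss_rows m n \<rightarrow>\<^sub>M gauss_matrix m n"
    unfolding gm by (rule measurable_restrict) (auto intro!: measurable_gauss_rows_component cong: measurable_cong_sets)
  interpret GV: product_prob_space "\<lambda>_. gauss_vec n" I for I :: "nat set"
    by (simp add: product_prob_spaceI prob_space_gauss_vec)
  show ?thesis
    unfolding gm
  proof (rule SG.PiM_eqI)
    fix B assume B: "\<And>q. q \<in> {..<m} \<times> {..<n} \<Longrightarrow> B q \<in> sets std_gauss"
    have pre: "?u -` (\<Pi>\<^sub>E q\<in>{..<m} \<times> {..<n}. B q) \<inter> space (gauss_rows m n)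
        = (\<Pi>\<^sub>E i\<in>{..<m}. \<Pi>\<^sub>E k\<in>{..<n}. B (i, k))"
      by (auto simp: gauss_rows_def gauss_vec_def space_PiM PiE_iff)
    have "emeasure (distr (gauss_rows m n) (PiM ({..<m} \<times> {..<n}) (\<lambda>_. std_gauss)) ?u) (\<Pi>\<^sub>E q\<in>{..<m} \<times> {..<n}. B q)
       = emeasure (gauss_rows m n) (\<Pi>\<^sub>E i\<in>{..<m}. \<Pi>\<^sub>E k\<in>{..<n}. B (i, k))"
      unfolding pre[symmetric] using u[unfolded gm] B by (intro emeasure_distr sets_PiM_I_finite) auto
    also have "\<dots> = (\<Prod>i<m. emeasure (gauss_vec n) (\<Pi>\<^sub>E k\<in>{..<n}. B (i, k)))"
      unfolding gauss_rows_def by (rule GV.emeasure_PiM) (use B in \<open>auto simp: gauss_vec_def intro!: sets_PiM_I_finite\<close>)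
    also have "\<dots> = (\<Prod>i<m. \<Prod>k<n. emeasure std_gauss (B (i, k)))"
      unfolding gauss_vec_def by (intro prod.cong refl SG.emeasure_PiM) (use B in auto)
    also have "\<dots> = (\<Prod>q\<in>{..<m} \<times> {..<n}. emeasure std_gauss (B q))"
      by (simp add: prod.cartesian_product)
    finally show "emeasure (distr (gauss_rows m n) (PiM ({..<m} \<times> {..<n}) (\<lambda>_. std_gauss)) ?u) (\<Pi>\<^sub>E q\<in>{..<m} \<times> {..<n}. B q)
       = (\<Prod>q\<in>{..<m} \<times> {..<n}. emeasure std_gauss (B q))" .
  qed auto
qed

text \<open>Failure of strict minimality is \<open>lpp p n v \<le> lpp p n x\<close>, from which the
  non-strict cone inequality for \<open>w\<close> follows; ties are thus ruled out too, which gives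
  uniqueness. The support of \<open>x\<close> serves as \<open>T\<close>, since \<open>w\<close>
  agrees with \<open>v\<close> outside it, and homogeneity moves \<open>w\<close> to the unit
  sphere.\<close>

lemma lp_recovers_if_null_space:
  assumes p: "0 < p" "p \<le> 1"
    and ns: "\<And>v. ip n v v = 1 \<Longrightarrow> \<forall>j<m. ip n (\<lambda>i. A (j, i)) v = 0 \<Longrightarrow> \<not> near_concentrated n p \<rho> 0 v"
  shows "lp_recovers p \<rho> m n A"
  unfolding lp_recovers_def
proof (intro allI impI, elim conjE)
  fix x v
  assume x0: "\<forall>i\<ge>n. x i = 0" and card: "real (card {i. i < n \<and> x i \<noteq> 0}) \<le> \<rho> * real n"
    and v0: "\<forall>i\<ge>n. v i = 0" and eq: "mat_vec m n A v = mat_vec m n A x" and ne: "v \<noteq> x"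
  define w where "w i = v i - x i" for i
  have "\<exists>i<n. w i \<noteq> 0"
  proof (rule ccontr)
    assume "\<not> ?thesis"
    then have "v i = x i" for i using x0 v0 by (cases "i < n") (auto simp: w_def)
    then show False using ne by auto
  qed
  then have w: "0 < ip n w w" by (simp add: ip_self_pos_iff)
  have null: "ip n (\<lambda>i. A (j, i)) w = 0" if "j < m" for j
  proof -
    have "(\<Sum>i<n. A (j, i) * v i) = (\<Sum>i<n. A (j, i) * x i)"
      using fun_cong[OF eq, of j] that by (simp add: mat_vec_def)
    then show ?thesis by (simp add: ip_def w_def right_diff_distrib sum_subtractf)
  qed
  show "lpp p n x < lpp p n v"
  proof (rule ccontr)
    assume "\<not> ?thesis"
    then have le: "lpp p n v \<le> lpp p n x" by simp
    define T where "T = {i. i < n \<and> x i \<noteq> 0}"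
    have T: "T \<subseteq> {..<n}" by (auto simp: T_def)
    have split: "(\<Sum>i<n. f i) = (\<Sum>i\<in>{..<n} - T. f i) + (\<Sum>i\<in>T. f i)" for f :: "nat \<Rightarrow> real"
      using T by (intro sum.subset_diff) auto
    have "(\<Sum>i\<in>{..<n} - T. \<bar>v i\<bar> powr p) = (\<Sum>i\<in>{..<n} - T. \<bar>w i\<bar> powr p)"
      by (rule sum.cong) (auto simp: w_def T_def)
    moreover have "(\<Sum>i\<in>{..<n} - T. \<bar>x i\<bar> powr p) = 0"
      by (rule sum.neutral) (use p in \<open>auto simp: T_def\<close>)
    moreover have "(\<Sum>i\<in>T. \<bar>x i\<bar> powr p) \<le> (\<Sum>i\<in>T. \<bar>v i\<bar> powr p + \<bar>w i\<bar> powr p)"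
    proof (rule sum_mono)
      fix i show "\<bar>x i\<bar> powr p \<le> \<bar>v i\<bar> powr p + \<bar>w i\<bar> powr p"
        using abs_add_powr_le[OF p, of "v i" "- w i"] by (simp add: w_def abs_minus_commute)
    qed
    ultimately have "(\<Sum>i\<in>{..<n} - T. \<bar>w i\<bar> powr p) \<le> (\<Sum>i\<in>T. \<bar>w i\<bar> powr p)"
      using le by (simp add: lpp_def split sum.distrib)
    then have nc: "near_concentrated n p \<rho> 0 w"
      unfolding near_concentrated_def using w T card by (intro conjI bexI[of _ T]) (auto simp: T_def)
    define t where "t = 1 / sqrt (ip n w w)"
    have t: "0 < t" using w by (simp add: t_def)
    have "ip n (\<lambda>i. t * w i) (\<lambda>i. t * w i) = t * t * ip n w w"
      by (simp add: ip_scale_left ip_scale_right)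
    also have "\<dots> = 1" using w by (simp add: t_def)
    finally have "ip n (\<lambda>i. t * w i) (\<lambda>i. t * w i) = 1" .
    moreover have "\<forall>j<m. ip n (\<lambda>i. A (j, i)) (\<lambda>i. t * w i) = 0"
      using null by (simp add: ip_scale_right)
    ultimately show False using ns near_concentrated_scale[OF t nc] by blast
  qed
qed

theorem theorem5:
  fixes p \<rho> :: real
  assumes "0 < p" and "p \<le> 1" and "\<rho> < rho_star p"
  shows "\<exists>c4 c5::real. 0 < c4 \<and> c4 < 1 \<and> 0 < c5 \<and>
           (\<forall>\<alpha>::real. \<alpha> > c4 \<longrightarrow>
              (\<exists>N::nat. \<forall>m n::nat. n \<ge> N \<and> real m = \<alpha> * real n \<longrightarrow>
                 (\<exists>S \<in> sets (gauss_matrix m n).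
                    S \<subseteq> {A \<in> space (gauss_matrix m n). lp_recovers p \<rho> m n A} \<and>
                    measure (gauss_matrix m n) S \<ge> 1 - exp (- c5 * real n))))"
proof -
  obtain c c' :: real and N where c: "0 < c" "c < 1" "0 < c'" and
    N: "\<And>m n. N \<le> n \<Longrightarrow> c * real n < real m \<Longrightarrow>
      \<exists>S\<in>sets (gauss_rows m n). (\<forall>A\<in>S. \<forall>v. ip n v v = 1 \<and> (\<forall>i<m. ip n (A i) v = 0) \<longrightarrow> \<not> near_concentrated n p \<rho> 0 v) \<and>
       1 - exp (- c' * real n) \<le> measure (gauss_rows m n) S"
    using null_space_concentrated_prob[OF assms] by blast
  \<comment> \<open>\<open>n \<ge> 1\<close> makes \<open>c * n < \<alpha> * n\<close> strict. The
    same bound on \<open>n\<close> and the same rate serve every \<open>\<alpha>\<close>.\<close>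
  have "\<exists>S\<in>sets (gauss_matrix m n). S \<subseteq> {A \<in> space (gauss_matrix m n). lp_recovers p \<rho> m n A} \<and>
      1 - exp (- c' * real n) \<le> measure (gauss_matrix m n) S"
    if n: "max N 1 \<le> n" and m: "real m = \<alpha> * real n" and \<alpha>: "c < \<alpha>" for \<alpha> m n
  proof -
    have "c * real n < real m" using n \<alpha> by (simp add: m)
    then obtain S where S: "S \<in> sets (gauss_rows m n)"
      "\<And>A v. A \<in> S \<Longrightarrow> ip n v v = 1 \<Longrightarrow> \<forall>i<m. ip n (A i) v = 0 \<Longrightarrow> \<not> near_concentrated n p \<rho> 0 v"
      "1 - exp (- c' * real n) \<le> measure (gauss_rows m n) S"
      using N[of n m] n by auto
    have gm: "gauss_matrix m n = PiM ({..<m} \<times> {..<n}) (\<lambda>_. std_gauss)"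
      by (simp add: gauss_matrix_def std_gauss_def)
    define cur :: "(nat \<times> nat \<Rightarrow> real) \<Rightarrow> nat \<Rightarrow> nat \<Rightarrow> real" where "cur = (\<lambda>A. \<lambda>i\<in>{..<m}. \<lambda>k\<in>{..<n}. A (i, k))"
    define unc :: "(nat \<Rightarrow> nat \<Rightarrow> real) \<Rightarrow> nat \<times> nat \<Rightarrow> real" where "unc = (\<lambda>A. \<lambda>q\<in>{..<m} \<times> {..<n}. A (fst q) (snd q))"
    have cm: "cur \<in> gauss_matrix m n \<rightarrow>\<^sub>M gauss_rows m n"
      unfolding gm gauss_rows_def gauss_vec_def cur_def
      by (intro measurable_restrict measurable_component_singleton) auto
    have um: "unc \<in> gauss_rows m n \<rightarrow>\<^sub>M gauss_matrix m n"
      unfolding gm unc_def by (rule measurable_restrict) (auto intro!: measurable_gauss_rows_component cong: measurable_cong_sets)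
    have cu: "cur (unc A) = A" if "A \<in> space (gauss_rows m n)" for A
    proof (intro ext)
      fix i k
      show "cur (unc A) i k = A i k"
        using that by (cases "i < m"; cases "k < n")
          (auto simp: cur_def unc_def gauss_rows_def gauss_vec_def space_PiM PiE_iff extensional_def)
    qed
    \<comment> \<open>Preimage of the row event under currying: a measurable set inside the recovery
      event, so no measurability of the latter enters.\<close>
    define S' where "S' = cur -` S \<inter> space (gauss_matrix m n)"
    have S': "S' \<in> sets (gauss_matrix m n)" unfolding S'_def by (rule measurable_sets[OF cm S(1)])
    have "measure (gauss_matrix m n) S' = measure (distr (gauss_rows m n) (gauss_matrix m n) unc) S'"
      by (simp add: distr_gauss_rows_uncurry unc_def)
    also have "\<dots> = measure (gauss_rows m n) (unc -` S' \<inter> space (gauss_rows m n))"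
      by (rule measure_distr[OF um S'])
    also have "unc -` S' \<inter> space (gauss_rows m n) = S"
      using cu measurable_space[OF um] sets.sets_into_space[OF S(1)] by (auto simp: S'_def)
    finally have "1 - exp (- c' * real n) \<le> measure (gauss_matrix m n) S'" using S(3) by simp
    moreover have "lp_recovers p \<rho> m n A" if "A \<in> S'" for A
    proof (rule lp_recovers_if_null_space[OF assms(1,2)])
      fix v assume v: "ip n v v = 1" "\<forall>j<m. ip n (\<lambda>i. A (j, i)) v = 0"
      have "ip n (cur A i) v = ip n (\<lambda>k. A (i, k)) v" if "i < m" for i
        using that by (intro ip_cong) (auto simp: cur_def)
      then show "\<not> near_concentrated n p \<rho> 0 v" using S(2)[of "cur A" v] v \<open>A \<in> S'\<close> by (auto simp: S'_def)
    qed
    ultimately show ?thesis using S' by (intro bexI[of _ S']) (auto simp: S'_def)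
  qed
  then have "\<forall>\<alpha>. \<alpha> > c \<longrightarrow> (\<exists>N::nat. \<forall>m n::nat. n \<ge> N \<and> real m = \<alpha> * real n \<longrightarrow>
                 (\<exists>S \<in> sets (gauss_matrix m n).
                    S \<subseteq> {A \<in> space (gauss_matrix m n). lp_recovers p \<rho> m n A} \<and>
                    measure (gauss_matrix m n) S \<ge> 1 - exp (- c' * real n)))"
    by blast
  with c show ?thesis by blast
qed

end
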